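(* Let $\mathcal{D}$ be a standardizable $n$-dimensional Ferrers diagram, $I_{\mathcal{D}}$ the Ferrers ideal associated with $\mathcal{D}$, $r$ a positive integer, and $\widetilde{\mathcal{D}_r}=\mathcal{D}\times[r]$. Then the set $\mathcal{G}=\mathbf{I}(\widetilde{\mathcal{D}_r})$ is a Gröbner basis, with respect to the monomial order $\sigma$, of the presentation ideal $\mathcal{K}$ of the special fiber ring $\mathcal{F}(\bigoplus_{i=1}^{r}I_{\mathcal{D}})$. In particular, $\mathcal{F}(\bigoplus_{i=1}^{r}I_{\mathcal{D}})$ is Koszul.
   Context: $\mathbb{K}$ is a field, $\mathbb{Z}_+$ the set of positive integers, $[p]=\{1,\dots,p\}$. An $n$-dimensional Ferrers diagram is a nonempty finite set $\mathcal{D}\subset\mathbb{Z}_+^n$ such that if $(j_1,\dots,j_n)\in\mathcal{D}$ and $(i_1,\dots,i_n)\in\mathbb{Z}_+^n$ with $i_k\le j_k$ for all $k\in[n]$, then $(i_1,\dots,i_n)\in\mathcal{D}$. Fix an integer $m\ge\max\{j_1,\dots,j_n:(j_1,\dots,j_n)\in\mathcal{D}\}$ and let $R=\mathbb{K}[x_{i,j}:i\in[n],j\in[m]]$. For $\boldsymbol{a}=(a_1,\dots,a_n)\in\mathcal{D}$ put $\boldsymbol{x}_{\boldsymbol{a}}=\prod_{i=1}^n x_{i,a_i}$; the Ferrers ideal is $I_{\mathcal{D}}=(\boldsymbol{x}_{\boldsymbol{a}}:\boldsymbol{a}\in\mathcal{D})\subset R$. $\mathcal{D}$ is standardizable if for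 all $\boldsymbol{a}\ne\boldsymbol{b}\in\mathcal{D}$ and $k$ with $a_i=b_i$ for $i<k$ and $a_k<b_k$, the point $(a_1,\dots,a_k,\max\{a_{k+1},b_{k+1}\},\dots,\max\{a_n,b_n\})$ lies in $\mathcal{D}$. $\widetilde{\mathcal{D}_r}=\mathcal{D}\times[r]$ is an $(n+1)$-dimensional Ferrers diagram. The special fiber ring $\mathcal{F}(\bigoplus_{i=1}^r I_{\mathcal{D}})$ is $\mathcal{R}(\bigoplus_{i=1}^r I_{\mathcal{D}})\otimes_R\mathbb{K}$, where $\mathcal{R}(\bigoplus_{i=1}^r I_{\mathcal{D}})=R[\boldsymbol{x}_{\boldsymbol{a}}t_i:\boldsymbol{a}\in\mathcal{D},i\in[r]]\subseteq R[t_1,\dots,t_r]$ is the multi-Rees algebra; it is isomorphic to $\mathbb{K}[\boldsymbol{x}_{\boldsymbol{a}}t_i:\boldsymbol{a}\in\mathcal{D},i\in[r]]$. Its presentation ideal $\mathcal{K}$ is the kernel of the $\mathbb{K}$-algebra map $\mathbb{K}[T_{(\boldsymbol{a},i)}:(\boldsymbol{a},i)\in\widetilde{\mathcal{D}_r}]\to\mathbb{K}[\boldsymbol{x}_{\boldsymbol{a}}t_i]$, $T_{(\boldsymbol{a},i)}\mapsto\boldsymbol{x}_{\boldsymbol{a}}t_i$. For an $N$-dimensional Ferrers diagram $\mathcal{E}$, a subset $H\subseteq[N]$ and $\boldsymbol{a},\boldsymbol{b}\in\mathcal{E}$, let $\boldsymbol{p},\boldsymbol{q}$ be obtained from $\boldsymbol{a},\boldsymbol{b}$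 by exchanging the coordinates in $H$: $p_i=a_i,q_i=b_i$ if $i\notin H$, and $p_i=b_i,q_i=a_i$ if $i\in H$. Set $\mathbf{I}_H(\boldsymbol{a},\boldsymbol{b})=T_{\boldsymbol{a}}T_{\boldsymbol{b}}-T_{\boldsymbol{p}}T_{\boldsymbol{q}}\in\mathbb{K}[T_{\boldsymbol{c}}:\boldsymbol{c}\in\mathcal{E}]$ if $\boldsymbol{p},\boldsymbol{q}\in\mathcal{E}$, and $\mathbf{I}_H(\boldsymbol{a},\boldsymbol{b})=0$ otherwise. Then $\mathbf{I}(\mathcal{E})=\{\mathbf{I}_H(\boldsymbol{a},\boldsymbol{b}):H\subseteq[N],\ \boldsymbol{a},\boldsymbol{b}\in\mathcal{E},\ \mathbf{I}_H(\boldsymbol{a},\boldsymbol{b})\ne0\}$. Order $\sigma$: for $\boldsymbol{a},\boldsymbol{b}\in\mathbb{Z}_+^{N}$, $\boldsymbol{a}>_\sigma\boldsymbol{b}$ if the first nonzero entry of $\boldsymbol{a}-\boldsymbol{b}$ is negative. Variables are ordered by $T_{\boldsymbol{a}}>T_{\boldsymbol{b}}$ iff $\boldsymbol{a}>_\sigma\boldsymbol{b}$, and the induced lexicographic monomial order on $\mathbb{K}[T_{\boldsymbol{c}}:\boldsymbol{c}\in\mathcal{E}]$ is also denoted $\sigma$ (used here with $\mathcal{E}=\widetilde{\mathcal{D}_r}$, $N=n+1$). A standard graded $\mathbb{K}$-algebra is Koszul if the residue field $\mathbb{K}$ has a linear resolution over it. *)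

theory Defs
  imports
    "HOL-Library.Poly_Mapping"
    "HOL-Library.FuncSet"
    "HOL-Algebra.Algebraic_Closure_Type"
    "HOL-Algebra.QuotRing"
    "HOL-Algebra.Generated_Rings"
begin

section \<open>Polynomial rings\<close>

text \<open>
  Monomials are exponent vectors of type \<^typ>\<open>'v \<Rightarrow>\<^sub>0 nat\<close>. The polynomial ring in the variables
  \<^term>\<open>V :: 'v set\<close> is the subring, of the ring of all polynomials with variables from the
  type, of those polynomials that involve only variables of \<^term>\<open>V\<close>.
\<close>

type_synonym ('v, 'k) mpoly = "('v \<Rightarrow>\<^sub>0 nat) \<Rightarrow>\<^sub>0 'k"

definition mvar :: "'v \<Rightarrow> ('v, 'k::field) mpoly" where
  "mvar v = Poly_Mapping.single (Poly_Mapping.single v 1) 1"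

definition mconst :: "'k \<Rightarrow> ('v, 'k::field) mpoly" where
  "mconst c = Poly_Mapping.single 0 c"

definition mpoly_ring :: "'v set \<Rightarrow> ('v, 'k::field) mpoly ring" where
  "mpoly_ring V = ring_of_type_algebra \<lparr>carrier := {f. \<forall>u\<in>Poly_Mapping.keys f. Poly_Mapping.keys u \<subseteq> V}\<rparr>"

text \<open>The algebra homomorphism that sends each variable \<^term>\<open>v\<close> to \<^term>\<open>\<phi> v\<close>.\<close>

definition msubst :: "('v \<Rightarrow> ('w, 'k) mpoly) \<Rightarrow> ('v, 'k::field) mpoly \<Rightarrow> ('w, 'k) mpoly" where
  "msubst \<phi> f = (\<Sum>u\<in>Poly_Mapping.keys f.
     mconst (Poly_Mapping.lookup f u) * (\<Prod>v\<in>Poly_Mapping.keys u. \<phi> v ^ Poly_Mapping.lookup u v))"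


section \<open>Initial monomials and Groebner bases\<close>

text \<open>
  Here \<^term>\<open>gt u v\<close> means that the monomial \<^term>\<open>u\<close> is strictly larger than \<^term>\<open>v\<close>. The initial
  monomial is only meaningful for nonzero polynomials.
\<close>

definition initial :: "(('v \<Rightarrow>\<^sub>0 nat) \<Rightarrow> ('v \<Rightarrow>\<^sub>0 nat) \<Rightarrow> bool) \<Rightarrow> ('v, 'k::field) mpoly \<Rightarrow> ('v, 'k) mpoly" where
  "initial gt f = Poly_Mapping.single
     (THE u. u \<in> Poly_Mapping.keys f \<and> (\<forall>v\<in>Poly_Mapping.keys f. v \<noteq> u \<longrightarrow> gt u v)) 1"

definition groebner_basis ::
  "'v set \<Rightarrow> (('v \<Rightarrow>\<^sub>0 nat) \<Rightarrow> ('v \<Rightarrow>\<^sub>0 nat) \<Rightarrow> bool) \<Rightarrow> ('v, 'k::field) mpoly set \<Rightarrow> ('v, 'k) mpoly set \<Rightarrow> bool" where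
  "groebner_basis V gt G I \<longleftrightarrow>
     ideal I (mpoly_ring V) \<and> finite G \<and> G \<subseteq> I \<and>
     Idl\<^bsub>mpoly_ring V\<^esub> (initial gt ` (G - {0})) = Idl\<^bsub>mpoly_ring V\<^esub> (initial gt ` (I - {0}))"

text \<open>
  On points of equal length, \<open>sigma_gt a b\<close> says that the first nonzero entry of $a - b$ is negative.
  The second definition is the induced lexicographic order: the larger monomial has the larger
  exponent at the largest variable where the exponents differ.
\<close>

definition sigma_gt :: "nat list \<Rightarrow> nat list \<Rightarrow> bool" where
  "sigma_gt a b \<longleftrightarrow> length a = length b \<and>
     (\<exists>k<length a. (\<forall>i<k. a ! i = b ! i) \<and> a ! k < b ! k)"

definition sigma_lex :: "(nat list \<Rightarrow>\<^sub>0 nat) \<Rightarrow> (nat list \<Rightarrow>\<^sub>0 nat) \<Rightarrow> bool" where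
  "sigma_lex u v \<longleftrightarrow>
     (\<exists>c. (\<forall>d. sigma_gt d c \<longrightarrow> Poly_Mapping.lookup u d = Poly_Mapping.lookup v d) \<and>
          Poly_Mapping.lookup u c > Poly_Mapping.lookup v c)"


section \<open>Ferrers diagrams\<close>

text \<open>
  Points of $\mathbb{Z}_+^n$ are lists of length \<^term>\<open>n\<close> with positive entries. Positions are numbered
  from 0, so that \<open>a ! i\<close> is the coordinate $a_{i+1}$; the entries themselves start at 1.
\<close>

definition positive_points :: "nat \<Rightarrow> nat list set" where
  "positive_points n = {a. length a = n \<and> (\<forall>i<n. 0 < a ! i)}"

definition ferrers_diagram :: "nat \<Rightarrow> nat list set \<Rightarrow> bool" where
  "ferrers_diagram n D \<longleftrightarrow> D \<noteq> {} \<and> finite D \<and> D \<subseteq> positive_points n \<and>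
     (\<forall>b\<in>D. \<forall>a\<in>positive_points n. (\<forall>i<n. a ! i \<le> b ! i) \<longrightarrow> a \<in> D)"

definition standardizable :: "nat \<Rightarrow> nat list set \<Rightarrow> bool" where
  "standardizable n D \<longleftrightarrow>
     (\<forall>a\<in>D. \<forall>b\<in>D. \<forall>k<n. a \<noteq> b \<and> (\<forall>i<k. a ! i = b ! i) \<and> a ! k < b ! k \<longrightarrow>
        map (\<lambda>i. if i \<le> k then a ! i else max (a ! i) (b ! i)) [0..<n] \<in> D)"

definition extend_diagram :: "nat list set \<Rightarrow> nat \<Rightarrow> nat list set" where
  "extend_diagram D r = {a @ [i] | a i. a \<in> D \<and> i \<in> {1..r}}"

definition exchange :: "nat \<Rightarrow> nat set \<Rightarrow> nat list \<Rightarrow> nat list \<Rightarrow> nat list" where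
  "exchange N H a b = map (\<lambda>i. if i \<in> H then b ! i else a ! i) [0..<N]"

definition exchange_binomial ::
  "nat \<Rightarrow> nat list set \<Rightarrow> nat set \<Rightarrow> nat list \<Rightarrow> nat list \<Rightarrow> (nat list, 'k::field) mpoly" where
  "exchange_binomial N E H a b =
     (let p = exchange N H a b; q = exchange N H b a
      in if p \<in> E \<and> q \<in> E then mvar a * mvar b - mvar p * mvar q else 0)"

definition exchange_binomials :: "nat \<Rightarrow> nat list set \<Rightarrow> (nat list, 'k::field) mpoly set" where
  "exchange_binomials N E =
     {exchange_binomial N E H a b | H a b.
        H \<subseteq> {..<N} \<and> a \<in> E \<and> b \<in> E \<and> exchange_binomial N E H a b \<noteq> (0 :: (nat list, 'k) mpoly)}"


section \<open>Ferrers ideals, the multi-Rees algebra and the special fiber ring\<close>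

text \<open>\<open>XVar i j\<close> stands for $x_{i+1,j}$ and \<open>TVar i\<close> for $t_i$.\<close>

datatype xt = XVar nat nat | TVar nat

definition x_vars :: "nat \<Rightarrow> nat \<Rightarrow> xt set" where
  "x_vars n m = {XVar i j | i j. i < n \<and> j \<in> {1..m}}"

definition t_vars :: "nat \<Rightarrow> xt set" where
  "t_vars r = TVar ` {1..r}"

definition x_monomial :: "nat list \<Rightarrow> (xt, 'k::field) mpoly" where
  "x_monomial a = (\<Prod>i<length a. mvar (XVar i (a ! i)))"

definition ferrers_ideal :: "nat \<Rightarrow> nat \<Rightarrow> nat list set \<Rightarrow> (xt, 'k::field) mpoly set" where
  "ferrers_ideal n m D = Idl\<^bsub>mpoly_ring (x_vars n m)\<^esub> (x_monomial ` D)"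

text \<open>
  For an ideal $I$ of $R = K[x_{i,j}]$, the multi-Rees algebra of $I \oplus \dots \oplus I$ ($r$ copies)
  is $R[I t_1, \dots, I t_r] \subseteq R[t_1, \dots, t_r]$. For a Ferrers ideal it is
  generated over $R$ by the $\boldsymbol{x}_{\boldsymbol{a}} t_i$, see \<open>multi_rees_ferrers\<close> below.
\<close>

definition multi_rees :: "nat \<Rightarrow> nat \<Rightarrow> nat \<Rightarrow> (xt, 'k::field) mpoly set \<Rightarrow> (xt, 'k) mpoly ring" where
  "multi_rees n m r I =
     (let S = mpoly_ring (x_vars n m \<union> t_vars r)
      in S \<lparr>carrier := generate_ring S
              (carrier (mpoly_ring (x_vars n m)) \<union> {f * mvar (TVar i) | f i. f \<in> I \<and> i \<in> {1..r}})\<rparr>)"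

text \<open>
  $\mathcal{R} \otimes_R K$, where $K = R/\mathfrak{m}$ with $\mathfrak{m} = (x_{i,j})$, is the quotient
  $\mathcal{R}/\mathfrak{m}\mathcal{R}$.
\<close>

definition fiber_ideal :: "nat \<Rightarrow> nat \<Rightarrow> nat \<Rightarrow> (xt, 'k::field) mpoly set \<Rightarrow> (xt, 'k) mpoly set" where
  "fiber_ideal n m r I = Idl\<^bsub>multi_rees n m r I\<^esub> (mvar ` x_vars n m)"

definition special_fiber :: "nat \<Rightarrow> nat \<Rightarrow> nat \<Rightarrow> (xt, 'k::field) mpoly set \<Rightarrow> (xt, 'k) mpoly set ring" where
  "special_fiber n m r I = multi_rees n m r I Quot fiber_ideal n m r I"

definition special_fiber_scalar ::
  "nat \<Rightarrow> nat \<Rightarrow> nat \<Rightarrow> (xt, 'k::field) mpoly set \<Rightarrow> 'k \<Rightarrow> (xt, 'k) mpoly set" where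
  "special_fiber_scalar n m r I c = fiber_ideal n m r I +>\<^bsub>multi_rees n m r I\<^esub> mconst c"

text \<open>The special fiber ring is graded by the total degree in $t_1, \dots, t_r$.\<close>

definition special_fiber_component ::
  "nat \<Rightarrow> nat \<Rightarrow> nat \<Rightarrow> (xt, 'k::field) mpoly set \<Rightarrow> nat \<Rightarrow> (xt, 'k) mpoly set set" where
  "special_fiber_component n m r I d =
     {fiber_ideal n m r I +>\<^bsub>multi_rees n m r I\<^esub> f | f.
        f \<in> carrier (multi_rees n m r I) \<and>
        (\<forall>u\<in>Poly_Mapping.keys f. (\<Sum>i=1..r. Poly_Mapping.lookup u (TVar i)) = d)}"

text \<open>
  $K[\boldsymbol{x}_{\boldsymbol{a}} t_i : \boldsymbol{a} \in D, i \in [r]]$, the images \<open>fiber_monomial\<close> of the variables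
  $T_{(\boldsymbol{a},i)}$, and the kernel of the presentation.
\<close>

definition fiber_monomial :: "nat list \<Rightarrow> (xt, 'k::field) mpoly" where
  "fiber_monomial c = x_monomial (butlast c) * mvar (TVar (last c))"

definition fiber_monomial_algebra :: "nat list set \<Rightarrow> nat \<Rightarrow> (xt, 'k::field) mpoly ring" where
  "fiber_monomial_algebra D r =
     ring_of_type_algebra \<lparr>carrier := generate_ring ring_of_type_algebra
        (range mconst \<union> {x_monomial a * mvar (TVar i) | a i. a \<in> D \<and> i \<in> {1..r}})\<rparr>"

definition presentation_ideal :: "nat list set \<Rightarrow> nat \<Rightarrow> (nat list, 'k::field) mpoly set" where
  "presentation_ideal D r =
     a_kernel (mpoly_ring (extend_diagram D r)) (fiber_monomial_algebra D r) (msubst fiber_monomial)"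


section \<open>Koszul algebras\<close>

text \<open>
  A standard graded algebra over the field \<^typ>\<open>'k\<close> is given by a commutative ring \<open>A\<close>, the embedding
  \<open>\<iota>\<close> of the field, and the homogeneous components \<open>G d\<close>.
\<close>

definition standard_graded ::
  "('a, 'b) ring_scheme \<Rightarrow> ('k::field \<Rightarrow> 'a) \<Rightarrow> (nat \<Rightarrow> 'a set) \<Rightarrow> bool" where
  "standard_graded A \<iota> G \<longleftrightarrow>
     cring A \<and> \<iota> \<in> ring_hom ring_of_type_algebra A \<and> inj \<iota> \<and>
     G 0 = range \<iota> \<and>
     (\<forall>d. additive_subgroup (G d) A) \<and>
     (\<forall>d e. \<forall>x\<in>G d. \<forall>y\<in>G e. x \<otimes>\<^bsub>A\<^esub> y \<in> G (d + e)) \<and>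
     (\<forall>x\<in>carrier A. \<exists>!h. (\<forall>d. h d \<in> G d) \<and> finite {d. h d \<noteq> \<zero>\<^bsub>A\<^esub>} \<and>
        x = (\<Oplus>\<^bsub>A\<^esub>d\<in>{d. h d \<noteq> \<zero>\<^bsub>A\<^esub>}. h d)) \<and>
     (\<exists>S. finite S \<and> S \<subseteq> G 1 \<and> generate_ring A (range \<iota> \<union> S) = carrier A)"

definition irrelevant_ideal :: "('a, 'b) ring_scheme \<Rightarrow> (nat \<Rightarrow> 'a set) \<Rightarrow> 'a set" where
  "irrelevant_ideal A G = Idl\<^bsub>A\<^esub> (\<Union>d\<in>{1..}. G d)"

definition free_module :: "('a, 'b) ring_scheme \<Rightarrow> nat \<Rightarrow> (nat \<Rightarrow> 'a) set" where
  "free_module A b = {..<b} \<rightarrow>\<^sub>E carrier A"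

definition matrix_map ::
  "('a, 'b) ring_scheme \<Rightarrow> nat \<Rightarrow> nat \<Rightarrow> (nat \<Rightarrow> nat \<Rightarrow> 'a) \<Rightarrow> (nat \<Rightarrow> 'a) \<Rightarrow> nat \<Rightarrow> 'a" where
  "matrix_map A b c M v = (\<lambda>k\<in>{..<c}. \<Oplus>\<^bsub>A\<^esub>j\<in>{..<b}. v j \<otimes>\<^bsub>A\<^esub> M j k)"

text \<open>
  A linear resolution of $K = A/A_+$ is a graded free resolution
  $\dots \to A(-2)^{b_2} \to A(-1)^{b_1} \to A \to K \to 0$. The degree-preserving maps
  $A(-i-1)^{b_{i+1}} \to A(-i)^{b_i}$ are exactly those given by a matrix (here \<open>M i\<close>) with
  entries in $A_1$. The free modules have finite rank, which is no restriction, since $A$ is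
  Noetherian and a linear resolution is minimal; for the same reason it starts with $A$ itself.
  The last two conditions are exactness at $A$ and at $A(-i-1)^{b_{i+1}}$.
\<close>

definition linear_resolution_of_residue_field ::
  "('a, 'b) ring_scheme \<Rightarrow> (nat \<Rightarrow> 'a set) \<Rightarrow> (nat \<Rightarrow> nat) \<Rightarrow> (nat \<Rightarrow> nat \<Rightarrow> nat \<Rightarrow> 'a) \<Rightarrow> bool" where
  "linear_resolution_of_residue_field A G b M \<longleftrightarrow>
     b 0 = 1 \<and>
     (\<forall>i. \<forall>j<b (Suc i). \<forall>k<b i. M i j k \<in> G 1) \<and>
     matrix_map A (b 1) (b 0) (M 0) ` free_module A (b 1) =
       {v \<in> free_module A (b 0).
          irrelevant_ideal A G +>\<^bsub>A\<^esub> v 0 = \<zero>\<^bsub>A Quot irrelevant_ideal A G\<^esub>} \<and>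
     (\<forall>i. matrix_map A (b (Suc (Suc i))) (b (Suc i)) (M (Suc i)) ` free_module A (b (Suc (Suc i))) =
       {v \<in> free_module A (b (Suc i)).
          matrix_map A (b (Suc i)) (b i) (M i) v = (\<lambda>k\<in>{..<b i}. \<zero>\<^bsub>A\<^esub>)})"

definition koszul ::
  "('a, 'b) ring_scheme \<Rightarrow> ('k::field \<Rightarrow> 'a) \<Rightarrow> (nat \<Rightarrow> 'a set) \<Rightarrow> bool" where
  "koszul A \<iota> G \<longleftrightarrow>
     standard_graded A \<iota> G \<and> (\<exists>b M. linear_resolution_of_residue_field A G b M)"


section \<open>Comparison of the descriptions of the multi-Rees algebra\<close>

lemma carrier_mpoly_ring:
  "f \<in> carrier (mpoly_ring V) \<longleftrightarrow> (\<forall>u\<in>Poly_Mapping.keys f. Poly_Mapping.keys u \<subseteq> V)"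
  by (simp add: mpoly_ring_def)

lemma mpoly_ring_simps [simp]:
  "f \<oplus>\<^bsub>mpoly_ring V\<^esub> g = f + g"
  "f \<otimes>\<^bsub>mpoly_ring V\<^esub> g = f * g"
  "\<zero>\<^bsub>mpoly_ring V\<^esub> = 0"
  "\<one>\<^bsub>mpoly_ring V\<^esub> = 1"
  by (simp_all add: mpoly_ring_def ring_of_type_algebra_def)

lemma mpoly_ring_closed:
  assumes "f \<in> carrier (mpoly_ring V)" "g \<in> carrier (mpoly_ring V)"
  shows "f + g \<in> carrier (mpoly_ring V)" "- f \<in> carrier (mpoly_ring V)"
    and "f * g \<in> carrier (mpoly_ring V)"
proof -
  show "f + g \<in> carrier (mpoly_ring V)"
    using assms Poly_Mapping.keys_add[of f g] unfolding carrier_mpoly_ring by blast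
  show "- f \<in> carrier (mpoly_ring V)"
    using assms unfolding carrier_mpoly_ring by (simp add: in_keys_iff)
  show "f * g \<in> carrier (mpoly_ring V)"
    unfolding carrier_mpoly_ring
  proof
    fix u assume "u \<in> Poly_Mapping.keys (f * g)"
    then obtain p q where "u = p + q" "p \<in> Poly_Mapping.keys f" "q \<in> Poly_Mapping.keys g"
      using Poly_Mapping.keys_mult by blast
    then show "Poly_Mapping.keys u \<subseteq> V"
      using assms Poly_Mapping.keys_add[of p q] unfolding carrier_mpoly_ring by blast
  qed
qed

lemma const_in_mpoly_ring:
  "0 \<in> carrier (mpoly_ring V)" "1 \<in> carrier (mpoly_ring V)" "mconst c \<in> carrier (mpoly_ring V)"
  by (simp_all add: carrier_mpoly_ring mconst_def)

lemma cring_mpoly_ring: "cring (mpoly_ring V :: ('v, 'k::field) mpoly ring)"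
proof (rule cringI)
  show "abelian_group (mpoly_ring V :: ('v, 'k) mpoly ring)"
  proof (rule abelian_groupI)
    fix f :: "('v, 'k) mpoly" assume "f \<in> carrier (mpoly_ring V)"
    then show "\<exists>g\<in>carrier (mpoly_ring V). g \<oplus>\<^bsub>mpoly_ring V\<^esub> f = \<zero>\<^bsub>mpoly_ring V\<^esub>"
      by (intro bexI[of _ "- f"]) (auto intro: mpoly_ring_closed)
  qed (auto simp: add_ac const_in_mpoly_ring intro: mpoly_ring_closed)
  show "comm_monoid (mpoly_ring V :: ('v, 'k) mpoly ring)"
    by (rule comm_monoidI) (auto simp: mult_ac const_in_mpoly_ring intro: mpoly_ring_closed)
qed (simp add: distrib_right)

lemma mpoly_ring_mono: "V \<subseteq> W \<Longrightarrow> carrier (mpoly_ring V) \<subseteq> carrier (mpoly_ring W)"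
  unfolding carrier_mpoly_ring subset_iff by blast

lemma mvar_in_mpoly_ring: "v \<in> V \<Longrightarrow> mvar v \<in> carrier (mpoly_ring V)"
  by (simp add: mvar_def carrier_mpoly_ring)

lemma x_monomial_in_mpoly_ring:
  assumes "a \<in> positive_points n" "\<forall>j\<in>set a. j \<le> m"
  shows "x_monomial a \<in> carrier (mpoly_ring (x_vars n m))"
proof -
  have "(\<Prod>i\<in>J. mvar (XVar i (a ! i))) \<in> carrier (mpoly_ring (x_vars n m))"
    if "finite J" "J \<subseteq> {..<length a}" for J
    using that
  proof (induction J rule: finite_induct)
    case (insert i J)
    then have "XVar i (a ! i) \<in> x_vars n m"
      using assms by (force simp: x_vars_def positive_points_def Suc_le_eq)
    then show ?case
      using insert by (simp add: mvar_in_mpoly_ring mpoly_ring_closed)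
  qed (simp add: const_in_mpoly_ring)
  from this[of "{..<length a}"] show ?thesis by (simp add: x_monomial_def)
qed

lemma multi_rees_ferrers:
  assumes D: "D \<subseteq> positive_points n" and m: "\<forall>a\<in>D. \<forall>j\<in>set a. j \<le> m"
  shows "carrier (multi_rees n m r (ferrers_ideal n m D)) =
    generate_ring (mpoly_ring (x_vars n m \<union> t_vars r))
      (carrier (mpoly_ring (x_vars n m)) \<union>
       {x_monomial a * mvar (TVar i) | a i. a \<in> D \<and> i \<in> {1..r}})"
proof -
  define R :: "(xt, 'a) mpoly ring" where "R = mpoly_ring (x_vars n m)"
  define S :: "(xt, 'a) mpoly ring" where "S = mpoly_ring (x_vars n m \<union> t_vars r)"
  define I :: "(xt, 'a) mpoly set" where "I = ferrers_ideal n m D"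
  define A where "A = {f * mvar (TVar i) | f i. f \<in> I \<and> i \<in> {1..r}}"
  define B :: "(xt, 'a) mpoly set"
    where "B = {x_monomial a * mvar (TVar i) | a i. a \<in> D \<and> i \<in> {1..r}}"
  define C where "C = generate_ring S (carrier R \<union> B)"
  interpret R: cring R unfolding R_def by (rule cring_mpoly_ring)
  interpret S: cring S unfolding S_def by (rule cring_mpoly_ring)
  have RS: "carrier R \<subseteq> carrier S"
    unfolding R_def S_def by (rule mpoly_ring_mono) simp
  have DR: "x_monomial ` D \<subseteq> carrier R"
    unfolding R_def using D m x_monomial_in_mpoly_ring by blast
  have I_eq: "I = Idl\<^bsub>R\<^esub> (x_monomial ` D)"
    by (simp add: I_def R_def ferrers_ideal_def)
  have DI: "x_monomial ` D \<subseteq> I"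
    unfolding I_eq by (rule R.genideal_self[OF DR])
  have "ideal I R"
    unfolding I_eq by (rule R.genideal_ideal[OF DR])
  then have IR: "I \<subseteq> carrier R"
    by (simp add: additive_subgroup.a_subset ideal_def)
  have A: "A \<subseteq> carrier S"
  proof
    fix g assume "g \<in> A"
    then obtain f i where g: "g = f * mvar (TVar i)" and f: "f \<in> I" and i: "i \<in> {1..r}"
      unfolding A_def by blast
    have "mvar (TVar i) \<in> carrier S"
      unfolding S_def by (rule mvar_in_mpoly_ring) (use i in \<open>simp add: t_vars_def\<close>)
    then show "g \<in> carrier S"
      using f IR RS unfolding g S_def by (blast intro: mpoly_ring_closed)
  qed
  have BA: "B \<subseteq> A" using DI unfolding A_def B_def by blast
  have sub: "subring C S"
    unfolding C_def using RS A BA by (intro S.generate_ring_is_subring) blast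
  have add: "f + g \<in> C" if "f \<in> C" "g \<in> C" for f g
    using subringE(7)[OF sub that] by (simp add: S_def)
  have mult: "f * g \<in> C" if "f \<in> C" "g \<in> C" for f g
    using subringE(6)[OF sub that] by (simp add: S_def)
  have RC: "carrier R \<subseteq> C" and BC: "B \<subseteq> C"
    unfolding C_def by (blast intro: generate_ring.incl)+
  have "A \<subseteq> C"
  proof
    fix g' assume "g' \<in> A"
    then obtain f i where g': "g' = f * mvar (TVar i)" and f: "f \<in> I" and i: "i \<in> {1..r}"
      unfolding A_def by blast
    define J where "J = {g \<in> carrier R. g * mvar (TVar i) \<in> C}"
    have clR: "h * g \<in> J" if g: "g \<in> J" and h: "h \<in> carrier R" for g h
    proof -
      have "h * (g * mvar (TVar i)) \<in> C"
        using g h RC by (intro mult[of h "g * mvar (TVar i)"]) (auto simp: J_def)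
      moreover have "h * g \<in> carrier R"
        using g h unfolding J_def R_def by (blast intro: mpoly_ring_closed)
      ultimately show ?thesis
        by (simp add: J_def mult.assoc)
    qed
    have clA: "g + h \<in> J" if "g \<in> J" "h \<in> J" for g h
    proof -
      have "g + h \<in> carrier R"
        using that unfolding J_def R_def by (blast intro: mpoly_ring_closed)
      then show ?thesis using that add by (simp add: J_def distrib_right)
    qed
    have "0 \<in> carrier R" unfolding R_def by (rule const_in_mpoly_ring)
    then have zero: "0 \<in> J" using RC by (auto simp: J_def)
    have "ideal J R"
    proof (rule idealI)
      show "ring R" ..
      show "subgroup J (add_monoid R)"
      proof (rule R.add.subgroupI)
        show "J \<subseteq> carrier R" by (auto simp: J_def)
        show "J \<noteq> {}" using zero by blast
      next
        fix g assume g: "g \<in> J"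
        have gR: "g \<in> carrier R" "- g \<in> carrier R"
          using g unfolding J_def R_def by (blast intro: mpoly_ring_closed)+
        have "mconst (- 1) * g = - g"
          by (simp add: mconst_def single_uminus)
        moreover have "mconst (- 1) \<in> carrier R"
          unfolding R_def by (rule const_in_mpoly_ring)
        moreover have "\<ominus>\<^bsub>R\<^esub> g = - g"
          by (rule R.minus_equality[OF _ gR]) (simp add: R_def)
        ultimately show "\<ominus>\<^bsub>R\<^esub> g \<in> J"
          using clR[OF g] by metis
      next
        fix g h assume "g \<in> J" "h \<in> J"
        then show "g \<oplus>\<^bsub>R\<^esub> h \<in> J" using clA by (simp add: R_def)
      qed
    next
      fix g h assume gh: "g \<in> J" "h \<in> carrier R"
      show "h \<otimes>\<^bsub>R\<^esub> g \<in> J" using clR[OF gh] by (simp add: R_def)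
      show "g \<otimes>\<^bsub>R\<^esub> h \<in> J" using clR[OF gh] by (simp add: R_def mult.commute)
    qed
    moreover have "x_monomial ` D \<subseteq> J"
    proof
      fix g :: "(xt, 'a) mpoly" assume g: "g \<in> x_monomial ` D"
      then have "g * mvar (TVar i) \<in> B" using i unfolding B_def by blast
      then show "g \<in> J" using g DR BC by (auto simp: J_def)
    qed
    ultimately have "I \<subseteq> J"
      unfolding I_eq by (rule R.genideal_minimal)
    then show "g' \<in> C" using f by (auto simp: J_def g')
  qed
  then have "generate_ring S (carrier R \<union> A) \<subseteq> C"
    using RS A RC sub by (intro S.generate_ring_min_subring1) blast+
  moreover have "C \<subseteq> generate_ring S (carrier R \<union> A)"
    unfolding C_def using RS A BA by (intro S.mono_generate_ring) blast+
  ultimately show ?thesis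
    by (simp add: multi_rees_def Let_def A_def B_def C_def I_def R_def S_def)
qed

end

theory Submission
  imports Defs "HOL-Library.List_Lexorder" "HOL-Library.Product_Lexorder"
begin

text \<open>
  Call two points \<open>a, b\<close> of $\widetilde{\mathcal{D}_r}$ a bad pair if, beyond the first position where
  they differ, they differ once more in the same direction. Exchanging those further positions
  replaces $T_a T_b$ by a smaller monomial in the same fiber of the monomial map, and standardizability
  keeps the new points inside the diagram. Conversely a monomial without bad pairs is determined by its
  image: reading the coordinates one after another, the groups of points with a common prefix receive
  the values of the next coordinate in decreasing order. Hence the monomials without bad pairs are the
  normal forms, which gives the Groebner basis.

  Since the relations are quadratic, a linear resolution of the residue field is built degree by degree
  as a lift of Froeberg's resolution over the initial algebra. The basis of the $i$-th free module
  consists of chains $(s_i, \dots, s_1)$ of variables, where $y$ may extend a chain with front \<open>s\<close> if \<open>(y, s)\<close>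
  is a bad pair, or if \<open>y\<close> precedes \<open>s\<close> and could have been chosen instead of \<open>s\<close>. Ordered by the Schreyer
  order, the leading terms of the module of syzygies are exactly the normal monomials divisible by an
  allowed variable, and this property is inherited by the next syzygy module.

  The special fiber ring is isomorphic to the monomial algebra, because $\mathcal{R}$ and
  $\mathfrak{m}\mathcal{R}$ are spanned by monomials and the generators $x_a t_i$ all have the
  same degree \<open>n\<close> in the \<open>x\<close>-variables.
\<close>

section \<open>Polynomials and rings of polynomials\<close>

text \<open>The smaller list is the larger variable, and \<open><\<close> on exponent vectors is
  decided at the smallest list where they differ. So on points of equal length \<open><\<close> on
  exponents is the order sigma, and a normal form is the least element of its fiber. The obstacle in
  the lifting is that the product of a bad pair is zero in the initial algebra, but a smaller
  monomial in the toric ring. Each differential therefore needs correction terms, and these come out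
  of a division procedure instead of a formula. Two facts make this possible: the normal form of a
  product is at most the sum of the normal forms, so multiplication never raises a term in the
  Schreyer order; and each degree has only finitely many monomials, so division stops. Linearity
  survives because the leading relations are quadratic: the colon ideals that occur are generated by
  variables, so the remainders to be divided have degree 2, and dividing by linear elements leaves
  coefficients of degree 1.\<close>

abbreviation supp :: "('a \<Rightarrow>\<^sub>0 'b::zero) \<Rightarrow> 'a set" where "supp \<equiv> Poly_Mapping.keys"
abbreviation coef :: "('a \<Rightarrow>\<^sub>0 'b::zero) \<Rightarrow> 'a \<Rightarrow> 'b" where "coef \<equiv> Poly_Mapping.lookup"
abbreviation single :: "'a \<Rightarrow> 'b \<Rightarrow> ('a \<Rightarrow>\<^sub>0 'b::zero)" where "single \<equiv> Poly_Mapping.single"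

lemma supp_add_nat: "supp (u + v) = supp u \<union> supp (v :: 'a \<Rightarrow>\<^sub>0 nat)"
  by (auto simp: in_keys_iff lookup_add)

lemma supp_minus_nat: "supp (u - v) \<subseteq> supp (u :: 'a \<Rightarrow>\<^sub>0 nat)"
  by (auto simp: in_keys_iff lookup_minus)

lemma single_add_minus:
  fixes u :: "'a \<Rightarrow>\<^sub>0 nat"
  assumes "k \<le> coef u e"
  shows "single e k + (u - single e k) = u"
  by (rule poly_mapping_eqI) (use assms in \<open>auto simp: lookup_add lookup_minus lookup_single when_def\<close>)

lemma supp_minus:
  fixes f g :: "'a \<Rightarrow>\<^sub>0 'b::ab_group_add"
  shows "supp (f - g) \<subseteq> supp f \<union> supp g"
  by (auto simp: in_keys_iff lookup_minus)

lemma supp_sum: "supp (\<Sum>i\<in>A. f i) \<subseteq> (\<Union>i\<in>A. supp (f i))"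
proof
  fix x assume "x \<in> supp (\<Sum>i\<in>A. f i)"
  then have "(\<Sum>i\<in>A. coef (f i) x) \<noteq> 0" by (simp add: in_keys_iff lookup_sum)
  then obtain i where "i \<in> A" "coef (f i) x \<noteq> 0" by (rule sum.not_neutral_contains_not_neutral)
  then show "x \<in> (\<Union>i\<in>A. supp (f i))" by (auto simp: in_keys_iff)
qed

lemma poly_decomp:
  fixes f :: "'a \<Rightarrow>\<^sub>0 'b::comm_monoid_add"
  shows "(\<Sum>u\<in>supp f. single u (coef f u)) = f"
proof (rule poly_mapping_eqI)
  fix v
  have "(\<Sum>u\<in>supp f. coef (single u (coef f u)) v) = (\<Sum>u\<in>supp f. if u = v then coef f u else 0)"
    by (rule sum.cong) (auto simp: lookup_single when_def)
  then show "coef (\<Sum>u\<in>supp f. single u (coef f u)) v = coef f v"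
    by (simp add: lookup_sum sum.delta in_keys_iff)
qed

lemma finsum_eq_sum:
  fixes R :: "'a::comm_monoid_add ring"
  assumes "abelian_monoid R" "\<And>x y. x \<oplus>\<^bsub>R\<^esub> y = x + y" "\<zero>\<^bsub>R\<^esub> = 0"
    and "finite A" "\<And>i. i \<in> A \<Longrightarrow> f i \<in> carrier R"
  shows "finsum R f A = sum f A"
proof -
  interpret abelian_monoid R by fact
  show ?thesis using assms(4,5)
    by (induction A rule: finite_induct) (simp_all add: assms(2,3) Pi_def)
qed

lemma abelian_group_inv_type_algebra:
  fixes R :: "'a::ab_group_add ring"
  assumes "abelian_group R" "\<And>x y. x \<oplus>\<^bsub>R\<^esub> y = x + y" "\<zero>\<^bsub>R\<^esub> = 0" "x \<in> carrier R" "- x \<in> carrier R"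
  shows "\<ominus>\<^bsub>R\<^esub> x = - x"
proof -
  interpret abelian_group R by fact
  show ?thesis by (rule minus_equality) (simp_all add: assms)
qed

lemma additive_subgroup_sum_closed:
  fixes R :: "'a::comm_monoid_add ring"
  assumes "additive_subgroup I R" "\<And>x y. x \<oplus>\<^bsub>R\<^esub> y = x + y" "\<zero>\<^bsub>R\<^esub> = 0" "\<And>i. i \<in> A \<Longrightarrow> f i \<in> I"
  shows "sum f A \<in> I"
  using assms(4)
proof (induction A rule: infinite_finite_induct)
  case (insert x F)
  then show ?case using additive_subgroup.a_closed[OF assms(1), of "f x" "sum f F"] assms(2) by simp
qed (use additive_subgroup.zero_closed[OF assms(1)] assms(3) in simp_all)

text \<open>Both the toric ring and the multi-Rees algebra have this form, with \<open>P\<close> a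
  monoid of exponents. Questions about their ideals and quotients then become inclusions between
  sets of exponents.\<close>

definition monomial_ring :: "('x \<Rightarrow>\<^sub>0 nat) set \<Rightarrow> ('x, 'k::field) mpoly ring" where
  "monomial_ring P = mpoly_ring UNIV \<lparr>carrier := {f. supp f \<subseteq> P}\<rparr>"

lemma monomial_ring_simps [simp]:
  "carrier (monomial_ring P) = {f. supp f \<subseteq> P}"
  "f \<oplus>\<^bsub>monomial_ring P\<^esub> g = f + g"
  "f \<otimes>\<^bsub>monomial_ring P\<^esub> g = f * g"
  "\<zero>\<^bsub>monomial_ring P\<^esub> = 0"
  "\<one>\<^bsub>monomial_ring P\<^esub> = 1"
  by (simp_all add: monomial_ring_def mpoly_ring_def ring_of_type_algebra_def)

lemma cring_monomial_ring:
  assumes "0 \<in> P" "\<And>\<mu> \<nu>. \<mu> \<in> P \<Longrightarrow> \<nu> \<in> P \<Longrightarrow> \<mu> + \<nu> \<in> P"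
  shows "cring (monomial_ring P :: ('x, 'k::field) mpoly ring)"
proof -
  have add: "supp (f + g) \<subseteq> P" if "supp f \<subseteq> P" "supp g \<subseteq> P" for f g :: "('x, 'k) mpoly"
    using that keys_add[of f g] by blast
  have mult: "supp (f * g) \<subseteq> P" if "supp f \<subseteq> P" "supp g \<subseteq> P" for f g :: "('x, 'k) mpoly"
    using that keys_mult[of f g] assms(2) by blast
  show ?thesis
  proof (rule cringI)
    show "abelian_group (monomial_ring P :: ('x, 'k) mpoly ring)"
    proof (rule abelian_groupI)
      fix f :: "('x, 'k) mpoly" assume "f \<in> carrier (monomial_ring P)"
      then show "\<exists>g\<in>carrier (monomial_ring P). g \<oplus>\<^bsub>monomial_ring P\<^esub> f = \<zero>\<^bsub>monomial_ring P\<^esub>"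
        by (intro bexI[of _ "- f"]) (simp_all add: subset_iff in_keys_iff)
    qed (simp_all add: add_ac add)
    show "comm_monoid (monomial_ring P :: ('x, 'k) mpoly ring)"
      by (rule comm_monoidI) (simp_all add: mult_ac assms(1) mult)
  qed (simp add: distrib_right)
qed

lemma monomial_ring_inv:
  assumes "0 \<in> P" "\<And>\<mu> \<nu>. \<mu> \<in> P \<Longrightarrow> \<nu> \<in> P \<Longrightarrow> \<mu> + \<nu> \<in> P" "supp f \<subseteq> P"
  shows "\<ominus>\<^bsub>monomial_ring P\<^esub> f = - (f :: ('x, 'k::field) mpoly)"
proof -
  have "cring (monomial_ring P :: ('x, 'k) mpoly ring)" using assms(1,2) by (rule cring_monomial_ring)
  then have "abelian_group (monomial_ring P :: ('x, 'k) mpoly ring)" by (simp add: cring_def ring_def)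
  then show ?thesis
    using assms(3) by (intro abelian_group_inv_type_algebra) (simp_all add: subset_iff in_keys_iff)
qed

text \<open>With \<open>P = M\<close> this projects the multi-Rees algebra onto the toric ring along
  the fiber ideal, and so picks the representative of a coset in the special fiber ring.\<close>

definition restrict_supp :: "'a set \<Rightarrow> ('a \<Rightarrow>\<^sub>0 'b::comm_monoid_add) \<Rightarrow> ('a \<Rightarrow>\<^sub>0 'b)" where
  "restrict_supp P f = (\<Sum>\<mu>\<in>supp f \<inter> P. single \<mu> (coef f \<mu>))"

lemma coef_restrict_supp: "coef (restrict_supp P f) \<mu> = (if \<mu> \<in> P then coef f \<mu> else 0)"
proof -
  have "coef (restrict_supp P f) \<mu> = (\<Sum>\<nu>\<in>supp f \<inter> P. if \<nu> = \<mu> then coef f \<mu> else 0)"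
    unfolding restrict_supp_def lookup_sum by (rule sum.cong) (auto simp: lookup_single when_def)
  then show ?thesis by (auto simp: in_keys_iff)
qed

lemma supp_restrict_supp: "supp (restrict_supp P f) = supp f \<inter> P"
  by (auto simp: in_keys_iff coef_restrict_supp split: if_splits)

section \<open>Linear resolutions over toric rings with quadratic standard monomials\<close>

text \<open>This isolates what the resolution uses of the diagram. \<open>reduce\<close> makes every
  product of a bad pair a leading monomial, \<open>unique\<close> says that there are no further
  minimal ones, and \<open>bad_irrefl\<close> keeps squares of variables out of the initial
  ideal.\<close>

locale quadratic_toric =
fixes E :: "'e::linorder set"
    and \<theta> :: "('e \<Rightarrow>\<^sub>0 nat) \<Rightarrow> ('x \<Rightarrow>\<^sub>0 nat)"
    and \<delta> :: "('x \<Rightarrow>\<^sub>0 nat) \<Rightarrow> nat"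
    and bad :: "'e \<Rightarrow> 'e \<Rightarrow> bool"
  assumes fin: "finite E"
    and \<theta>_add: "\<theta> (u + v) = \<theta> u + \<theta> v"
    and \<delta>_add: "\<delta> (\<mu> + \<nu>) = \<delta> \<mu> + \<delta> \<nu>"
    and \<delta>_var: "e \<in> E \<Longrightarrow> \<delta> (\<theta> (single e 1)) = 1"
    and bad_irrefl: "\<not> bad e e"
    and bad_sym: "bad a b \<Longrightarrow> bad b a"
    and reduce: "\<lbrakk>supp u \<subseteq> E; a \<in> supp u; b \<in> supp u; bad a b\<rbrakk>
      \<Longrightarrow> \<exists>v. supp v \<subseteq> E \<and> \<theta> v = \<theta> u \<and> v < u"
    and unique: "\<lbrakk>supp u \<subseteq> E; supp v \<subseteq> E; \<theta> u = \<theta> v;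
      \<forall>a\<in>supp u. \<forall>b\<in>supp u. \<not> bad a b; \<forall>a\<in>supp v. \<forall>b\<in>supp v. \<not> bad a b\<rbrakk> \<Longrightarrow> u = v"
begin

section \<open>Normal forms in the fibers of the monomial map\<close>

definition normal :: "('e \<Rightarrow>\<^sub>0 nat) \<Rightarrow> bool" where
  "normal u \<longleftrightarrow> supp u \<subseteq> E \<and> (\<forall>a\<in>supp u. \<forall>b\<in>supp u. \<not> bad a b)"

definition M :: "('x \<Rightarrow>\<^sub>0 nat) set" where "M = \<theta> ` {u. supp u \<subseteq> E}"

definition nf :: "('x \<Rightarrow>\<^sub>0 nat) \<Rightarrow> ('e \<Rightarrow>\<^sub>0 nat)" where
  "nf \<mu> = (THE u. normal u \<and> \<theta> u = \<mu>)"

lemma \<theta>_0 [simp]: "\<theta> 0 = 0"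
  using \<theta>_add[of 0 0] by simp

lemma \<delta>_0 [simp]: "\<delta> 0 = 0"
  using \<delta>_add[of 0 0] by simp

lemma \<delta>_\<theta>_single: "e \<in> E \<Longrightarrow> \<delta> (\<theta> (single e k)) = k"
proof (induction k)
  case (Suc k)
  have "single e (Suc k) = single e 1 + single e k" by (simp flip: single_add)
  then show ?case using Suc by (simp only: \<theta>_add \<delta>_add \<delta>_var)
qed simp

lemma coef_le_\<delta>: "e \<in> E \<Longrightarrow> coef u e \<le> \<delta> (\<theta> u)"
  using single_add_minus[of "coef u e" u e] \<delta>_\<theta>_single[of e "coef u e"] \<theta>_add \<delta>_add
  by (metis le_add1 order_refl)

text \<open>This takes the place of well-foundedness: the minimum of a fiber and the termination of
  the division both rest on it.\<close>

lemma finite_degree: "finite {u. supp u \<subseteq> E \<and> \<delta> (\<theta> u) = d}"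
proof (rule finite_imageD)
  let ?A = "{u. supp u \<subseteq> E \<and> \<delta> (\<theta> u) = d}"
  show "finite ((\<lambda>u. restrict (coef u) E) ` ?A)"
    by (rule finite_subset[of _ "E \<rightarrow>\<^sub>E {..d}"])
      (use coef_le_\<delta> in \<open>auto intro!: finite_PiE fin\<close>)
  show "inj_on (\<lambda>u. restrict (coef u) E) ?A"
  proof (rule inj_onI)
    fix u v assume uv: "u \<in> ?A" "v \<in> ?A" "restrict (coef u) E = restrict (coef v) E"
    show "u = v"
    proof (rule poly_mapping_eqI)
      fix e show "coef u e = coef v e"
      proof (cases "e \<in> E")
        case True then show ?thesis using uv(3) by (metis restrict_apply')
      next
        case False then have "e \<notin> supp u" "e \<notin> supp v" using uv by auto
        then show ?thesis by (simp add: in_keys_iff)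
      qed
    qed
  qed
qed

lemma \<theta>_M: "supp u \<subseteq> E \<Longrightarrow> \<theta> u \<in> M" by (auto simp: M_def)

lemma normal_E: "normal u \<Longrightarrow> supp u \<subseteq> E" by (simp add: normal_def)

text \<open>The minimum of the finite fiber is normal, because a bad pair in it would give a still
  smaller element by \<open>reduce\<close>.\<close>

lemma normal_le:
  assumes "supp u \<subseteq> E"
  shows "\<exists>v. normal v \<and> \<theta> v = \<theta> u \<and> v \<le> u"
proof -
  let ?F = "{v. supp v \<subseteq> E \<and> \<theta> v = \<theta> u}"
  have fF: "finite ?F"
    by (rule finite_subset[OF _ finite_degree[of "\<delta> (\<theta> u)"]]) auto
  have uF: "u \<in> ?F" using assms by simp
  define v where "v = Min ?F"
  have v: "v \<in> ?F" using Min_in[OF fF] uF unfolding v_def by blast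
  have min: "v \<le> w" if "w \<in> ?F" for w unfolding v_def using fF that by (rule Min_le)
  have "normal v"
  proof (rule ccontr)
    assume "\<not> normal v"
    then obtain a b where "a \<in> supp v" "b \<in> supp v" "bad a b" using v by (auto simp: normal_def)
    then obtain w where "supp w \<subseteq> E" "\<theta> w = \<theta> v" "w < v" using reduce[of v] v by blast
    then show False using min[of w] v by auto
  qed
  then show ?thesis using v min[OF uF] by blast
qed

lemma nf_eqI: "normal u \<Longrightarrow> \<theta> u = \<mu> \<Longrightarrow> nf \<mu> = u"
  unfolding nf_def by (rule the_equality) (auto simp: normal_def intro: unique)

lemma nf:
  assumes "\<mu> \<in> M"
  shows normal_nf: "normal (nf \<mu>)" and \<theta>_nf: "\<theta> (nf \<mu>) = \<mu>"
proof -
  obtain u where "normal u" "\<theta> u = \<mu>" using assms normal_le unfolding M_def by blast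
  then have "nf \<mu> = u" by (rule nf_eqI)
  then show "normal (nf \<mu>)" "\<theta> (nf \<mu>) = \<mu>" using \<open>normal u\<close> \<open>\<theta> u = \<mu>\<close> by simp_all
qed

lemma nf_le: "supp u \<subseteq> E \<Longrightarrow> nf (\<theta> u) \<le> u"
  using normal_le nf_eqI by blast

lemma nf_normal: "normal u \<Longrightarrow> nf (\<theta> u) = u"
  using nf_eqI by blast

lemma nf_less: "supp u \<subseteq> E \<Longrightarrow> \<not> normal u \<Longrightarrow> nf (\<theta> u) < u"
  by (metis nf(1) \<theta>_M nf_le order.not_eq_order_implies_strict)

lemma M_add: "\<mu> \<in> M \<Longrightarrow> \<nu> \<in> M \<Longrightarrow> \<mu> + \<nu> \<in> M"
  unfolding M_def by (clarsimp simp flip: \<theta>_add) (simp add: supp_add_nat)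

lemma M_0: "0 \<in> M"
  unfolding M_def by (rule image_eqI[of _ _ 0]) auto

text \<open>This is a colon ideal. In the initial algebra let \<open>J\<close> be the ideal of the
  variables in \<open>allowed c\<close> that precede \<open>s\<close>. A nonzero monomial times
  \<open>s\<close> lies in \<open>J\<close> or vanishes exactly if it contains one of these
  variables or a variable bad with \<open>s\<close>. So \<open>allowed (s # c)\<close> generates the
  colon of \<open>J\<close> by \<open>s\<close>, and chains index a resolution by iterated linear
  quotients.\<close>

fun allowed :: "'e list \<Rightarrow> 'e set" where
  "allowed [] = E"
| "allowed (s # c) = {y \<in> E. bad y s \<or> y \<in> allowed c \<and> y < s}"

fun chains :: "nat \<Rightarrow> 'e list set" where
  "chains 0 = {[]}"
| "chains (Suc i) = {s # c | s c. c \<in> chains i \<and> s \<in> allowed c}"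

fun wt :: "'e list \<Rightarrow> ('e \<Rightarrow>\<^sub>0 nat)" where
  "wt [] = 0"
| "wt (s # c) = single s 1 + wt c"

lemma allowed_subset: "allowed c \<subseteq> E" by (cases c) auto

lemma chains_length: "c \<in> chains i \<Longrightarrow> length c = i"
  by (induction i arbitrary: c) auto

lemma finite_chains: "finite (chains i)"
proof (induction i)
  case (Suc i)
  have "chains (Suc i) \<subseteq> (\<lambda>(s, c). s # c) ` (E \<times> chains i)" using allowed_subset by auto
  then show ?case using Suc fin by (meson finite_SigmaI finite_imageI finite_subset)
qed simp

text \<open>
  The Schreyer order: the term of a vector with monomial \<open>\<mu>\<close> at the basis element \<open>c\<close> is compared by its
  unreduced product with all variables of \<open>c\<close>, with ties broken from the oldest entry of the chain,
  which is why the chain is reversed.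
\<close>

definition key :: "('x \<Rightarrow>\<^sub>0 nat) \<Rightarrow> 'e list \<Rightarrow> ('e \<Rightarrow>\<^sub>0 nat) \<times> 'e list" where
  "key \<mu> c = (nf \<mu> + wt c, rev c)"

lemma key_inj: "\<lbrakk>\<mu> \<in> M; \<nu> \<in> M; key \<mu> c = key \<nu> d\<rbrakk> \<Longrightarrow> \<mu> = \<nu> \<and> c = d"
  unfolding key_def by (metis \<theta>_nf add_right_cancel fst_conv rev_rev_ident snd_conv)

text \<open>Equal length matters, since a proper prefix precedes its extensions. Reversed chains of
  equal length are compared by their tails, and the newest entry only decides between chains with
  the same tail.\<close>

lemma rev_less_Cons:
  fixes c d :: "'e list"
  assumes "length c = length d"
  shows "rev (s # c) < rev (t # d) \<longleftrightarrow> rev c < rev d \<or> c = d \<and> s < t"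
proof (cases "c = d")
  case True
  have "\<not> rev d < rev d" by simp
  then show ?thesis using True by (simp add: list_less_def lexord_same_pref_iff)
next
  case False
  then show ?thesis using assms
    by (auto simp: list_less_def intro: lexord_sufI dest: lexord_sufE)
qed

definition below :: "nat \<Rightarrow> ('e \<Rightarrow>\<^sub>0 nat) \<times> 'e list \<Rightarrow> ('e list \<Rightarrow> ('x, 'k::field) mpoly) \<Rightarrow> bool" where
  "below i \<kappa> v \<longleftrightarrow> (\<forall>c\<in>chains i. \<forall>\<mu>\<in>supp (v c). key \<mu> c < \<kappa>)"

definition B :: "('x, 'k::field) mpoly set" where "B = {f. supp f \<subseteq> M}"

definition piece :: "nat \<Rightarrow> ('x, 'k::field) mpoly set" where
  "piece d = {f. \<forall>\<mu>\<in>supp f. \<mu> \<in> M \<and> \<delta> \<mu> = d}"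

text \<open>The prescribed leading term of the linear element with index \<open>d\<close>: the
  variable \<open>hd d\<close> placed at the basis element \<open>tl d\<close>. At stage 0 these
  terms are the differential itself.\<close>

definition unitvec :: "'e list \<Rightarrow> 'e list \<Rightarrow> ('x, 'k::field) mpoly" where
  "unitvec d c = (if c = tl d then single (\<theta> (single (hd d) 1)) 1 else 0)"

definition syz :: "nat \<Rightarrow> ('e list \<Rightarrow> 'e list \<Rightarrow> ('x, 'k::field) mpoly) \<Rightarrow>
    ('e list \<Rightarrow> ('x, 'k) mpoly) \<Rightarrow> 'e list \<Rightarrow> ('x, 'k) mpoly" where
  "syz i z v c = (\<Sum>d\<in>chains (Suc i). v d * z d c)"

text \<open>
  The invariant of the construction: \<open>Z\<close> is the syzygy module inside the \<open>i\<close>-th free module, its leading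
  monomials at \<open>c\<close> are divisible by a variable of \<open>allowed c\<close>, and the linear elements \<open>z (s # c)\<close> of
  \<open>Z\<close> realize the leading terms \<open>s\<close> at \<open>c\<close>.
\<close>

definition stage :: "nat \<Rightarrow> ('e list \<Rightarrow> ('x, 'k::field) mpoly) set \<Rightarrow>
    ('e list \<Rightarrow> 'e list \<Rightarrow> ('x, 'k) mpoly) \<Rightarrow> bool" where
  "stage i Z z \<longleftrightarrow>
     (\<forall>v\<in>Z. \<forall>w\<in>Z. (\<lambda>c. v c - w c) \<in> Z) \<and>
     (\<forall>g\<in>B. \<forall>v\<in>Z. (\<lambda>c. g * v c) \<in> Z) \<and>
     (\<forall>v\<in>Z. (\<forall>c\<in>chains i. v c \<in> B) \<longrightarrow> (\<forall>c\<in>chains i. \<forall>\<mu>\<in>supp (v c).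
        (\<forall>c'\<in>chains i. \<forall>\<mu>'\<in>supp (v c'). key \<mu>' c' \<le> key \<mu> c) \<longrightarrow> supp (nf \<mu>) \<inter> allowed c \<noteq> {})) \<and>
     (\<forall>d\<in>chains (Suc i). z d \<in> Z \<and> (\<forall>c\<in>chains i. z d c \<in> piece 1) \<and>
        below i (wt d, rev (tl d)) (\<lambda>c. z d c - unitvec d c))"

lemma stageD:
  assumes "stage i Z z"
  shows "v \<in> Z \<Longrightarrow> w \<in> Z \<Longrightarrow> (\<lambda>c. v c - w c) \<in> Z"
    and "g \<in> B \<Longrightarrow> v \<in> Z \<Longrightarrow> (\<lambda>c. g * v c) \<in> Z"
    and "\<lbrakk>v \<in> Z; \<forall>c\<in>chains i. v c \<in> B; c \<in> chains i; \<mu> \<in> supp (v c);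
        \<forall>c'\<in>chains i. \<forall>\<mu>'\<in>supp (v c'). key \<mu>' c' \<le> key \<mu> c\<rbrakk> \<Longrightarrow> supp (nf \<mu>) \<inter> allowed c \<noteq> {}"
    and "d \<in> chains (Suc i) \<Longrightarrow> z d \<in> Z"
    and "d \<in> chains (Suc i) \<Longrightarrow> c \<in> chains i \<Longrightarrow> z d c \<in> piece 1"
    and "d \<in> chains (Suc i) \<Longrightarrow> below i (wt d, rev (tl d)) (\<lambda>c. z d c - unitvec d c)"
  using assms unfolding stage_def by blast+

section \<open>Homogeneous pieces of the toric ring\<close>

lemma piece_B: "f \<in> piece d \<Longrightarrow> f \<in> B"
  by (auto simp: piece_def B_def)

lemma piece_mult: "f \<in> piece d \<Longrightarrow> g \<in> piece e \<Longrightarrow> f * g \<in> piece (d + e)"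
  unfolding piece_def using keys_mult[of f g] by (fastforce simp: \<delta>_add intro: M_add)

lemma piece_add: "f \<in> piece d \<Longrightarrow> g \<in> piece d \<Longrightarrow> f + g \<in> piece d"
  unfolding piece_def using keys_add[of f g] by blast

lemma piece_diff: "f \<in> piece d \<Longrightarrow> g \<in> piece d \<Longrightarrow> f - g \<in> piece d"
  unfolding piece_def using supp_minus[of f g] by blast

lemma piece_0: "0 \<in> piece d" by (simp add: piece_def)

lemma piece_single: "\<mu> \<in> M \<Longrightarrow> single \<mu> a \<in> piece (\<delta> \<mu>)"
  by (simp add: piece_def)

lemma B_mult: "f \<in> B \<Longrightarrow> g \<in> B \<Longrightarrow> f * g \<in> B"
  unfolding B_def using keys_mult[of f g] M_add by blast

lemma B_add: "f \<in> B \<Longrightarrow> g \<in> B \<Longrightarrow> f + g \<in> B"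
  unfolding B_def using keys_add[of f g] by blast

lemma B_diff: "f \<in> B \<Longrightarrow> g \<in> B \<Longrightarrow> f - g \<in> B"
  unfolding B_def using supp_minus[of f g] by blast

lemma B_0: "0 \<in> B" by (simp add: B_def)

lemma B_sum: "(\<And>i. i \<in> A \<Longrightarrow> f i \<in> B) \<Longrightarrow> sum f A \<in> B"
  by (induction A rule: infinite_finite_induct) (auto simp: B_0 B_add)

lemma B_single: "\<mu> \<in> M \<Longrightarrow> single \<mu> a \<in> B"
  by (simp add: B_def)

lemma unitvec_piece: "d \<in> chains (Suc i) \<Longrightarrow> unitvec d c \<in> piece 1"
proof -
  assume "d \<in> chains (Suc i)"
  then have "hd d \<in> E" using allowed_subset by fastforce
  then show ?thesis using \<delta>_var[of "hd d"] \<theta>_M[of "single (hd d) 1"]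
    by (auto simp: unitvec_def piece_def)
qed

section \<open>Bounds on vectors in the Schreyer order\<close>

lemma supp_monom_mult:
  fixes f :: "('x, 'k::field) mpoly"
  shows "supp (single \<mu> a * f) \<subseteq> (\<lambda>\<nu>. \<mu> + \<nu>) ` supp f"
  using keys_mult[of "single \<mu> a" f] by (auto split: if_splits)

text \<open>The product of two normal monomials may be reducible, so its key may drop below the sum;
  it never exceeds it, by \<open>nf_le\<close>. Hence strict bounds are stable under multiplication
  by a monomial, although the order on normal forms is not multiplicative.\<close>

lemma key_shift:
  assumes "supp u \<subseteq> E" "\<mu> \<in> M" "key \<mu> c < (w, l)"
  shows "key (\<theta> u + \<mu>) c < (u + w, l)"
proof -
  have "nf (\<theta> u + \<mu>) \<le> u + nf \<mu>"
    using nf_le[of "u + nf \<mu>"] assms nf[of \<mu>] normal_E by (simp add: \<theta>_add supp_add_nat)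
  then have le: "nf (\<theta> u + \<mu>) + wt c \<le> u + (nf \<mu> + wt c)"
    by (metis add.assoc add_right_mono)
  have "nf \<mu> + wt c < w \<or> nf \<mu> + wt c = w \<and> rev c < l"
    using assms(3) by (auto simp: key_def)
  then show ?thesis
    using le by (auto simp: key_def intro: le_less_trans order.trans add_strict_left_mono)
qed

lemma below_shift:
  assumes "supp u \<subseteq> E" "\<forall>c\<in>chains i. v c \<in> B" "below i (w, l) v"
  shows "below i (u + w, l) (\<lambda>c. single (\<theta> u) a * v c)"
  unfolding below_def
proof (intro ballI)
  fix c \<mu> assume c: "c \<in> chains i" and "\<mu> \<in> supp (single (\<theta> u) a * v c)"
  then obtain \<nu> where \<nu>: "\<nu> \<in> supp (v c)" "\<mu> = \<theta> u + \<nu>" using supp_monom_mult by blast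
  then show "key \<mu> c < (u + w, l)"
    using key_shift[OF assms(1), of \<nu> c w l] assms(2,3) c by (auto simp: below_def B_def)
qed

lemma below_diff:
  assumes "below i \<kappa> v" "below i \<kappa> w"
  shows "below i \<kappa> (\<lambda>c. v c - w c)"
  unfolding below_def
proof (intro ballI)
  fix c \<mu> assume "c \<in> chains i" "\<mu> \<in> supp (v c - w c)"
  then show "key \<mu> c < \<kappa>" using assms supp_minus[of "v c" "w c"] by (auto simp: below_def)
qed

lemma below_add:
  assumes "below i \<kappa> v" "below i \<kappa> w"
  shows "below i \<kappa> (\<lambda>c. v c + w c)"
  unfolding below_def
proof (intro ballI)
  fix c \<mu> assume "c \<in> chains i" "\<mu> \<in> supp (v c + w c)"
  then show "key \<mu> c < \<kappa>" using assms keys_add[of "v c" "w c"] by (auto simp: below_def)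
qed

lemma leading_exists:
  assumes "c0 \<in> chains i" "v c0 \<noteq> 0"
  obtains c \<mu> where "c \<in> chains i" "\<mu> \<in> supp (v c)"
    "\<forall>c'\<in>chains i. \<forall>\<mu>'\<in>supp (v c'). key \<mu>' c' \<le> key \<mu> c"
proof -
  let ?T = "\<Union>c\<in>chains i. (\<lambda>\<mu>. key \<mu> c) ` supp (v c)"
  have fT: "finite ?T" using finite_chains by auto
  have "?T \<noteq> {}" using assms by (auto simp: keys_eq_empty)
  then have "Max ?T \<in> ?T" using fT by (rule Max_in[rotated])
  then obtain c \<mu> where c: "c \<in> chains i" "\<mu> \<in> supp (v c)" "Max ?T = key \<mu> c" by blast
  have "key \<mu>' c' \<le> key \<mu> c" if "c' \<in> chains i" "\<mu>' \<in> supp (v c')" for c' \<mu>'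
    unfolding c(3)[symmetric] using that by (intro Max_ge[OF fT]) blast
  then show ?thesis using c that by blast
qed

text \<open>A leading monomial would contain an allowed variable and thus have positive
  degree.\<close>

lemma stage_zero:
  assumes st: "stage i Z z" and v: "v \<in> Z" "\<forall>c\<in>chains i. v c \<in> piece 0" and c: "c \<in> chains i"
  shows "v c = 0"
proof (rule ccontr)
  assume "v c \<noteq> 0"
  then obtain c \<mu> where c: "c \<in> chains i" "\<mu> \<in> supp (v c)"
    "\<forall>c'\<in>chains i. \<forall>\<mu>'\<in>supp (v c'). key \<mu>' c' \<le> key \<mu> c"
    using leading_exists[OF c] by metis
  have "\<forall>c\<in>chains i. v c \<in> B" using v(2) piece_B by blast
  then obtain e where e: "e \<in> supp (nf \<mu>)" using stageD(3)[OF st v(1) _ c] by blast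
  have \<mu>: "\<mu> \<in> M" "\<delta> \<mu> = 0" using v(2) c by (auto simp: piece_def)
  have "coef (nf \<mu>) e \<le> 0"
    using coef_le_\<delta>[of e "nf \<mu>"] \<theta>_nf[OF \<mu>(1)] \<mu> e normal_E[OF normal_nf[OF \<mu>(1)]] by auto
  then show False using e by (simp add: in_keys_iff)
qed

text \<open>
  Unlike \<open>below (Suc i)\<close>, this forgets the newest entry of a chain in the tie break: it bounds the image of
  a vector in the previous free module.
\<close>

definition formal_below :: "nat \<Rightarrow> ('e \<Rightarrow>\<^sub>0 nat) \<times> 'e list \<Rightarrow> ('e list \<Rightarrow> ('x, 'k::field) mpoly) \<Rightarrow> bool" where
  "formal_below i \<kappa> v \<longleftrightarrow> (\<forall>d\<in>chains (Suc i). \<forall>\<mu>\<in>supp (v d). (nf \<mu> + wt d, rev (tl d)) < \<kappa>)"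

section \<open>Division by the linear elements of a syzygy module\<close>

lemma syz_add: "syz i z (\<lambda>d. v d + w d) c = syz i z v c + syz i z w c"
  by (simp add: syz_def distrib_right sum.distrib)

lemma syz_diff: "syz i z (\<lambda>d. v d - w d) c = syz i z v c - syz i z w c"
  by (simp add: syz_def left_diff_distrib sum_subtractf)

lemma syz_single:
  assumes "d \<in> chains (Suc i)"
  shows "syz i z (\<lambda>d'. if d' = d then g else 0) c = g * z d c"
proof -
  have "syz i z (\<lambda>d'. if d' = d then g else 0) c = (\<Sum>d'\<in>chains (Suc i). if d' = d then g * z d c else 0)"
    unfolding syz_def by (rule sum.cong) auto
  then show ?thesis using assms finite_chains[of "Suc i"] by (simp add: sum.delta del: chains.simps)
qed

lemma stage_rest_B:
  assumes "stage i Z z" "d \<in> chains (Suc i)" "c \<in> chains i"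
  shows "z d c - unitvec d c \<in> B"
  using stageD(5)[OF assms] unitvec_piece[OF assms(2)] by (intro B_diff piece_B)

lemma stage_rest:
  assumes "stage i Z z" "d \<in> chains (Suc i)" "supp u \<subseteq> E"
  shows "below i (u + wt d, rev (tl d)) (\<lambda>c. single (\<theta> u) a * (z d c - unitvec d c))"
  using stage_rest_B[OF assms(1,2)] stageD(6)[OF assms(1,2)] by (intro below_shift assms(3)) auto

text \<open>The leading monomial at \<open>c\<close> contains some allowed \<open>s\<close>, and
  subtracting the multiple of \<open>z (s # c)\<close> with the same leading term lowers the bound.
  The quotients collected in this way form a standard representation: \<open>formal_below\<close>
  records that no quotient times a prescribed leading term reaches \<kappa>. That control is what
  the next stage needs.\<close>

lemma stage_lift:
  assumes st: "stage i Z z" and v: "v \<in> Z" "\<forall>c\<in>chains i. v c \<in> piece (Suc n)" and bl: "below i \<kappa> v"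
  shows "\<exists>v'. (\<forall>d\<in>chains (Suc i). v' d \<in> piece n) \<and> formal_below i \<kappa> v' \<and> (\<forall>c\<in>chains i. syz i z v' c = v c)"
proof -
  \<comment> \<open>These are all keys that a term of degree \<open>Suc n\<close> can have. The
    induction runs on the number of them below the current bound.\<close>
  define F where "F = (\<Union>c\<in>chains i. (\<lambda>\<mu>. key \<mu> c) ` \<theta> ` {u. supp u \<subseteq> E \<and> \<delta> (\<theta> u) = Suc n})"
  have fF: "finite F" unfolding F_def using finite_chains finite_degree by auto
  have FI: "key \<mu> c \<in> F" if "\<mu> \<in> M" "\<delta> \<mu> = Suc n" "c \<in> chains i" for \<mu> c
    using that unfolding F_def M_def by blast
  show ?thesis using v bl
  proof (induction "card {k \<in> F. k < \<kappa>}" arbitrary: v \<kappa> rule: less_induct)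
    case less
    show ?case
    proof (cases "\<forall>c\<in>chains i. v c = 0")
      case True
      then show ?thesis
        by (intro exI[of _ "\<lambda>_. 0"]) (simp add: piece_0 formal_below_def syz_def)
    next
      case False
      then obtain c0 where "c0 \<in> chains i" "v c0 \<noteq> 0" by blast
      then obtain c \<mu> where c: "c \<in> chains i" and \<mu>: "\<mu> \<in> supp (v c)"
        and max: "\<forall>c'\<in>chains i. \<forall>\<mu>'\<in>supp (v c'). key \<mu>' c' \<le> key \<mu> c"
        by (rule leading_exists)
      have vB: "\<forall>c\<in>chains i. v c \<in> B" using less.prems(2) piece_B by blast
      have \<mu>M: "\<mu> \<in> M" "\<delta> \<mu> = Suc n" using less.prems(2) c \<mu> by (auto simp: piece_def)
      obtain s where s: "s \<in> supp (nf \<mu>)" "s \<in> allowed c"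
        using stageD(3)[OF st less.prems(1) vB c \<mu> max] by blast
      define d where "d = s # c"
      have d: "d \<in> chains (Suc i)" "tl d = c" "hd d = s" "wt d = single s 1 + wt c"
        unfolding d_def using c s by auto
      have sE: "s \<in> E" using s allowed_subset by blast
      define m where "m = nf \<mu> - single s 1"
      have m: "nf \<mu> = single s 1 + m"
        unfolding m_def using s(1) by (intro single_add_minus[symmetric]) (simp add: in_keys_iff)
      have mE: "supp m \<subseteq> E"
        unfolding m_def by (rule order.trans[OF supp_minus_nat normal_E[OF normal_nf[OF \<mu>M(1)]]])
      have \<mu>_eq: "\<mu> = \<theta> m + \<theta> (single s 1)"
        using \<theta>_nf[OF \<mu>M(1)] m by (simp add: \<theta>_add add.commute)
      have \<delta>m: "\<delta> (\<theta> m) = n"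
        using \<mu>M(2) \<delta>_var[OF sE] by (simp add: \<mu>_eq \<delta>_add)
      define g where "g = single (\<theta> m) (coef (v c) \<mu>)"
      have gc: "g \<in> piece n" unfolding g_def using piece_single[OF \<theta>_M[OF mE]] \<delta>m by metis
      have \<kappa>': "key \<mu> c = (m + wt d, rev c)" by (simp add: key_def m d add_ac)
      have gu: "g * unitvec d c' = (if c' = c then single \<mu> (coef (v c) \<mu>) else 0)" for c'
        by (simp add: unitvec_def d g_def mult_single \<mu>_eq)
      define w where "w = (\<lambda>c'. v c' - g * z d c')"
      have wZ: "w \<in> Z"
        unfolding w_def using gc piece_B stageD[OF st] less.prems(1) d(1) by blast
      have wc: "\<forall>c\<in>chains i. w c \<in> piece (Suc n)"
      proof
        fix c' assume c': "c' \<in> chains i"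
        then have "g * z d c' \<in> piece (n + 1)" using piece_mult gc stageD(5)[OF st d(1)] by blast
        then show "w c' \<in> piece (Suc n)" unfolding w_def using less.prems(2) c' piece_diff by auto
      qed
      have "below i (m + wt d, rev c) (\<lambda>c'. single (\<theta> m) (coef (v c) \<mu>) * (z d c' - unitvec d c'))"
        using stage_rest[OF st d(1), of m "coef (v c) \<mu>"] mE d(2) by simp
      then have b1: "below i (key \<mu> c) (\<lambda>c'. g * (z d c' - unitvec d c'))"
        by (simp add: \<kappa>' g_def)
      \<comment> \<open>Subtracting \<open>g\<close> times the prescribed leading term removes
        exactly the leading term of \<open>v\<close>. What \<open>g\<close> times the rest of
        \<open>z d\<close> adds is smaller by \<open>b1\<close>.\<close>
      have b2: "below i (key \<mu> c) (\<lambda>c'. v c' - g * unitvec d c')"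
        unfolding below_def
      proof (intro ballI)
        fix c' \<nu> assume c': "c' \<in> chains i" and \<nu>: "\<nu> \<in> supp (v c' - g * unitvec d c')"
        have "\<not> (\<nu> = \<mu> \<and> c' = c)" using \<nu> by (auto simp: in_keys_iff lookup_minus gu)
        moreover have \<nu>v: "\<nu> \<in> supp (v c')"
          using \<nu> \<mu> by (auto simp: in_keys_iff lookup_minus gu lookup_single when_def split: if_splits)
        ultimately have "key \<nu> c' \<noteq> key \<mu> c"
          using key_inj[of \<nu> \<mu> c' c] \<mu>M vB c' by (auto simp: B_def)
        then show "key \<nu> c' < key \<mu> c" using max \<nu>v c' by (simp add: order.strict_iff_order)
      qed
      have wb: "below i (key \<mu> c) w"
        using below_diff[OF b2 b1] by (simp add: w_def algebra_simps)
      have k\<kappa>: "key \<mu> c < \<kappa>" using less.prems(3) c \<mu> by (auto simp: below_def)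
      have "card {k \<in> F. k < key \<mu> c} < card {k \<in> F. k < \<kappa>}"
      proof (rule psubset_card_mono)
        show "finite {k \<in> F. k < \<kappa>}" using fF by simp
        show "{k \<in> F. k < key \<mu> c} \<subset> {k \<in> F. k < \<kappa>}"
          using k\<kappa> FI[OF \<mu>M c] by (auto dest: order.strict_trans)
      qed
      then obtain v2 where v2: "\<forall>d\<in>chains (Suc i). v2 d \<in> piece n" "formal_below i (key \<mu> c) v2"
        "\<forall>c\<in>chains i. syz i z v2 c = w c"
        using less.hyps[OF _ wZ wc wb] by blast
      define v' where "v' = (\<lambda>d'. v2 d' + (if d' = d then g else 0))"
      have "\<forall>c\<in>chains i. syz i z v' c = v c"
        unfolding v'_def syz_add syz_single[OF d(1)] using v2(3) by (simp add: w_def)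
      moreover have "\<forall>d\<in>chains (Suc i). v' d \<in> piece n"
        using v2(1) gc by (auto simp: v'_def intro: piece_add simp del: chains.simps)
      moreover have "formal_below i \<kappa> v'"
        unfolding formal_below_def
      proof (intro ballI)
        fix d' \<nu> assume d': "d' \<in> chains (Suc i)" and \<nu>: "\<nu> \<in> supp (v' d')"
        have "\<nu> \<in> supp (v2 d') \<or> d' = d \<and> \<nu> = \<theta> m"
          using \<nu> keys_add[of "v2 d'" g] by (auto simp: v'_def g_def split: if_splits)
        then have "(nf \<nu> + wt d', rev (tl d')) \<le> key \<mu> c"
        proof
          assume "\<nu> \<in> supp (v2 d')"
          then show ?thesis using v2(2) d' unfolding formal_below_def by (meson less_imp_le)
        next
          assume "d' = d \<and> \<nu> = \<theta> m"
          moreover have "nf (\<theta> m) + wt d \<le> m + wt d" using nf_le[OF mE] by (rule add_right_mono)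
          ultimately show ?thesis by (auto simp: \<kappa>' d(2))
        qed
        then show "(nf \<nu> + wt d', rev (tl d')) < \<kappa>" using k\<kappa> by (rule le_less_trans)
      qed
      ultimately show ?thesis by blast
    qed
  qed
qed

text \<open>The strict comparison is already decided by the monomial parts or by the tails, so the
  newest entries are never reached and any \<open>s\<close> may be put in front.\<close>

lemma formal_below_below:
  assumes "formal_below i (w, rev c) v" "c \<in> chains i"
  shows "below (Suc i) (w, rev (s # c)) v"
  unfolding below_def
proof (intro ballI)
  fix d \<mu> assume d: "d \<in> chains (Suc i)" and \<mu>: "\<mu> \<in> supp (v d)"
  then obtain s' c' where d_eq: "d = s' # c'" "c' \<in> chains i" by auto
  have "(nf \<mu> + wt d, rev c') < (w, rev c)"
    using assms(1) d \<mu> unfolding formal_below_def d_eq(1) by fastforce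
  then show "key \<mu> d < (w, rev (s # c))"
    using rev_less_Cons[of c' c s' s] chains_length[OF assms(2)] chains_length[OF d_eq(2)]
    unfolding key_def d_eq(1) by (auto simp del: rev.simps)
qed

section \<open>Linear generators and leading terms of the next syzygy module\<close>

lemma piece_if: "g \<in> piece n \<Longrightarrow> (if P then g else 0) \<in> piece n"
  by (simp add: piece_0)

lemma unitvec_eq: "unitvec (s # c) c' = (if c' = c then single (\<theta> (single s 1)) 1 else 0)"
  by (simp add: unitvec_def)

lemma single_mult_unitvec:
  "single \<mu> a * unitvec (s # c) c' = (if c' = c then single (\<mu> + \<theta> (single s 1)) a else 0)"
  by (simp add: unitvec_eq mult_single)

text \<open>Write \<open>d = s # c\<close>. If \<open>y\<close> and \<open>s\<close> form a bad
  pair, their product at \<open>c\<close> is not normal, so \<open>Y * z d\<close> drops below its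
  expected leading term by itself. Otherwise \<open>y\<close> is an earlier choice at
  \<open>c\<close>, and the multiple of \<open>z (y # c)\<close> by \<open>s\<close> cancels the
  leading term, as in an S-polynomial. In both cases \<open>stage_lift\<close> divides the
  remainder, and the correction stays below \<open>y\<close> at \<open>d\<close>.\<close>

lemma stage_syzygy:
  assumes st: "stage i Z (z :: 'e list \<Rightarrow> 'e list \<Rightarrow> ('x, 'k::field) mpoly)"
    and e: "y # d \<in> chains (Suc (Suc i))"
  shows "\<exists>z'. (\<forall>d'\<in>chains (Suc i). z' d' \<in> piece 1) \<and> (\<forall>c\<in>chains i. syz i z z' c = 0) \<and>
    below (Suc i) (wt (y # d), rev d) (\<lambda>d'. z' d' - unitvec (y # d) d')"
proof -
  have d: "d \<in> chains (Suc i)" and y: "y \<in> allowed d" using e by auto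
  then obtain s c where dc: "d = s # c" and c: "c \<in> chains i" and s: "s \<in> allowed c" by auto
  have yE: "y \<in> E" and sE: "s \<in> E" using y s allowed_subset by blast+
  define Y :: "('x, 'k) mpoly" where "Y = single (\<theta> (single y 1)) 1"
  have Yc: "Y \<in> piece 1"
    unfolding Y_def using piece_single[OF \<theta>_M, of "single y 1"] \<delta>_var[OF yE] yE by simp
  have suppy: "supp (single y (1::nat)) \<subseteq> E" and supps: "supp (single s (1::nat)) \<subseteq> E"
    using yE sE by auto
  \<comment> \<open>The unreduced product of \<open>y\<close> with the leading term of
    \<open>z d\<close>, at the basis element \<open>c\<close>. Whatever lies strictly below it lifts
    to terms below the desired leading term \<open>y\<close> at \<open>d\<close>.\<close>
  define \<kappa> where "\<kappa> = (wt (y # d), rev c)"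
  have b1: "below i \<kappa> (\<lambda>c'. Y * (z d c' - unitvec d c'))"
    using stage_rest[OF st d suppy, of 1] by (simp add: Y_def \<kappa>_def dc)
  have Yzc: "\<forall>c'\<in>chains i. Y * z d c' \<in> piece (Suc 1)"
    using piece_mult[OF Yc stageD(5)[OF st d]] by simp
  have YzZ: "(\<lambda>c'. Y * z d c') \<in> Z"
    using stageD(2)[OF st piece_B[OF Yc] stageD(4)[OF st d]] .
  show ?thesis
  proof (cases "bad y s")
    case True
    have "below i \<kappa> (\<lambda>c'. Y * unitvec d c')"
      unfolding below_def
    proof (intro ballI)
      fix c' \<mu> assume "\<mu> \<in> supp (Y * unitvec d c')"
      then have \<mu>: "c' = c" "\<mu> = \<theta> (single y 1 + single s 1)"
        by (auto simp: Y_def dc single_mult_unitvec \<theta>_add split: if_splits)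
      have "\<not> normal (single y 1 + single s 1)"
        using True by (auto simp: normal_def supp_add_nat)
      then have "nf \<mu> < single y 1 + single s 1"
        unfolding \<mu>(2) using suppy supps by (intro nf_less) (auto simp: supp_add_nat)
      then have "nf \<mu> + wt c < single y 1 + single s 1 + wt c" by (rule add_strict_right_mono)
      then show "key \<mu> c' < \<kappa>" by (simp add: key_def \<kappa>_def \<mu>(1) dc add.assoc)
    qed
    from below_add[OF b1 this] have "below i \<kappa> (\<lambda>c'. Y * z d c')"
      by (simp add: algebra_simps)
    then obtain v where v: "\<forall>d\<in>chains (Suc i). v d \<in> piece 1" "formal_below i \<kappa> v"
      "\<forall>c\<in>chains i. syz i z v c = Y * z d c"
      using stage_lift[OF st YzZ Yzc] by blast
    define z' where "z' = (\<lambda>d'. (if d' = d then Y else 0) - v d')"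
    have "\<forall>d'\<in>chains (Suc i). z' d' \<in> piece 1"
      unfolding z'_def using v(1) by (intro ballI piece_diff piece_if Yc) blast
    moreover have "\<forall>c\<in>chains i. syz i z z' c = 0"
      unfolding z'_def syz_diff syz_single[OF d] using v(3) by simp
    moreover have "below (Suc i) (wt (y # d), rev d) v"
      using formal_below_below[OF v(2)[unfolded \<kappa>_def] c, of s] by (simp add: dc)
    then have "below (Suc i) (wt (y # d), rev d) (\<lambda>d'. z' d' - unitvec (y # d) d')"
      by (simp add: z'_def unitvec_eq Y_def below_def)
    ultimately show ?thesis by blast
  next
    case False
    then have yc: "y \<in> allowed c" "y < s" using y by (auto simp: dc)
    define d2 where "d2 = y # c"
    have d2: "d2 \<in> chains (Suc i)" unfolding d2_def using c yc by auto
    define W :: "('x, 'k) mpoly" where "W = single (\<theta> (single s 1)) 1"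
    have Wc: "W \<in> piece 1"
      unfolding W_def using piece_single[OF \<theta>_M, of "single s 1"] \<delta>_var[OF sE] sE by simp
    have Wzc: "\<forall>c'\<in>chains i. W * z d2 c' \<in> piece (Suc 1)"
      using piece_mult[OF Wc stageD(5)[OF st d2]] by simp
    have WzZ: "(\<lambda>c'. W * z d2 c') \<in> Z"
      using stageD(2)[OF st piece_B[OF Wc] stageD(4)[OF st d2]] .
    have b2: "below i \<kappa> (\<lambda>c'. W * (z d2 c' - unitvec d2 c'))"
      using stage_rest[OF st d2 supps, of 1] by (simp add: W_def \<kappa>_def dc d2_def add_ac)
    have "Y * unitvec d c' = W * unitvec d2 c'" for c'
      by (simp add: W_def Y_def dc d2_def single_mult_unitvec add_ac)
    then have bY: "below i \<kappa> (\<lambda>c'. Y * z d c' - W * z d2 c')"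
      using below_diff[OF b1 b2] by (simp add: algebra_simps)
    have ZY: "(\<lambda>c'. Y * z d c' - W * z d2 c') \<in> Z"
      using stageD(1)[OF st YzZ WzZ] .
    have "\<forall>c'\<in>chains i. Y * z d c' - W * z d2 c' \<in> piece (Suc 1)"
      using Yzc Wzc piece_diff by blast
    then obtain v where v: "\<forall>d\<in>chains (Suc i). v d \<in> piece 1" "formal_below i \<kappa> v"
      "\<forall>c\<in>chains i. syz i z v c = Y * z d c - W * z d2 c"
      using stage_lift[OF st ZY _ bY] by blast
    define z' where "z' = (\<lambda>d'. (if d' = d then Y else 0) - ((if d' = d2 then W else 0) + v d'))"
    have f1: "\<forall>d'\<in>chains (Suc i). z' d' \<in> piece 1"
      unfolding z'_def using v(1) by (intro ballI piece_diff piece_add piece_if Yc Wc) blast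
    have f2: "\<forall>c\<in>chains i. syz i z z' c = 0"
      unfolding z'_def syz_diff syz_add syz_single[OF d] syz_single[OF d2] using v(3) by simp
    have bv: "below (Suc i) (wt (y # d), rev d) v"
      using formal_below_below[OF v(2)[unfolded \<kappa>_def] c, of s] by (simp add: dc)
    have bW: "below (Suc i) (wt (y # d), rev d) (\<lambda>d'. if d' = d2 then W else 0)"
      unfolding below_def
    proof (intro ballI)
      fix d' \<mu> assume "\<mu> \<in> supp (if d' = d2 then W else 0)"
      then have \<mu>: "d' = d2" "\<mu> = \<theta> (single s 1)" by (auto simp: W_def split: if_splits)
      have "nf \<mu> + wt d2 \<le> single s 1 + wt d2"
        unfolding \<mu>(2) by (intro add_right_mono nf_le supps)
      \<comment> \<open>The term \<open>s\<close> at \<open>d2\<close> and the term \<open>y\<close>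
        at \<open>d\<close> have the same unreduced product. Only the tie break separates them, and
        this is the reason for requiring \<open>y < s\<close> in \<open>allowed\<close>.\<close>
      moreover have "rev d2 < rev d"
        unfolding d2_def dc using rev_less_Cons[of c c y s] yc(2) by simp
      ultimately show "key \<mu> d' < (wt (y # d), rev d)"
        by (auto simp: key_def \<mu>(1) dc d2_def add_ac)
    qed
    have "below (Suc i) (wt (y # d), rev d) (\<lambda>d'. 0 - ((if d' = d2 then W else 0) + v d'))"
      by (intro below_diff below_add bW bv) (simp add: below_def)
    moreover have "(\<lambda>d'. 0 - ((if d' = d2 then W else 0) + v d')) = (\<lambda>d'. z' d' - unitvec (y # d) d')"
      by (auto simp: z'_def unitvec_eq Y_def)
    ultimately have "below (Suc i) (wt (y # d), rev d) (\<lambda>d'. z' d' - unitvec (y # d) d')" by simp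
    then show ?thesis using f1 f2 by blast
  qed
qed

text \<open>If the leading monomial \<mu> at \<open>d = s # c\<close> contained no allowed variable,
  then \<mu> times \<open>s\<close> would be normal. Its monomial \<rho> would then occur in the
  image at \<open>c\<close> through the leading term alone: no other term of \<open>v\<close>
  contributes to that coefficient, so it could not cancel.\<close>

lemma stage_kernel_leading:
  assumes st: "stage i Z (z :: 'e list \<Rightarrow> 'e list \<Rightarrow> ('x, 'k::field) mpoly)"
    and v: "\<forall>d\<in>chains (Suc i). v d \<in> B" "\<forall>c\<in>chains i. syz i z v c = 0"
    and d: "d \<in> chains (Suc i)" and \<mu>: "\<mu> \<in> supp (v d)"
    and max: "\<forall>d'\<in>chains (Suc i). \<forall>\<nu>\<in>supp (v d'). key \<nu> d' \<le> key \<mu> d"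
  shows "supp (nf \<mu>) \<inter> allowed d \<noteq> {}"
proof
  assume disj: "supp (nf \<mu>) \<inter> allowed d = {}"
  obtain s c where dc: "d = s # c" and c: "c \<in> chains i" and s: "s \<in> allowed c" using d by auto
  have sE: "s \<in> E" using s allowed_subset by blast
  have supps: "supp (single s (1::nat)) \<subseteq> E" using sE by simp
  have \<mu>M: "\<mu> \<in> M" using v(1) d \<mu> by (auto simp: B_def)
  define m where "m = nf \<mu>"
  have mE: "supp m \<subseteq> E" unfolding m_def by (rule normal_E[OF normal_nf[OF \<mu>M]])
  define \<rho> where "\<rho> = \<theta> (m + single s 1)"
  have \<rho>_eq: "\<rho> = \<mu> + \<theta> (single s 1)" by (simp add: \<rho>_def \<theta>_add m_def \<theta>_nf[OF \<mu>M])
  have "normal (m + single s 1)"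
  proof -
    have "\<not> bad a s" if "a \<in> supp m" for a
      using disj that mE by (auto simp: dc m_def)
    then have "\<not> bad a s \<and> \<not> bad s a" if "a \<in> supp m" for a using that bad_sym by blast
    then show ?thesis
      using normal_nf[OF \<mu>M] sE bad_irrefl by (auto simp: normal_def supp_add_nat m_def)
  qed
  then have nf\<rho>: "nf \<rho> = m + single s 1" unfolding \<rho>_def by (rule nf_normal)
  have key\<rho>: "key \<rho> c = (m + wt d, rev c)" by (simp add: key_def nf\<rho> dc add_ac)
  \<comment> \<open>The lower terms of \<open>z d'\<close> only produce keys strictly below the
    unreduced product with the leading term, and that product is at most the key of \<rho> at
    \<open>c\<close>.\<close>
  have rest0: "coef (single \<nu> a * (z d' c - unitvec d' c)) \<rho> = 0"
    if d': "d' \<in> chains (Suc i)" and \<nu>: "\<nu> \<in> M" and le: "key \<nu> d' \<le> key \<mu> d" for \<nu> d' a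
  proof (rule ccontr)
    assume "coef (single \<nu> a * (z d' c - unitvec d' c)) \<rho> \<noteq> 0"
    then have \<rho>: "\<rho> \<in> supp (single (\<theta> (nf \<nu>)) a * (z d' c - unitvec d' c))"
      by (simp add: in_keys_iff \<theta>_nf[OF \<nu>])
    obtain s' c' where d'c': "d' = s' # c'" "c' \<in> chains i" using d' by auto
    have "key \<rho> c < (nf \<nu> + wt d', rev c')"
      using stage_rest[OF st d' normal_E[OF normal_nf[OF \<nu>]], of a] c \<rho>
      unfolding below_def d'c'(1) by fastforce
    also have "\<dots> \<le> (m + wt d, rev c)"
      using le rev_less_Cons[of c c' s s'] rev_less_Cons[of c' c s' s] chains_length[OF c] chains_length[OF d'c'(2)]
      by (auto simp: key_def m_def dc d'c'(1) order.order_iff_strict simp del: rev.simps)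
    finally show False by (simp add: key\<rho>)
  qed
  \<comment> \<open>A prescribed leading term could meet \<rho> only as \<nu> times
    \<open>s'\<close> at the same \<open>c\<close>. As \<open>m + single s 1\<close> is the least
    exponent in its fiber, maximality of the key of \<mu> forces equality of the two unreduced
    products and \<open>s' < s\<close>. Then \<open>s'\<close> divides \<open>m\<close> and belongs
    to \<open>allowed d\<close>, contrary to the assumption.\<close>
  have unit0: "coef (single \<nu> a * unitvec d' c) \<rho> = 0"
    if d': "d' \<in> chains (Suc i)" and \<nu>: "\<nu> \<in> M" and less: "key \<nu> d' < key \<mu> d" for \<nu> d' and a :: 'k
  proof (rule ccontr)
    assume nz: "coef (single \<nu> a * unitvec d' c) \<rho> \<noteq> 0"
    obtain s' c' where d'c': "d' = s' # c'" "c' \<in> chains i" "s' \<in> allowed c'" using d' by auto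
    have c': "c' = c" and \<rho>: "\<rho> = \<nu> + \<theta> (single s' 1)"
      using nz by (auto simp: d'c'(1) single_mult_unitvec lookup_single when_def split: if_splits)
    have s'E: "s' \<in> E" using d'c'(3) allowed_subset by blast
    have "\<rho> = \<theta> (nf \<nu> + single s' 1)" by (simp add: \<rho> \<theta>_add \<theta>_nf[OF \<nu>])
    then have le: "m + single s 1 \<le> nf \<nu> + single s' 1"
      using nf_le[of "nf \<nu> + single s' 1"] normal_E[OF normal_nf[OF \<nu>]] s'E nf\<rho>
      by (simp add: supp_add_nat)
    then have "m + single s 1 + wt c \<le> nf \<nu> + single s' 1 + wt c" by (rule add_right_mono)
    then have eq: "nf \<nu> + wt d' = m + wt d" and "rev d' < rev d"
      using less by (auto simp: key_def dc d'c'(1) c' m_def add.assoc)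
    then have "s' < s" using rev_less_Cons[of c c s' s] by (simp add: dc d'c'(1) c')
    from eq have "nf \<nu> + single s' 1 + wt c = m + single s 1 + wt c"
      by (simp add: dc d'c'(1) c' add.assoc)
    then have "nf \<nu> + single s' 1 = m + single s 1" by (rule add_right_imp_eq)
    then have "s' \<in> supp (m + single s 1)" by (metis supp_add_nat UnI2 keys_single insertI1 zero_neq_one)
    then have "s' \<in> supp m" using \<open>s' < s\<close> by (auto simp: supp_add_nat)
    then show False using disj \<open>s' < s\<close> d'c'(3) s'E by (auto simp: dc c' m_def)
  qed
  have term0: "coef (single \<nu> a * z d' c) \<rho> = 0"
    if "d' \<in> chains (Suc i)" "\<nu> \<in> M" "key \<nu> d' < key \<mu> d" for \<nu> d' and a :: 'k
    using rest0[OF that(1,2) less_imp_le[OF that(3)], of a] unit0[OF that, of a]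
    by (simp add: right_diff_distrib lookup_minus)
  have expand: "coef (v d' * z d' c) \<rho> =
      (\<Sum>\<nu>\<in>supp (v d'). coef (single \<nu> (coef (v d') \<nu>) * z d' c) \<rho>)" for d'
    by (subst poly_decomp[of "v d'", symmetric]) (simp add: sum_distrib_right lookup_sum)
  have other: "coef (v d' * z d' c) \<rho> = 0" if d': "d' \<in> chains (Suc i)" "d' \<noteq> d" for d'
    unfolding expand
  proof (rule sum.neutral, rule ballI)
    fix \<nu> assume \<nu>: "\<nu> \<in> supp (v d')"
    have \<nu>M: "\<nu> \<in> M" using v(1) d'(1) \<nu> by (auto simp: B_def)
    have "key \<nu> d' \<noteq> key \<mu> d" using key_inj[OF \<nu>M \<mu>M] d'(2) by blast
    then have "key \<nu> d' < key \<mu> d" using max d'(1) \<nu> by (simp add: order.strict_iff_order)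
    then show "coef (single \<nu> (coef (v d') \<nu>) * z d' c) \<rho> = 0" by (rule term0[OF d'(1) \<nu>M])
  qed
  have "coef (v d * z d c) \<rho> =
      (\<Sum>\<nu>\<in>supp (v d). if \<nu> = \<mu> then coef (single \<mu> (coef (v d) \<mu>) * z d c) \<rho> else 0)"
    unfolding expand
  proof (rule sum.cong[OF refl])
    fix \<nu> assume \<nu>: "\<nu> \<in> supp (v d)"
    have \<nu>M: "\<nu> \<in> M" using v(1) d \<nu> by (auto simp: B_def)
    have "key \<nu> d < key \<mu> d" if "\<nu> \<noteq> \<mu>"
      using max d \<nu> that key_inj[OF \<nu>M \<mu>M, of d d] by (auto simp: order.strict_iff_order)
    then show "coef (single \<nu> (coef (v d) \<nu>) * z d c) \<rho> =
        (if \<nu> = \<mu> then coef (single \<mu> (coef (v d) \<mu>) * z d c) \<rho> else 0)"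
      using term0[OF d \<nu>M] by auto
  qed
  also have "\<dots> = coef (single \<mu> (coef (v d) \<mu>) * z d c) \<rho>"
    using \<mu> by simp
  also have "\<dots> = coef (single \<mu> (coef (v d) \<mu>) * unitvec d c) \<rho>"
    using rest0[OF d \<mu>M order_refl, of "coef (v d) \<mu>"] by (simp add: right_diff_distrib lookup_minus)
  also have "\<dots> = coef (v d) \<mu>"
    by (simp add: dc single_mult_unitvec \<rho>_eq)
  finally have "coef (v d * z d c) \<rho> \<noteq> 0" using \<mu> by (simp add: in_keys_iff)
  moreover have "coef (syz i z v c) \<rho> = coef (v d * z d c) \<rho>"
  proof -
    have "(\<Sum>d'\<in>chains (Suc i) - {d}. coef (v d' * z d' c) \<rho>) = 0"
      using other by (intro sum.neutral) blast
    then show ?thesis by (simp add: syz_def lookup_sum lookup_add sum.remove[OF finite_chains d] del: chains.simps)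
  qed
  ultimately show False using v(2) c by simp
qed

lemma syz_mult: "syz i z (\<lambda>d. g * v d) c = g * syz i z v c"
  by (simp add: syz_def sum_distrib_left mult.assoc)

lemma stage_Suc:
  assumes st: "stage i Z (z :: 'e list \<Rightarrow> 'e list \<Rightarrow> ('x, 'k::field) mpoly)"
  shows "\<exists>z'. stage (Suc i) {v. \<forall>c\<in>chains i. syz i z v c = 0} z'"
proof -
  have "\<forall>e\<in>chains (Suc (Suc i)). \<exists>z'. (\<forall>d\<in>chains (Suc i). z' d \<in> piece 1) \<and> (\<forall>c\<in>chains i. syz i z z' c = 0) \<and>
    below (Suc i) (wt e, rev (tl e)) (\<lambda>d. z' d - unitvec e d)"
  proof
    fix e assume e: "e \<in> chains (Suc (Suc i))"
    then obtain y d where yd: "e = y # d" by auto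
    show "\<exists>z'. (\<forall>d\<in>chains (Suc i). z' d \<in> piece 1) \<and> (\<forall>c\<in>chains i. syz i z z' c = 0) \<and>
      below (Suc i) (wt e, rev (tl e)) (\<lambda>d. z' d - unitvec e d)"
      using stage_syzygy[OF st e[unfolded yd]] unfolding yd list.sel .
  qed
  then obtain z' where z': "\<forall>e\<in>chains (Suc (Suc i)). (\<forall>d\<in>chains (Suc i). z' e d \<in> piece 1) \<and>
    (\<forall>c\<in>chains i. syz i z (z' e) c = 0) \<and> below (Suc i) (wt e, rev (tl e)) (\<lambda>d. z' e d - unitvec e d)"
    by (rule bchoice[THEN exE])
  have "stage (Suc i) {v. \<forall>c\<in>chains i. syz i z v c = 0} z'"
    unfolding stage_def
  proof (intro conjI)
    show "\<forall>v\<in>{v. \<forall>c\<in>chains i. syz i z v c = 0}. \<forall>w\<in>{v. \<forall>c\<in>chains i. syz i z v c = 0}.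
        (\<lambda>c. v c - w c) \<in> {v. \<forall>c\<in>chains i. syz i z v c = 0}"
      by (simp add: syz_diff)
    show "\<forall>g\<in>B. \<forall>v\<in>{v. \<forall>c\<in>chains i. syz i z v c = 0}. (\<lambda>c. g * v c) \<in> {v. \<forall>c\<in>chains i. syz i z v c = 0}"
      by (simp add: syz_mult)
    show "\<forall>v\<in>{v. \<forall>c\<in>chains i. syz i z v c = 0}. (\<forall>d\<in>chains (Suc i). v d \<in> B) \<longrightarrow>
       (\<forall>d\<in>chains (Suc i). \<forall>\<mu>\<in>supp (v d).
          (\<forall>d'\<in>chains (Suc i). \<forall>\<nu>\<in>supp (v d'). key \<nu> d' \<le> key \<mu> d) \<longrightarrow> supp (nf \<mu>) \<inter> allowed d \<noteq> {})"
    proof (intro ballI impI)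
      fix v d \<mu>
      assume "v \<in> {v. \<forall>c\<in>chains i. syz i z v c = 0}" and a: "\<forall>d\<in>chains (Suc i). v d \<in> B"
        "d \<in> chains (Suc i)" "\<mu> \<in> supp (v d)"
        "\<forall>d'\<in>chains (Suc i). \<forall>\<nu>\<in>supp (v d'). key \<nu> d' \<le> key \<mu> d"
      then have "\<forall>c\<in>chains i. syz i z v c = 0" by simp
      from stage_kernel_leading[OF st a(1) this a(2-4)] show "supp (nf \<mu>) \<inter> allowed d \<noteq> {}" .
    qed
    show "\<forall>e\<in>chains (Suc (Suc i)). z' e \<in> {v. \<forall>c\<in>chains i. syz i z v c = 0} \<and>
        (\<forall>d\<in>chains (Suc i). z' e d \<in> piece 1) \<and>
        below (Suc i) (wt e, rev (tl e)) (\<lambda>d. z' e d - unitvec e d)"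
      using z' by (simp del: chains.simps)
  qed
  then show ?thesis by blast
qed

text \<open>The start is the augmentation ideal. A nonconstant normal monomial contains some
  variable, and \<open>allowed []\<close> consists of all of them.\<close>

lemma stage_0: "stage 0 {v. 0 \<notin> supp (v [])} unitvec"
  unfolding stage_def
proof (intro conjI)
  have "\<theta> (single s 1) \<noteq> 0" if "s \<in> E" for s
    using \<delta>_var[OF that] by auto
  then show "\<forall>d\<in>chains (Suc 0). unitvec d \<in> {v. 0 \<notin> supp (v [])} \<and> (\<forall>c\<in>chains 0. unitvec d c \<in> piece 1) \<and>
     below 0 (wt d, rev (tl d)) (\<lambda>c. unitvec d c - unitvec d c)"
    using unitvec_piece[of _ 0] by (auto simp: below_def unitvec_eq)
  show "\<forall>v\<in>{v. 0 \<notin> supp (v [])}. \<forall>w\<in>{v. 0 \<notin> supp (v [])}. (\<lambda>c. v c - w c) \<in> {v. 0 \<notin> supp (v [])}"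
    by (simp add: in_keys_iff lookup_minus)
  have "a + b = 0 \<Longrightarrow> b = 0" for a b :: "'x \<Rightarrow>\<^sub>0 nat"
    by (metis add_is_0 lookup_add lookup_zero poly_mapping_eqI)
  then show "\<forall>g\<in>B. \<forall>v\<in>{v. 0 \<notin> supp (v [])}. (\<lambda>c. g * v c) \<in> {v. 0 \<notin> supp (v [])}"
    using keys_mult by fastforce
  show "\<forall>v\<in>{v. 0 \<notin> supp (v [])}. (\<forall>c\<in>chains 0. v c \<in> B) \<longrightarrow> (\<forall>c\<in>chains 0. \<forall>\<mu>\<in>supp (v c).
      (\<forall>c'\<in>chains 0. \<forall>\<mu>'\<in>supp (v c'). key \<mu>' c' \<le> key \<mu> c) \<longrightarrow> supp (nf \<mu>) \<inter> allowed c \<noteq> {})"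
  proof (intro ballI impI)
    fix v c \<mu> assume v: "v \<in> {v. 0 \<notin> supp (v [])}" "\<forall>c\<in>chains 0. v c \<in> B" "c \<in> chains 0" "\<mu> \<in> supp (v c)"
    then have \<mu>: "\<mu> \<in> M" "\<mu> \<noteq> 0" by (auto simp: B_def)
    then have "nf \<mu> \<noteq> 0" using \<theta>_nf[OF \<mu>(1)] by auto
    then have "supp (nf \<mu>) \<noteq> {}" by (simp add: keys_eq_empty)
    moreover have "supp (nf \<mu>) \<subseteq> allowed c" using normal_E[OF normal_nf[OF \<mu>(1)]] v(3) by simp
    ultimately show "supp (nf \<mu>) \<inter> allowed c \<noteq> {}" by blast
  qed
qed

section \<open>Homogeneous components and exactness\<close>

definition proj :: "nat \<Rightarrow> ('x, 'k::field) mpoly \<Rightarrow> ('x, 'k) mpoly" where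
  "proj d f = (\<Sum>\<mu>\<in>{\<mu>\<in>supp f. \<delta> \<mu> = d}. single \<mu> (coef f \<mu>))"

lemma coef_proj: "coef (proj d f) \<mu> = (if \<delta> \<mu> = d then coef f \<mu> else 0)"
proof -
  have "coef (proj d f) \<mu> = (\<Sum>\<nu>\<in>{\<nu>\<in>supp f. \<delta> \<nu> = d}. if \<nu> = \<mu> then coef f \<mu> else 0)"
    unfolding proj_def lookup_sum by (rule sum.cong) (auto simp: lookup_single when_def)
  then show ?thesis by (auto simp: in_keys_iff)
qed

lemma supp_proj: "supp (proj d f) = {\<mu>\<in>supp f. \<delta> \<mu> = d}"
  by (auto simp: in_keys_iff coef_proj split: if_splits)

lemma proj_piece: "f \<in> B \<Longrightarrow> proj d f \<in> piece d"
  by (auto simp: piece_def B_def supp_proj)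

lemma proj_of_piece: "f \<in> piece e \<Longrightarrow> proj d f = (if d = e then f else 0)"
  by (rule poly_mapping_eqI) (auto simp: coef_proj piece_def in_keys_iff)

lemma proj_sum: "proj d (sum f A) = (\<Sum>i\<in>A. proj d (f i))"
  by (rule poly_mapping_eqI) (auto simp: coef_proj lookup_sum)

lemma proj_decomp:
  assumes "finite A" "\<delta> ` supp f \<subseteq> A"
  shows "(\<Sum>d\<in>A. proj d f) = f"
proof (rule poly_mapping_eqI)
  fix \<mu>
  have "coef (\<Sum>d\<in>A. proj d f) \<mu> = (\<Sum>d\<in>A. if d = \<delta> \<mu> then coef f \<mu> else 0)"
    unfolding lookup_sum by (rule sum.cong) (auto simp: coef_proj)
  then show "coef (\<Sum>d\<in>A. proj d f) \<mu> = coef f \<mu>"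
    using assms by (auto simp: image_subset_iff in_keys_iff)
qed

lemma proj_mult:
  assumes "f \<in> B" "g \<in> piece 1"
  shows "proj (Suc d) (f * g) = proj d f * g"
proof -
  let ?A = "insert d (\<delta> ` supp f)"
  have "f * g = (\<Sum>e\<in>?A. proj e f * g)"
    by (subst proj_decomp[of ?A f, symmetric]) (auto simp: sum_distrib_right)
  then have "proj (Suc d) (f * g) = (\<Sum>e\<in>?A. proj (Suc d) (proj e f * g))"
    by (simp add: proj_sum)
  also have "\<dots> = (\<Sum>e\<in>?A. if e = d then proj d f * g else 0)"
  proof (rule sum.cong[OF refl])
    fix e
    have "proj e f * g \<in> piece (e + 1)" using assms proj_piece piece_mult by blast
    then show "proj (Suc d) (proj e f * g) = (if e = d then proj d f * g else 0)"
      by (simp add: proj_of_piece)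
  qed
  finally show ?thesis by simp
qed

text \<open>Dependent choice is the right form here, because the linear elements exist without being
  canonical and each syzygy module depends on those chosen one step before.\<close>

lemma resolution_exists:
  shows "\<exists>(Z :: nat \<Rightarrow> ('e list \<Rightarrow> ('x, 'k::field) mpoly) set) z.
    Z 0 = {v. 0 \<notin> supp (v [])} \<and> (\<forall>i. stage i (Z i) (z i)) \<and>
    (\<forall>i. Z (Suc i) = {v. \<forall>c\<in>chains i. syz i (z i) v c = 0})"
proof -
  define P :: "nat \<Rightarrow> ('e list \<Rightarrow> ('x, 'k::field) mpoly) set \<times> ('e list \<Rightarrow> 'e list \<Rightarrow> ('x, 'k) mpoly) \<Rightarrow> bool"
    where "P i p \<longleftrightarrow> stage i (fst p) (snd p) \<and> (i = 0 \<longrightarrow> fst p = {v. 0 \<notin> supp (v [])})" for i p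
  have "\<exists>f. \<forall>n. P n (f n) \<and> fst (f (Suc n)) = {v. \<forall>c\<in>chains n. syz n (snd (f n)) v c = 0}"
  proof (rule dependent_nat_choice)
    show "\<exists>p. P 0 p" using stage_0 by (auto simp: P_def)
    fix p n assume "P n p"
    then obtain z' where "stage (Suc n) {v. \<forall>c\<in>chains n. syz n (snd p) v c = 0} z'"
      using stage_Suc unfolding P_def by blast
    then show "\<exists>q. P (Suc n) q \<and> fst q = {v. \<forall>c\<in>chains n. syz n (snd p) v c = 0}"
      by (intro exI[of _ "({v. \<forall>c\<in>chains n. syz n (snd p) v c = 0}, z')"]) (simp add: P_def)
  qed
  then obtain f where f: "\<And>n. P n (f n)"
    "\<And>n. fst (f (Suc n)) = {v. \<forall>c\<in>chains n. syz n (snd (f n)) v c = 0}" by blast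
  show ?thesis
  proof (intro exI conjI allI)
    show "fst (f 0) = {v. 0 \<notin> supp (v [])}" using f(1)[of 0] by (simp add: P_def)
    show "stage i (fst (f i)) (snd (f i))" for i using f(1)[of i] by (simp add: P_def)
    show "fst (f (Suc i)) = {v. \<forall>c\<in>chains i. syz i (snd (f i)) v c = 0}" for i by (rule f(2))
  qed
qed

lemma syz_proj:
  assumes "stage i Z z" "\<forall>d\<in>chains (Suc i). v d \<in> B" "c \<in> chains i"
  shows "syz i z (\<lambda>d. proj n (v d)) c = proj (Suc n) (syz i z v c)"
  unfolding syz_def proj_sum
  by (intro sum.cong refl proj_mult[symmetric]) (use assms(2,3) stageD(5)[OF assms(1)] in blast)+

lemma below_exists: "\<exists>\<kappa>. below i \<kappa> v"
proof -
  let ?T = "\<Union>c\<in>chains i. (\<lambda>\<mu>. key \<mu> c) ` supp (v c)"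
  have fT: "finite (insert (0, []) ?T)" using finite_chains by auto
  obtain w l where wl: "Max (insert (0, []) ?T) = (w, l)" by (cases "Max (insert (0, []) ?T)")
  \<comment> \<open>A strict upper bound is wanted, and extending the list of the maximal key by any
    entry gives one.\<close>
  have "l < l @ [undefined]" by (simp add: list_less_def lexord_append_rightI)
  then have lt: "(w, l) < (w, l @ [undefined])" by simp
  have "below i (w, l @ [undefined]) v"
    unfolding below_def
  proof (intro ballI)
    fix c \<mu> assume "c \<in> chains i" "\<mu> \<in> supp (v c)"
    then have "key \<mu> c \<le> (w, l)" unfolding wl[symmetric] by (intro Max_ge[OF fT]) blast
    then show "key \<mu> c < (w, l @ [undefined])" using lt by (rule le_less_trans)
  qed
  then show ?thesis by blast
qed

text \<open>Each homogeneous component is lifted separately and the lifts are added; the component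
  of degree 0 vanishes by \<open>stage_zero\<close>. Membership in \<open>Z\<close> is assumed for
  every component because \<open>stage\<close> does not say that \<open>Z\<close> is graded.\<close>

lemma stage_exact:
  assumes st: "stage i Z z" and v: "\<And>d. (\<lambda>c. proj d (v c)) \<in> Z" "\<forall>c\<in>chains i. v c \<in> B"
  shows "\<exists>v'. (\<forall>d\<in>chains (Suc i). v' d \<in> B) \<and> (\<forall>c\<in>chains i. syz i z v' c = v c)"
proof -
  have "\<exists>v'. (\<forall>d\<in>chains (Suc i). v' d \<in> B) \<and> (\<forall>c\<in>chains i. syz i z v' c = proj n (v c))" for n
  proof (cases n)
    case 0
    have "proj 0 (v c) = 0" if "c \<in> chains i" for c
      using stage_zero[OF st v(1)[of 0] _ that] v(2) proj_piece by blast
    then show ?thesis by (intro exI[of _ "\<lambda>_. 0"]) (simp add: B_0 syz_def 0)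
  next
    case (Suc k)
    obtain \<kappa> where \<kappa>: "below i \<kappa> (\<lambda>c. proj n (v c))" using below_exists by blast
    have "\<forall>c\<in>chains i. proj n (v c) \<in> piece (Suc k)" using v(2) proj_piece Suc by blast
    from stage_lift[OF st v(1) this \<kappa>] obtain v' where
      "\<forall>d\<in>chains (Suc i). v' d \<in> piece k" "\<forall>c\<in>chains i. syz i z v' c = proj n (v c)" by blast
    then show ?thesis by (intro exI[of _ v'] conjI ballI piece_B) blast+
  qed
  then obtain v' where v': "\<And>n. \<forall>d\<in>chains (Suc i). v' n d \<in> B" "\<And>n. \<forall>c\<in>chains i. syz i z (v' n) c = proj n (v c)"
    by metis
  define A where "A = (\<Union>c\<in>chains i. \<delta> ` supp (v c))"
  have fA: "finite A" unfolding A_def using finite_chains by auto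
  show ?thesis
  proof (intro exI conjI ballI)
    fix d assume "d \<in> chains (Suc i)"
    then show "(\<Sum>n\<in>A. v' n d) \<in> B" using v'(1) by (intro B_sum) blast
  next
    fix c assume c: "c \<in> chains i"
    have "syz i z (\<lambda>d. \<Sum>n\<in>A. v' n d) c = (\<Sum>n\<in>A. syz i z (v' n) c)"
      unfolding syz_def sum_distrib_right by (rule sum.swap)
    also have "\<dots> = (\<Sum>n\<in>A. proj n (v c))" using v'(2) c by simp
    also have "\<dots> = v c" using c by (intro proj_decomp fA) (auto simp: A_def)
    finally show "syz i z (\<lambda>d. \<Sum>n\<in>A. v' n d) c = v c" .
  qed
qed

lemma syz_closed:
  assumes "stage i Z z" "\<forall>d\<in>chains (Suc i). v d \<in> B" "c \<in> chains i"
  shows "syz i z v c \<in> B"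
  unfolding syz_def
  by (intro B_sum B_mult) (use assms stageD(5)[OF assms(1)] piece_B in blast)+

lemma syz_syz:
  assumes "\<forall>e\<in>chains (Suc (Suc i)). syz i z (z' e) c = 0"
  shows "syz i z (syz (Suc i) z' v) c = 0"
proof -
  have "syz i z (syz (Suc i) z' v) c = (\<Sum>e\<in>chains (Suc (Suc i)). v e * syz i z (z' e) c)"
    unfolding syz_def sum_distrib_right sum_distrib_left mult.assoc by (rule sum.swap)
  then show ?thesis using assms by simp
qed

section \<open>The toric ring as a standard graded algebra\<close>

definition toric_ring :: "('x, 'k::field) mpoly ring" where
  "toric_ring = monomial_ring M"

lemma toric_ring_simps [simp]:
  "carrier toric_ring = B"
  "f \<oplus>\<^bsub>toric_ring\<^esub> g = f + g"
  "f \<otimes>\<^bsub>toric_ring\<^esub> g = f * g"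
  "\<zero>\<^bsub>toric_ring\<^esub> = 0"
  "\<one>\<^bsub>toric_ring\<^esub> = 1"
  by (simp_all add: toric_ring_def B_def)

lemma B_uminus: "f \<in> B \<Longrightarrow> - f \<in> B"
  using B_diff[OF B_0] by simp

lemma B_mconst: "mconst c \<in> B"
  unfolding mconst_def by (rule B_single[OF M_0])

lemma cring_toric_ring: "cring (toric_ring :: ('x, 'k::field) mpoly ring)"
  unfolding toric_ring_def using M_0 M_add by (rule cring_monomial_ring)

lemma toric_ring_sum:
  "finite A \<Longrightarrow> (\<And>i. i \<in> A \<Longrightarrow> f i \<in> B) \<Longrightarrow> finsum toric_ring f A = sum f A"
  using cring_toric_ring
  by (intro finsum_eq_sum) (auto simp: cring_def ring_def abelian_group_def)

lemma toric_ring_inv: "f \<in> B \<Longrightarrow> \<ominus>\<^bsub>toric_ring\<^esub> f = - f"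
  unfolding toric_ring_def using M_0 M_add by (intro monomial_ring_inv) (auto simp: B_def)

lemma \<delta>_eq_0: "\<mu> \<in> M \<Longrightarrow> \<delta> \<mu> = 0 \<Longrightarrow> \<mu> = 0"
proof -
  assume \<mu>: "\<mu> \<in> M" "\<delta> \<mu> = 0"
  then obtain u where u: "supp u \<subseteq> E" "\<mu> = \<theta> u" by (auto simp: M_def)
  have "u = 0"
  proof (rule poly_mapping_eqI)
    fix e show "coef u e = coef 0 e"
      using coef_le_\<delta>[of e u] u \<mu>(2) by (cases "e \<in> supp u") (force simp: not_in_keys_iff_lookup_eq_zero)+
  qed
  then show "\<mu> = 0" using u by simp
qed

lemma piece_additive_subgroup: "additive_subgroup (piece d) (toric_ring :: ('x, 'k::field) mpoly ring)"
proof (rule additive_subgroupI)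
  interpret cring "toric_ring :: ('x, 'k) mpoly ring" by (rule cring_toric_ring)
  show "subgroup (piece d) (add_monoid (toric_ring :: ('x, 'k) mpoly ring))"
  proof (rule add.subgroupI)
    show "(piece d :: ('x, 'k) mpoly set) \<noteq> {}" using piece_0 by blast
    fix f :: "('x, 'k) mpoly" assume "f \<in> piece d"
    then show "\<ominus>\<^bsub>toric_ring\<^esub> f \<in> piece d"
      using toric_ring_inv[OF piece_B] piece_diff[OF piece_0] by fastforce
  qed (auto intro: piece_B piece_add)
qed

lemma piece_0_eq_range_mconst: "piece 0 = (range mconst :: ('x, 'k::field) mpoly set)"
proof
  show "(range mconst :: ('x, 'k) mpoly set) \<subseteq> piece 0" using M_0 by (auto simp: mconst_def piece_def split: if_splits)
  show "(piece 0 :: ('x, 'k) mpoly set) \<subseteq> range mconst"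
  proof
    fix f :: "('x, 'k) mpoly" assume "f \<in> piece 0"
    then have s: "supp f \<subseteq> {0}" using \<delta>_eq_0 by (auto simp: piece_def)
    have "f = mconst (coef f 0)"
    proof (rule poly_mapping_eqI)
      fix \<mu> show "coef f \<mu> = coef (mconst (coef f 0)) \<mu>"
        using s by (cases "\<mu> = 0") (auto simp: mconst_def lookup_single when_def in_keys_iff)
    qed
    then show "f \<in> range mconst" by blast
  qed
qed

definition toric_vars :: "('x, 'k::field) mpoly set" where
  "toric_vars = (\<lambda>e. single (\<theta> (single e 1)) 1) ` E"

lemma toric_gens_B: "range mconst \<subseteq> B \<and> toric_vars \<subseteq> B"
  by (auto simp: toric_vars_def intro!: B_mconst B_single \<theta>_M)

lemma toric_ring_generated:
  "generate_ring toric_ring (range mconst \<union> toric_vars) = (B :: ('x, 'k::field) mpoly set)"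
proof -
  interpret cring "toric_ring :: ('x, 'k) mpoly ring" by (rule cring_toric_ring)
  define C :: "('x, 'k) mpoly set" where "C = generate_ring toric_ring (range mconst \<union> toric_vars)"
  have "C \<subseteq> carrier toric_ring"
    unfolding C_def by (rule generate_ring_incl) (simp add: toric_gens_B)
  moreover have mono: "single (\<theta> u) 1 \<in> C" if "supp u \<subseteq> E" for u
    using that
  proof (induction "\<delta> (\<theta> u)" arbitrary: u rule: less_induct)
    case less
    show ?case
    proof (cases "u = 0")
      case True
      have "\<one>\<^bsub>toric_ring\<^esub> \<in> C" unfolding C_def by (rule generate_ring.one)
      then show ?thesis using True by simp
    next
      case False
      then obtain e where e: "e \<in> supp u" by (metis keys_eq_empty ex_in_conv)
      define w where "w = u - single e 1"
      have u: "u = single e 1 + w"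
        unfolding w_def using e by (intro single_add_minus[symmetric]) (simp add: in_keys_iff)
      have eE: "e \<in> E" using e less.prems by blast
      have wE: "supp w \<subseteq> E" unfolding w_def by (rule order.trans[OF supp_minus_nat less.prems])
      have "\<delta> (\<theta> u) = 1 + \<delta> (\<theta> w)" using \<delta>_var[OF eE] by (simp add: u \<theta>_add \<delta>_add)
      then have "single (\<theta> w) 1 \<in> C" using less.hyps wE by simp
      moreover have "single (\<theta> (single e 1)) 1 \<in> C"
        unfolding C_def using eE by (intro generate_ring.incl) (auto simp: toric_vars_def)
      ultimately have "single (\<theta> (single e 1)) 1 \<otimes>\<^bsub>toric_ring\<^esub> single (\<theta> w) 1 \<in> C"
        unfolding C_def by (intro generate_ring.eng_mult)
      then show ?thesis by (simp add: mult_single u \<theta>_add)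
    qed
  qed
  have "B \<subseteq> C"
  proof
    fix f :: "('x, 'k) mpoly" assume f: "f \<in> B"
    have t: "single \<mu> (coef f \<mu>) \<in> C" if \<mu>: "\<mu> \<in> supp f" for \<mu>
    proof -
      obtain u where u: "supp u \<subseteq> E" "\<mu> = \<theta> u" using f \<mu> by (auto simp: B_def M_def)
      have "mconst (coef f \<mu>) \<in> C" unfolding C_def by (intro generate_ring.incl) blast
      then have "mconst (coef f \<mu>) \<otimes>\<^bsub>toric_ring\<^esub> single (\<theta> u) 1 \<in> C"
        using mono[OF u(1)] unfolding C_def by (intro generate_ring.eng_mult)
      then show ?thesis by (simp add: mconst_def mult_single u(2))
    qed
    have "additive_subgroup C toric_ring"
    proof (rule additive_subgroupI)
      have "subring C toric_ring"
        unfolding C_def by (rule generate_ring_is_subring) (simp add: toric_gens_B)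
      then show "subgroup C (add_monoid toric_ring)" by (rule subring.axioms(1))
    qed
    then have "(\<Sum>\<mu>\<in>supp f. single \<mu> (coef f \<mu>)) \<in> C"
      by (rule additive_subgroup_sum_closed) (simp_all add: t)
    then show "f \<in> C" by (simp add: poly_decomp)
  qed
  ultimately show ?thesis unfolding C_def by auto
qed

lemma standard_graded_toric_ring:
  "standard_graded (toric_ring :: ('x, 'k::field) mpoly ring) mconst piece"
  unfolding standard_graded_def
proof (intro conjI allI ballI)
  show "cring (toric_ring :: ('x, 'k) mpoly ring)" by (rule cring_toric_ring)
  show "mconst \<in> ring_hom ring_of_type_algebra (toric_ring :: ('x, 'k) mpoly ring)"
    by (rule ring_hom_memI)
      (auto simp: B_mconst, simp_all add: ring_of_type_algebra_def mconst_def mult_single single_add)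
  show "inj (mconst :: 'k \<Rightarrow> ('x, 'k) mpoly)"
    unfolding mconst_def by (metis inj_onI lookup_single_eq)
  show "piece 0 = range (mconst :: 'k \<Rightarrow> ('x, 'k) mpoly)" by (rule piece_0_eq_range_mconst)
  show "additive_subgroup (piece d) (toric_ring :: ('x, 'k) mpoly ring)" for d
    by (rule piece_additive_subgroup)
  show "f \<otimes>\<^bsub>toric_ring\<^esub> g \<in> piece (d + e)"
    if "f \<in> piece d" "g \<in> piece e" for d e and f g :: "('x, 'k) mpoly"
    using that by (simp add: piece_mult)
  show "\<exists>allowed. finite allowed \<and> allowed \<subseteq> piece 1 \<and>
      generate_ring toric_ring (range mconst \<union> allowed) = carrier (toric_ring :: ('x, 'k) mpoly ring)"
    using fin \<delta>_var \<theta>_M toric_ring_generated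
    by (intro exI[of _ toric_vars]) (auto simp: toric_vars_def piece_def)
  fix f :: "('x, 'k) mpoly" assume "f \<in> carrier toric_ring"
  then have f: "f \<in> B" by simp
  show "\<exists>!h. (\<forall>d. h d \<in> piece d) \<and> finite {d. h d \<noteq> \<zero>\<^bsub>toric_ring\<^esub>} \<and>
      f = (\<Oplus>\<^bsub>toric_ring\<^esub>d\<in>{d. h d \<noteq> \<zero>\<^bsub>toric_ring\<^esub>}. h d)"
  proof (rule ex1I)
    have sub: "{d. proj d f \<noteq> 0} \<subseteq> \<delta> ` supp f"
    proof
      fix d assume "d \<in> {d. proj d f \<noteq> 0}"
      then have "supp (proj d f) \<noteq> {}" by simp
      then show "d \<in> \<delta> ` supp f" unfolding supp_proj by blast
    qed
    then have fin': "finite {d. proj d f \<noteq> 0}" by (rule finite_subset) simp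
    have "(\<Sum>d\<in>{d. proj d f \<noteq> 0}. proj d f) = (\<Sum>d\<in>\<delta> ` supp f. proj d f)"
      by (rule sum.mono_neutral_left[OF _ sub]) auto
    also have "\<dots> = f" by (rule proj_decomp) auto
    finally show "(\<forall>d. proj d f \<in> piece d) \<and> finite {d. proj d f \<noteq> \<zero>\<^bsub>toric_ring\<^esub>} \<and>
      f = (\<Oplus>\<^bsub>toric_ring\<^esub>d\<in>{d. proj d f \<noteq> \<zero>\<^bsub>toric_ring\<^esub>}. proj d f)"
      using proj_piece[OF f] fin' toric_ring_sum[OF fin', of "\<lambda>d. proj d f"] piece_B by fastforce
  next
    fix h assume h: "(\<forall>d. h d \<in> piece d) \<and> finite {d. h d \<noteq> \<zero>\<^bsub>toric_ring\<^esub>} \<and>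
      f = (\<Oplus>\<^bsub>toric_ring\<^esub>d\<in>{d. h d \<noteq> \<zero>\<^bsub>toric_ring\<^esub>}. h d)"
    then have f_eq: "f = (\<Sum>d\<in>{d. h d \<noteq> 0}. h d)" and fh: "finite {d. h d \<noteq> 0}"
      using toric_ring_sum[of "{d. h d \<noteq> 0}" h] piece_B by auto
    show "h = (\<lambda>d. proj d f)"
    proof
      fix d
      \<comment> \<open>Applying \<open>proj d\<close> to any homogeneous decomposition isolates its
        member of degree \<open>d\<close>, which gives uniqueness.\<close>
      have "proj d (h e) = (if d = e then h e else 0)" for e
        using h by (intro proj_of_piece) blast
      then have "proj d f = (\<Sum>e\<in>{d. h d \<noteq> 0}. if e = d then h d else 0)"
        unfolding f_eq proj_sum by (intro sum.cong) auto
      then show "h d = proj d f" using fh by auto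
    qed
  qed
qed

lemma irrelevant_ideal_toric_ring:
  "irrelevant_ideal toric_ring piece = {f \<in> B. 0 \<notin> supp (f :: ('x, 'k::field) mpoly)}"
proof -
  interpret cring "toric_ring :: ('x, 'k) mpoly ring" by (rule cring_toric_ring)
  let ?G = "\<Union>d\<in>{1..}. piece d :: ('x, 'k) mpoly set"
  let ?I = "{f \<in> B. 0 \<notin> supp (f :: ('x, 'k) mpoly)}"
  have G: "?G \<subseteq> carrier toric_ring" using piece_B by auto
  have zero: "a + b = 0 \<Longrightarrow> b = 0" for a b :: "'x \<Rightarrow>\<^sub>0 nat"
    by (metis add_is_0 lookup_add lookup_zero poly_mapping_eqI)
  have mult: "f * g \<in> ?I" if "f \<in> B" "g \<in> ?I" for f g
    using that B_mult keys_mult[of f g] zero by fastforce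
  have id: "ideal ?I toric_ring"
  proof (rule idealI)
    show "ring (toric_ring :: ('x, 'k) mpoly ring)" ..
    show "subgroup ?I (add_monoid toric_ring)"
    proof (rule add.subgroupI)
      show "?I \<noteq> {}" using B_0 by auto
      fix f assume "f \<in> ?I"
      then show "\<ominus>\<^bsub>toric_ring\<^esub> f \<in> ?I" by (simp add: toric_ring_inv B_uminus in_keys_iff)
    qed (auto simp: in_keys_iff lookup_add intro: B_add)
    fix g f assume "g \<in> ?I" "f \<in> carrier (toric_ring :: ('x, 'k) mpoly ring)"
    then show "f \<otimes>\<^bsub>toric_ring\<^esub> g \<in> ?I" "g \<otimes>\<^bsub>toric_ring\<^esub> f \<in> ?I"
      using mult[of f g] by (simp_all add: mult.commute)
  qed
  have "?G \<subseteq> ?I"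
    using piece_B by (auto simp: piece_def)
  then have "Idl\<^bsub>toric_ring\<^esub> ?G \<subseteq> ?I" by (rule genideal_minimal[OF id])
  moreover have "?I \<subseteq> Idl\<^bsub>toric_ring\<^esub> ?G"
  proof
    fix f assume f: "f \<in> ?I"
    have "proj d f \<in> Idl\<^bsub>toric_ring\<^esub> ?G" if d: "d \<in> \<delta> ` supp f" for d
    proof -
      obtain \<mu> where "\<mu> \<in> supp f" "\<delta> \<mu> = d" using d by blast
      then have "d \<noteq> 0" using f \<delta>_eq_0 by (auto simp: B_def)
      then have "proj d f \<in> ?G" using proj_piece[of f d] f by (auto intro!: bexI[of _ d])
      then show ?thesis using genideal_self[OF G] by blast
    qed
    then have "(\<Sum>d\<in>\<delta> ` supp f. proj d f) \<in> Idl\<^bsub>toric_ring\<^esub> ?G"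
      using ideal.axioms(1)[OF genideal_ideal[OF G]] by (intro additive_subgroup_sum_closed) auto
    then show "f \<in> Idl\<^bsub>toric_ring\<^esub> ?G" by (simp add: proj_decomp)
  qed
  ultimately show ?thesis unfolding irrelevant_ideal_def by blast
qed

text \<open>The counterpart of \<open>syz_syz\<close> at the bottom of the resolution, where
  \<open>Z 0\<close> is the augmentation ideal and not the kernel of a previous map.\<close>

lemma syz_no_constant:
  assumes "stage i Z z" "c \<in> chains i"
  shows "0 \<notin> supp (syz i z v c)"
proof
  assume "0 \<in> supp (syz i z v c)"
  then have "0 \<in> (\<Union>d\<in>chains (Suc i). supp (v d * z d c))"
    unfolding syz_def by (rule subsetD[OF supp_sum])
  then obtain d where d: "d \<in> chains (Suc i)" "0 \<in> supp (v d * z d c)" by blast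
  from subsetD[OF keys_mult d(2)] obtain \<mu> \<nu> where "0 = \<mu> + \<nu>" "\<nu> \<in> supp (z d c)" by blast
  moreover from this have "\<delta> \<nu> = 1" using stageD(5)[OF assms(1) d(1) assms(2)] by (simp add: piece_def)
  ultimately show False using \<delta>_add[of \<mu> \<nu>] by simp
qed

theorem koszul_toric_ring:
  "koszul (toric_ring :: ('x, 'k::field) mpoly ring) mconst piece"
proof -
  interpret R: cring "toric_ring :: ('x, 'k) mpoly ring" by (rule cring_toric_ring)
  obtain Z :: "nat \<Rightarrow> ('e list \<Rightarrow> ('x, 'k) mpoly) set" and z
    where Z0: "Z 0 = {v. 0 \<notin> supp (v [])}" and st: "\<And>i. stage i (Z i) (z i)"
      and ZSuc: "\<And>i. Z (Suc i) = {v. \<forall>c\<in>chains i. syz i (z i) v c = 0}"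
    using resolution_exists by blast
  define b where "b i = card (chains i)" for i
  have "\<exists>h. bij_betw h {..<b i} (chains i)" for i
    using ex_bij_betw_nat_finite[OF finite_chains[of i]] by (simp add: b_def atLeast0LessThan)
  \<comment> \<open>The stages index bases by chains, whereas \<open>free_module\<close> uses
    initial segments of the naturals. \<open>h\<close> enumerates the chains and \<open>g\<close>
    inverts it; \<open>vec\<close> and \<open>arr\<close> carry vectors from one indexing to the
    other.\<close>
  then obtain h where h: "\<And>i. bij_betw (h i) {..<b i} (chains i)" by metis
  define g where "g i = the_inv_into {..<b i} (h i)" for i
  have hJ: "h i k \<in> chains i" if "k < b i" for i k
    using bij_betwE[OF h] that by blast
  have gh: "g i (h i k) = k" if "k < b i" for i k
    unfolding g_def using bij_betw_imp_inj_on[OF h] that by (simp add: the_inv_into_f_f)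
  have hg: "h i (g i c) = c" and gJ: "g i c < b i" if cJ: "c \<in> chains i" for i c
  proof -
    obtain k where "k < b i" "c = h i k" using bij_betw_imp_surj_on[OF h[of i]] cJ by blast
    then show "h i (g i c) = c" "g i c < b i" using gh by simp_all
  qed
  define vec where "vec i v c = v (g i c)" for i c and v :: "nat \<Rightarrow> ('x, 'k) mpoly"
  define arr where "arr i w = (\<lambda>k\<in>{..<b i}. w (h i k))" for i and w :: "'e list \<Rightarrow> ('x, 'k) mpoly"
  define \<M> where "\<M> i j k = z i (h (Suc i) j) (h i k)" for i j k
  have free: "v \<in> free_module toric_ring (b i) \<longleftrightarrow> arr i (vec i v) = v \<and> (\<forall>c\<in>chains i. vec i v c \<in> B)" for i v
  proof
    assume v: "v \<in> free_module toric_ring (b i)"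
    then have "arr i (vec i v) = v"
      unfolding free_module_def arr_def vec_def
      by (auto simp: gh fun_eq_iff restrict_def PiE_def extensional_def)
    then show "arr i (vec i v) = v \<and> (\<forall>c\<in>chains i. vec i v c \<in> B)"
      using v gJ by (auto simp: free_module_def vec_def)
  next
    assume v: "arr i (vec i v) = v \<and> (\<forall>c\<in>chains i. vec i v c \<in> B)"
    then have "vec i v (h i k) \<in> B" if "k < b i" for k using hJ[OF that] by blast
    then have "arr i (vec i v) \<in> free_module toric_ring (b i)"
      by (auto simp: free_module_def arr_def)
    then show "v \<in> free_module toric_ring (b i)" using v by simp
  qed
  have vec_arr: "vec i (arr i w) c = w c" if "c \<in> chains i" for i w c
    using gJ[OF that] hg[OF that] by (simp add: vec_def arr_def)
  have arr_free: "arr i w \<in> free_module toric_ring (b i)" if "\<forall>c\<in>chains i. w c \<in> B" for i w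
    using that hJ by (auto simp: free_module_def arr_def)
  have arr_cong: "arr i w = arr i w'" if "\<forall>c\<in>chains i. w c = w' c" for i w w'
    using that hJ unfolding arr_def by (intro restrict_ext) auto
  have arr_inj: "\<forall>c\<in>chains i. w c = w' c" if "arr i w = arr i w'" for i w w'
    using that vec_arr by metis
  have syz_cong: "syz i (z i) w c = syz i (z i) w' c" if "\<forall>d\<in>chains (Suc i). w d = w' d" for i w w' c
    unfolding syz_def using that by (intro sum.cong) auto
  have map_eq: "matrix_map toric_ring (b (Suc i)) (b i) (\<M> i) v = arr i (syz i (z i) (vec (Suc i) v))"
    if v: "v \<in> free_module toric_ring (b (Suc i))" for i v
    unfolding matrix_map_def arr_def
  proof (rule restrict_ext)
    fix k assume "k \<in> {..<b i}"
    then have k: "k < b i" by simp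
    have "(\<Oplus>\<^bsub>toric_ring\<^esub>j\<in>{..<b (Suc i)}. v j \<otimes>\<^bsub>toric_ring\<^esub> \<M> i j k) = (\<Sum>j<b (Suc i). v j * \<M> i j k)"
    proof (subst toric_ring_sum)
      fix j assume "j \<in> {..<b (Suc i)}"
      then have "v j \<in> B" "\<M> i j k \<in> B"
        using v stageD(5)[OF st hJ hJ[OF k]] piece_B by (auto simp: free_module_def \<M>_def)
      then show "v j \<otimes>\<^bsub>toric_ring\<^esub> \<M> i j k \<in> B" by (simp add: B_mult)
    qed simp_all
    also have "\<dots> = (\<Sum>j<b (Suc i). vec (Suc i) v (h (Suc i) j) * z i (h (Suc i) j) (h i k))"
      by (rule sum.cong) (simp_all add: vec_def gh \<M>_def)
    also have "\<dots> = syz i (z i) (vec (Suc i) v) (h i k)"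
      unfolding syz_def by (rule sum.reindex_bij_betw[OF h])
    finally show "(\<Oplus>\<^bsub>toric_ring\<^esub>j\<in>{..<b (Suc i)}. v j \<otimes>\<^bsub>toric_ring\<^esub> \<M> i j k) =
      syz i (z i) (vec (Suc i) v) (h i k)" .
  qed
  \<comment> \<open>Exactness in one form for the bottom and for all higher stages. The elements of
    \<open>Z i\<close> are functions on all lists, so insensitivity to values outside
    \<open>chains i\<close> enters as the condition \<open>Zcong\<close>.\<close>
  have map_image: "matrix_map toric_ring (b (Suc i)) (b i) (\<M> i) ` free_module toric_ring (b (Suc i)) =
      {v \<in> free_module toric_ring (b i). vec i v \<in> Z i}"
    if kill: "\<And>w. \<forall>d\<in>chains (Suc i). w d \<in> B \<Longrightarrow> syz i (z i) w \<in> Z i"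
      and Zcong: "\<And>w w'. \<forall>c\<in>chains i. w c = w' c \<Longrightarrow> w \<in> Z i \<Longrightarrow> w' \<in> Z i"
      and Zproj: "\<And>w d. w \<in> Z i \<Longrightarrow> \<forall>c\<in>chains i. w c \<in> B \<Longrightarrow> (\<lambda>c. proj d (w c)) \<in> Z i" for i
  proof
    show "matrix_map toric_ring (b (Suc i)) (b i) (\<M> i) ` free_module toric_ring (b (Suc i)) \<subseteq>
      {v \<in> free_module toric_ring (b i). vec i v \<in> Z i}"
    proof
      fix y assume "y \<in> matrix_map toric_ring (b (Suc i)) (b i) (\<M> i) ` free_module toric_ring (b (Suc i))"
      then obtain v where v: "v \<in> free_module toric_ring (b (Suc i))"
        and y: "y = arr i (syz i (z i) (vec (Suc i) v))" using map_eq by auto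
      have vB: "\<forall>d\<in>chains (Suc i). vec (Suc i) v d \<in> B" using v free by blast
      have "vec i y \<in> Z i"
        by (rule Zcong[OF _ kill[OF vB]]) (simp add: y vec_arr)
      moreover have "y \<in> free_module toric_ring (b i)"
        unfolding y using syz_closed[OF st vB] by (intro arr_free) blast
      ultimately show "y \<in> {v \<in> free_module toric_ring (b i). vec i v \<in> Z i}" by simp
    qed
    show "{v \<in> free_module toric_ring (b i). vec i v \<in> Z i} \<subseteq>
      matrix_map toric_ring (b (Suc i)) (b i) (\<M> i) ` free_module toric_ring (b (Suc i))"
    proof
      fix y assume "y \<in> {v \<in> free_module toric_ring (b i). vec i v \<in> Z i}"
      then have y: "arr i (vec i y) = y" "\<forall>c\<in>chains i. vec i y c \<in> B" "vec i y \<in> Z i" using free by auto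
      obtain w where w: "\<forall>d\<in>chains (Suc i). w d \<in> B" "\<forall>c\<in>chains i. syz i (z i) w c = vec i y c"
        using stage_exact[OF st Zproj[OF y(3,2)] y(2)] by blast
      have "matrix_map toric_ring (b (Suc i)) (b i) (\<M> i) (arr (Suc i) w) =
          arr i (syz i (z i) (vec (Suc i) (arr (Suc i) w)))"
        by (rule map_eq[OF arr_free[OF w(1)]])
      also have "\<dots> = arr i (vec i y)"
      proof (rule arr_cong, rule ballI)
        fix c assume c: "c \<in> chains i"
        have "syz i (z i) (vec (Suc i) (arr (Suc i) w)) c = syz i (z i) w c"
          by (rule syz_cong, rule ballI, rule vec_arr)
        then show "syz i (z i) (vec (Suc i) (arr (Suc i) w)) c = vec i y c" using w(2) c by simp
      qed
      finally show "y \<in> matrix_map toric_ring (b (Suc i)) (b i) (\<M> i) ` free_module toric_ring (b (Suc i))"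
        using arr_free[OF w(1)] y(1) by (metis image_eqI)
    qed
  qed
  have "linear_resolution_of_residue_field (toric_ring :: ('x, 'k) mpoly ring) piece b \<M>"
    unfolding linear_resolution_of_residue_field_def
  proof (intro conjI allI impI)
    show b0: "b 0 = 1" by (simp add: b_def)
    show "\<M> i j k \<in> piece 1" if "j < b (Suc i)" "k < b i" for i j k
      unfolding \<M>_def by (rule stageD(5)[OF st hJ[OF that(1)] hJ[OF that(2)]])
    have I: "ideal (irrelevant_ideal toric_ring piece) (toric_ring :: ('x, 'k) mpoly ring)"
      unfolding irrelevant_ideal_def by (rule R.genideal_ideal) (use piece_B in auto)
    have "vec 0 v \<in> Z 0 \<longleftrightarrow>
        irrelevant_ideal toric_ring piece +>\<^bsub>toric_ring\<^esub> v 0 = \<zero>\<^bsub>toric_ring Quot irrelevant_ideal toric_ring piece\<^esub>"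
      if "v \<in> free_module toric_ring (b 0)" for v
    proof -
      have "g 0 [] = 0" using gJ[of "[]" 0] b0 by simp
      then have "vec 0 v \<in> Z 0 \<longleftrightarrow> 0 \<notin> supp (v 0)" by (simp add: Z0 vec_def)
      moreover have vB: "v 0 \<in> B" using that b0 by (auto simp: free_module_def)
      moreover have "irrelevant_ideal toric_ring piece +>\<^bsub>toric_ring\<^esub> v 0 = irrelevant_ideal toric_ring piece \<longleftrightarrow>
          v 0 \<in> irrelevant_ideal toric_ring piece"
        using R.a_coset_join1 R.a_rcos_zero[OF I] vB
          additive_subgroup.a_subgroup[OF ideal.axioms(1)[OF I]] by auto
      ultimately show ?thesis by (simp add: FactRing_def irrelevant_ideal_toric_ring)
    qed
    then show "matrix_map toric_ring (b 1) (b 0) (\<M> 0) ` free_module toric_ring (b 1) =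
      {v \<in> free_module toric_ring (b 0). irrelevant_ideal toric_ring piece +>\<^bsub>toric_ring\<^esub> v 0 =
         \<zero>\<^bsub>toric_ring Quot irrelevant_ideal toric_ring piece\<^esub>}"
      using map_image[of 0] syz_no_constant[OF st, of _ 0] by (auto simp: Z0 supp_proj)
    fix i
    have "matrix_map toric_ring (b (Suc (Suc i))) (b (Suc i)) (\<M> (Suc i)) ` free_module toric_ring (b (Suc (Suc i))) =
        {v \<in> free_module toric_ring (b (Suc i)). vec (Suc i) v \<in> Z (Suc i)}"
    proof (rule map_image)
      have "z (Suc i) e \<in> Z (Suc i)" if "e \<in> chains (Suc (Suc i))" for e
        by (rule stageD(4)[OF st that])
      then have "\<forall>e\<in>chains (Suc (Suc i)). syz i (z i) (z (Suc i) e) c = 0" if "c \<in> chains i" for c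
        using that ZSuc by (simp del: chains.simps)
      then show "syz (Suc i) (z (Suc i)) w \<in> Z (Suc i)" for w
        unfolding ZSuc using syz_syz by blast
      show "w' \<in> Z (Suc i)" if "\<forall>c\<in>chains (Suc i). w c = w' c" "w \<in> Z (Suc i)" for w w'
        using that syz_cong[of i w w'] by (simp add: ZSuc del: chains.simps)
      show "(\<lambda>c. proj d (w c)) \<in> Z (Suc i)" if "w \<in> Z (Suc i)" "\<forall>c\<in>chains (Suc i). w c \<in> B" for w d
        using that(1) syz_proj[OF st that(2)] by (simp add: ZSuc proj_def del: chains.simps)
    qed
    moreover have "vec (Suc i) v \<in> Z (Suc i) \<longleftrightarrow>
        matrix_map toric_ring (b (Suc i)) (b i) (\<M> i) v = (\<lambda>k\<in>{..<b i}. \<zero>\<^bsub>toric_ring\<^esub>)"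
      if "v \<in> free_module toric_ring (b (Suc i))" for v
    proof -
      have "(\<lambda>k\<in>{..<b i}. \<zero>\<^bsub>toric_ring\<^esub>) = arr i (\<lambda>_. 0)" by (simp add: arr_def)
      moreover have "arr i w = arr i w' \<longleftrightarrow> (\<forall>c\<in>chains i. w c = w' c)" for w w'
        using arr_inj[of i w w'] arr_cong[of i w w'] by blast
      ultimately show ?thesis unfolding map_eq[OF that] ZSuc by simp
    qed
    ultimately show "matrix_map toric_ring (b (Suc (Suc i))) (b (Suc i)) (\<M> (Suc i)) `
        free_module toric_ring (b (Suc (Suc i))) =
      {v \<in> free_module toric_ring (b (Suc i)).
         matrix_map toric_ring (b (Suc i)) (b i) (\<M> i) v = (\<lambda>k\<in>{..<b i}. \<zero>\<^bsub>toric_ring\<^esub>)}"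
      by blast
  qed
  then show ?thesis unfolding koszul_def using standard_graded_toric_ring by blast
qed

end

section \<open>Transport of the Koszul property along ring isomorphisms\<close>

lemma rcos_eq_zero_iff:
  assumes "ring R" "ideal I R" "x \<in> carrier R"
  shows "I +>\<^bsub>R\<^esub> x = \<zero>\<^bsub>R Quot I\<^esub> \<longleftrightarrow> x \<in> I"
proof -
  interpret ring R by fact
  have "I +>\<^bsub>R\<^esub> x = I \<longleftrightarrow> x \<in> I"
    using a_coset_join1[OF _ assms(3)] a_rcos_zero[OF assms(2)]
      additive_subgroup.a_subgroup[OF ideal.axioms(1)[OF assms(2)]] by blast
  then show ?thesis by (simp add: FactRing_def)
qed

text \<open>Components, ideals, generators and matrices all have to be pushed forward along
  \<open>h\<close>, since \<open>koszul\<close> refers to these data explicitly.\<close>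

locale ring_iso_cring = ring_hom_cring R S h for R (structure) and S (structure) and h +
  assumes bij: "bij_betw h (carrier R) (carrier S)"
begin

lemma h_inj: "x \<in> carrier R \<Longrightarrow> y \<in> carrier R \<Longrightarrow> h x = h y \<Longrightarrow> x = y"
  using bij by (auto simp: bij_betw_def inj_on_def)

lemma h_surj: "h ` carrier R = carrier S"
  using bij by (rule bij_betw_imp_surj_on)

lemma h_eq_zero: "x \<in> carrier R \<Longrightarrow> h x = \<zero>\<^bsub>S\<^esub> \<longleftrightarrow> x = \<zero>"
  using h_inj[of x "\<zero>"] by auto

lemma image_ideal:
  assumes "ideal I R"
  shows "ideal (h ` I) S"
proof -
  interpret I: ideal I R by fact
  show ?thesis
  proof (rule idealI)
    show "ring S" ..
    show "subgroup (h ` I) (add_monoid S)"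
    proof (rule S.add.subgroupI)
      show "h ` I \<subseteq> carrier S" using I.Icarr by auto
      show "h ` I \<noteq> {}" using I.zero_closed by blast
      fix a assume "a \<in> h ` I"
      then obtain x where x: "x \<in> I" "a = h x" by blast
      have "\<ominus>\<^bsub>S\<^esub> a = h (\<ominus> x)" using x I.Icarr by simp
      then show "\<ominus>\<^bsub>S\<^esub> a \<in> h ` I" using I.a_inv_closed[OF x(1)] by blast
    next
      fix a b assume "a \<in> h ` I" "b \<in> h ` I"
      then obtain x y where x: "x \<in> I" "y \<in> I" "a = h x" "b = h y" by blast
      have "a \<oplus>\<^bsub>S\<^esub> b = h (x \<oplus> y)" using x I.Icarr by simp
      then show "a \<oplus>\<^bsub>S\<^esub> b \<in> h ` I" using I.a_closed[OF x(1,2)] by blast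
    qed
    fix a b assume "a \<in> h ` I" "b \<in> carrier S"
    then obtain x y where x: "x \<in> I" "y \<in> carrier R" "a = h x" "b = h y" using h_surj by blast
    have "b \<otimes>\<^bsub>S\<^esub> a = h (y \<otimes> x)" "a \<otimes>\<^bsub>S\<^esub> b = h (x \<otimes> y)" using x I.Icarr by simp_all
    then show "b \<otimes>\<^bsub>S\<^esub> a \<in> h ` I" "a \<otimes>\<^bsub>S\<^esub> b \<in> h ` I"
      using I.I_l_closed[OF x(1,2)] I.I_r_closed[OF x(1,2)] by simp_all
  qed
qed

lemma image_genideal:
  assumes A: "A \<subseteq> carrier R"
  shows "Idl\<^bsub>S\<^esub> (h ` A) = h ` (Idl A)"
proof
  have hA: "h ` A \<subseteq> carrier S" using A by auto
  show "Idl\<^bsub>S\<^esub> (h ` A) \<subseteq> h ` (Idl A)"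
    by (rule S.genideal_minimal[OF image_ideal[OF R.genideal_ideal[OF A]]])
      (use R.genideal_self[OF A] in blast)
  have "ideal {r \<in> carrier R. h r \<in> Idl\<^bsub>S\<^esub> (h ` A)} R"
    by (rule ring_hom_ring.ideal_vimage[OF ring_hom_ringI2[OF R.ring_axioms S.ring_axioms homh] S.genideal_ideal[OF hA]])
  then have "Idl A \<subseteq> {r \<in> carrier R. h r \<in> Idl\<^bsub>S\<^esub> (h ` A)}"
    by (rule R.genideal_minimal) (use A S.genideal_self[OF hA] in blast)
  then show "h ` (Idl A) \<subseteq> Idl\<^bsub>S\<^esub> (h ` A)" by blast
qed

lemma image_generate_ring:
  assumes A: "A \<subseteq> carrier R"
  shows "h ` generate_ring R A \<subseteq> generate_ring S (h ` A)"
proof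
  fix a assume "a \<in> h ` generate_ring R A"
  then obtain x where x: "x \<in> generate_ring R A" "a = h x" by blast
  from x(1) have "h x \<in> generate_ring S (h ` A)"
  proof (induction rule: generate_ring.induct)
    case (a_inv x)
    then show ?case using R.generate_ring_in_carrier[OF A] by (simp add: generate_ring.a_inv)
  next
    case (eng_add x y)
    then show ?case using R.generate_ring_in_carrier[OF A] by (simp add: generate_ring.eng_add)
  next
    case (eng_mult x y)
    then show ?case using R.generate_ring_in_carrier[OF A] by (simp add: generate_ring.eng_mult)
  qed (use generate_ring.one[of S] in \<open>auto intro: generate_ring.incl\<close>)
  then show "a \<in> generate_ring S (h ` A)" by (simp add: x(2))
qed

lemma image_additive_subgroup:
  assumes "additive_subgroup H R"
  shows "additive_subgroup (h ` H) S"
proof (rule additive_subgroupI)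
  interpret H: additive_subgroup H R by fact
  have Hc: "x \<in> carrier R" if "x \<in> H" for x using that H.a_subset by blast
  show "subgroup (h ` H) (add_monoid S)"
  proof (rule S.add.subgroupI)
    show "h ` H \<subseteq> carrier S" using Hc by auto
    show "h ` H \<noteq> {}" using H.zero_closed by blast
    fix a assume "a \<in> h ` H"
    then obtain x where x: "x \<in> H" "a = h x" by blast
    have "\<ominus>\<^bsub>S\<^esub> a = h (\<ominus> x)" using x Hc by simp
    then show "\<ominus>\<^bsub>S\<^esub> a \<in> h ` H" using H.a_inv_closed[OF x(1)] by blast
  next
    fix a b assume "a \<in> h ` H" "b \<in> h ` H"
    then obtain x y where x: "x \<in> H" "y \<in> H" "a = h x" "b = h y" by blast
    have "a \<oplus>\<^bsub>S\<^esub> b = h (x \<oplus> y)" using x Hc by simp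
    then show "a \<oplus>\<^bsub>S\<^esub> b \<in> h ` H" using H.a_closed[OF x(1,2)] by blast
  qed
qed

lemma image_standard_graded:
  assumes sg: "standard_graded R \<iota> G" and \<iota>': "\<iota>' = h \<circ> \<iota>" and G': "\<And>d. G' d = h ` G d"
  shows "standard_graded S \<iota>' G'"
proof -
  have \<iota>: "\<iota> \<in> ring_hom ring_of_type_algebra R" "inj \<iota>" "G 0 = range \<iota>"
    and add: "\<And>d. additive_subgroup (G d) R"
    and mult: "\<And>d e x y. x \<in> G d \<Longrightarrow> y \<in> G e \<Longrightarrow> x \<otimes> y \<in> G (d + e)"
    and dec: "\<And>x. x \<in> carrier R \<Longrightarrow> \<exists>!f. (\<forall>d. f d \<in> G d) \<and> finite {d. f d \<noteq> \<zero>} \<and>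
        x = (\<Oplus>d\<in>{d. f d \<noteq> \<zero>}. f d)"
    and gen: "\<exists>A. finite A \<and> A \<subseteq> G 1 \<and> generate_ring R (range \<iota> \<union> A) = carrier R"
    using sg unfolding standard_graded_def by blast+
  have Gc: "x \<in> carrier R" if "x \<in> G d" for x d
    using additive_subgroup.a_subset[OF add] that by blast
  have \<iota>c: "range \<iota> \<subseteq> carrier R" using Gc \<iota>(3) by blast
  have sum: "h (\<Oplus>d\<in>{d. f d \<noteq> \<zero>}. f d) = (\<Oplus>\<^bsub>S\<^esub>d\<in>{d. h (f d) \<noteq> \<zero>\<^bsub>S\<^esub>}. h (f d))"
    if f: "\<And>d. f d \<in> carrier R" for f :: "nat \<Rightarrow> 'a"
  proof -
    have "{d. h (f d) \<noteq> \<zero>\<^bsub>S\<^esub>} = {d. f d \<noteq> \<zero>}" using h_eq_zero[OF f] by simp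
    then show ?thesis using hom_finsum[of f "{d. f d \<noteq> \<zero>}"] f by (simp add: Pi_def comp_def)
  qed
  show ?thesis
    unfolding standard_graded_def
  proof (intro conjI allI ballI)
    show "cring S" ..
    show "\<iota>' \<in> ring_hom ring_of_type_algebra S"
      unfolding \<iota>' using \<iota>(1) homh by (rule ring_hom_trans)
    show "inj \<iota>'"
    proof (rule injI)
      fix a b assume "\<iota>' a = \<iota>' b"
      then have "\<iota> a = \<iota> b" using h_inj[of "\<iota> a" "\<iota> b"] \<iota>c by (auto simp: \<iota>')
      then show "a = b" using \<iota>(2) by (simp add: inj_def)
    qed
    show "G' 0 = range \<iota>'" by (simp add: G' \<iota>' \<iota>(3) image_comp)
    show "additive_subgroup (G' d) S" for d unfolding G' by (rule image_additive_subgroup[OF add])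
    show "a \<otimes>\<^bsub>S\<^esub> b \<in> G' (d + e)" if ab: "a \<in> G' d" "b \<in> G' e" for a b d e
    proof -
      obtain x y where x: "x \<in> G d" "y \<in> G e" "a = h x" "b = h y" using ab unfolding G' by blast
      then have "a \<otimes>\<^bsub>S\<^esub> b = h (x \<otimes> y)" using Gc by simp
      then show ?thesis unfolding G' using mult[OF x(1,2)] by blast
    qed
    show "\<exists>A. finite A \<and> A \<subseteq> G' 1 \<and> generate_ring S (range \<iota>' \<union> A) = carrier S"
    proof -
      obtain A where A: "finite A" "A \<subseteq> G 1" "generate_ring R (range \<iota> \<union> A) = carrier R"
        using gen by blast
      have c: "range \<iota> \<union> A \<subseteq> carrier R" using \<iota>c A(2) Gc by blast
      have im: "h ` (range \<iota> \<union> A) = range \<iota>' \<union> h ` A" by (simp add: \<iota>' image_Un image_comp)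
      have "carrier S \<subseteq> generate_ring S (range \<iota>' \<union> h ` A)"
        using image_generate_ring[OF c] unfolding A(3) h_surj im .
      moreover have "generate_ring S (range \<iota>' \<union> h ` A) \<subseteq> carrier S"
        unfolding im[symmetric] using c h_surj by (intro S.generate_ring_incl) blast
      ultimately show ?thesis using A(1,2) by (intro exI[of _ "h ` A"]) (auto simp: G')
    qed
    fix a assume "a \<in> carrier S"
    then obtain x where x: "x \<in> carrier R" "a = h x" using h_surj by blast
    obtain f where f: "\<And>d. f d \<in> G d" "finite {d. f d \<noteq> \<zero>}" "x = (\<Oplus>d\<in>{d. f d \<noteq> \<zero>}. f d)"
      and un: "\<And>f'. \<lbrakk>\<forall>d. f' d \<in> G d; finite {d. f' d \<noteq> \<zero>}; x = (\<Oplus>d\<in>{d. f' d \<noteq> \<zero>}. f' d)\<rbrakk> \<Longrightarrow> f' = f"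
      using dec[OF x(1)] by (elim ex1E) blast
    show "\<exists>!f. (\<forall>d. f d \<in> G' d) \<and> finite {d. f d \<noteq> \<zero>\<^bsub>S\<^esub>} \<and> a = (\<Oplus>\<^bsub>S\<^esub>d\<in>{d. f d \<noteq> \<zero>\<^bsub>S\<^esub>}. f d)"
    proof (rule ex1I)
      show "(\<forall>d. h (f d) \<in> G' d) \<and> finite {d. h (f d) \<noteq> \<zero>\<^bsub>S\<^esub>} \<and>
          a = (\<Oplus>\<^bsub>S\<^esub>d\<in>{d. h (f d) \<noteq> \<zero>\<^bsub>S\<^esub>}. h (f d))"
      proof (intro conjI allI)
        have fc: "f d \<in> carrier R" for d using f(1) Gc by blast
        show "h (f d) \<in> G' d" for d using f(1) by (simp add: G')
        show "finite {d. h (f d) \<noteq> \<zero>\<^bsub>S\<^esub>}" using f(2) by (simp add: h_eq_zero[OF fc])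
        show "a = (\<Oplus>\<^bsub>S\<^esub>d\<in>{d. h (f d) \<noteq> \<zero>\<^bsub>S\<^esub>}. h (f d))"
          unfolding x(2) sum[of f, OF fc, symmetric] using f(3) by (rule arg_cong)
      qed
    next
      fix f' assume f': "(\<forall>d. f' d \<in> G' d) \<and> finite {d. f' d \<noteq> \<zero>\<^bsub>S\<^esub>} \<and>
          a = (\<Oplus>\<^bsub>S\<^esub>d\<in>{d. f' d \<noteq> \<zero>\<^bsub>S\<^esub>}. f' d)"
      then have "\<forall>d. \<exists>y. y \<in> G d \<and> f' d = h y" unfolding G' by blast
      \<comment> \<open>A second decomposition in \<open>S\<close> is pulled back member by member,
        so that uniqueness in \<open>R\<close> applies to it.\<close>
      then obtain k where k: "\<And>d. k d \<in> G d" "\<And>d. f' d = h (k d)" by metis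
      have kc: "k d \<in> carrier R" for d using k(1) Gc by blast
      have f'_eq: "f' = (\<lambda>d. h (k d))" using k(2) by blast
      have "k = f"
      proof (rule un)
        show "\<forall>d. k d \<in> G d" using k(1) by blast
        show "finite {d. k d \<noteq> \<zero>}" using f' by (simp add: f'_eq h_eq_zero kc)
        show "x = (\<Oplus>d\<in>{d. k d \<noteq> \<zero>}. k d)"
        proof (rule h_inj[OF x(1)])
          show "(\<Oplus>d\<in>{d. k d \<noteq> \<zero>}. k d) \<in> carrier R" using kc by (intro R.finsum_closed) auto
          show "h x = h (\<Oplus>d\<in>{d. k d \<noteq> \<zero>}. k d)"
            unfolding sum[of k, OF kc] x(2)[symmetric] using f' unfolding f'_eq by blast
        qed
      qed
      then show "f' = (\<lambda>d. h (f d))" using f'_eq by simp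
    qed
  qed
qed

text \<open>Applying \<open>h\<close> to each coordinate is a bijection \<open>T\<close> between the
  free modules that commutes with the matrix maps, so images and kernels correspond.\<close>

lemma image_linear_resolution:
  assumes lr: "linear_resolution_of_residue_field R G b M"
    and Gc: "\<And>d. G d \<subseteq> carrier R" and G': "\<And>d. G' d = h ` G d"
  shows "linear_resolution_of_residue_field S G' b (\<lambda>i j k. h (M i j k))"
proof -
  have b0: "b 0 = 1" and M: "\<And>i j k. j < b (Suc i) \<Longrightarrow> k < b i \<Longrightarrow> M i j k \<in> G 1"
    and ex0: "matrix_map R (b 1) (b 0) (M 0) ` free_module R (b 1) =
       {v \<in> free_module R (b 0). irrelevant_ideal R G +> v 0 = \<zero>\<^bsub>R Quot irrelevant_ideal R G\<^esub>}"
    and ex: "\<And>i. matrix_map R (b (Suc (Suc i))) (b (Suc i)) (M (Suc i)) ` free_module R (b (Suc (Suc i))) =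
       {v \<in> free_module R (b (Suc i)). matrix_map R (b (Suc i)) (b i) (M i) v = (\<lambda>k\<in>{..<b i}. \<zero>)}"
    using lr unfolding linear_resolution_of_residue_field_def by blast+
  define T where "T c v = (\<lambda>k\<in>{..<c}. h (v k))" for c and v :: "nat \<Rightarrow> 'a"
  have free: "free_module S c = T c ` free_module R c" for c
  proof
    show "T c ` free_module R c \<subseteq> free_module S c"
    proof (rule image_subsetI)
      fix v assume v: "v \<in> free_module R c"
      have "h (v k) \<in> carrier S" if "k \<in> {..<c}" for k
        using PiE_mem[OF v[unfolded free_module_def] that] by simp
      then show "T c v \<in> free_module S c"
        unfolding free_module_def T_def restrict_PiE_iff by blast
    qed
    show "free_module S c \<subseteq> T c ` free_module R c"
    proof
      fix w assume w: "w \<in> free_module S c"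
      then have "\<forall>k\<in>{..<c}. \<exists>x. x \<in> carrier R \<and> w k = h x"
        unfolding free_module_def using h_surj by blast
      then obtain v where v: "\<forall>k\<in>{..<c}. v k \<in> carrier R \<and> w k = h (v k)"
        by (rule bchoice[THEN exE])
      have "w = T c (restrict v {..<c})"
        using w v by (auto simp: free_module_def T_def fun_eq_iff PiE_def extensional_def restrict_def)
      then show "w \<in> T c ` free_module R c" using v by (auto simp: free_module_def)
    qed
  qed
  have T_eq: "T c v = T c w \<longleftrightarrow> v = w" if "v \<in> free_module R c" "w \<in> free_module R c" for c v w
  proof
    assume eq: "T c v = T c w"
    show "v = w"
    proof (rule PiE_ext[OF that[unfolded free_module_def]])
      fix k assume "k \<in> {..<c}"
      then show "v k = w k"
        using fun_cong[OF eq, of k] that h_inj[of "v k" "w k"] by (auto simp: T_def free_module_def)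
    qed
  qed simp
  have map: "matrix_map S (b (Suc i)) (b i) (\<lambda>j k. h (M i j k)) (T (b (Suc i)) v) =
      T (b i) (matrix_map R (b (Suc i)) (b i) (M i) v)" and
    map_closed: "matrix_map R (b (Suc i)) (b i) (M i) v \<in> free_module R (b i)"
    if v: "v \<in> free_module R (b (Suc i))" for i v
  proof -
    have vc: "v j \<in> carrier R" if "j < b (Suc i)" for j
      using v that by (auto simp: free_module_def)
    have Mc: "M i j k \<in> carrier R" if "j < b (Suc i)" "k < b i" for j k
      using M[OF that] Gc by blast
    have c: "v j \<otimes> M i j k \<in> carrier R" if "j < b (Suc i)" "k < b i" for j k
      using vc Mc that by simp
    then show "matrix_map R (b (Suc i)) (b i) (M i) v \<in> free_module R (b i)"
      by (auto simp: matrix_map_def free_module_def intro!: R.finsum_closed)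
    show "matrix_map S (b (Suc i)) (b i) (\<lambda>j k. h (M i j k)) (T (b (Suc i)) v) =
      T (b i) (matrix_map R (b (Suc i)) (b i) (M i) v)"
      unfolding matrix_map_def T_def
    proof (rule restrict_ext)
      fix k assume k: "k \<in> {..<b i}"
      have "h (\<Oplus>j\<in>{..<b (Suc i)}. v j \<otimes> M i j k) = (\<Oplus>\<^bsub>S\<^esub>j\<in>{..<b (Suc i)}. h (v j \<otimes> M i j k))"
        using hom_finsum[of "\<lambda>j. v j \<otimes> M i j k" "{..<b (Suc i)}"] c k by (simp add: Pi_def comp_def)
      also have "\<dots> = (\<Oplus>\<^bsub>S\<^esub>j\<in>{..<b (Suc i)}. (\<lambda>k\<in>{..<b (Suc i)}. h (v k)) j \<otimes>\<^bsub>S\<^esub> h (M i j k))"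
      proof (rule S.finsum_cong')
        show "(\<lambda>j. (\<lambda>k\<in>{..<b (Suc i)}. h (v k)) j \<otimes>\<^bsub>S\<^esub> h (M i j k)) \<in> {..<b (Suc i)} \<rightarrow> carrier S"
          using vc Mc k by auto
        show "h (v j \<otimes> M i j k) = (\<lambda>k\<in>{..<b (Suc i)}. h (v k)) j \<otimes>\<^bsub>S\<^esub> h (M i j k)"
          if "j \<in> {..<b (Suc i)}" for j
          using vc Mc k that by simp
      qed simp
      finally show "(\<Oplus>\<^bsub>S\<^esub>j\<in>{..<b (Suc i)}. (\<lambda>k\<in>{..<b (Suc i)}. h (v k)) j \<otimes>\<^bsub>S\<^esub> h (M i j k)) =
        h ((\<lambda>k\<in>{..<b i}. \<Oplus>j\<in>{..<b (Suc i)}. v j \<otimes> M i j k) k)" using k by simp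
    qed
  qed
  have image: "matrix_map S (b (Suc i)) (b i) (\<lambda>j k. h (M i j k)) ` free_module S (b (Suc i)) =
      T (b i) ` (matrix_map R (b (Suc i)) (b i) (M i) ` free_module R (b (Suc i)))" for i
    unfolding free image_image using map by (intro image_cong) auto
  have G: "(\<Union>d\<in>{1..}. G d) \<subseteq> carrier R" using Gc by blast
  have irr: "irrelevant_ideal S G' = h ` irrelevant_ideal R G"
    unfolding irrelevant_ideal_def image_genideal[OF G, symmetric] by (simp add: image_UN G')
  have I: "ideal (irrelevant_ideal R G) R"
    unfolding irrelevant_ideal_def by (rule R.genideal_ideal[OF G])
  show ?thesis
    unfolding linear_resolution_of_residue_field_def
  proof (intro conjI allI impI)
    show "b 0 = 1" by (rule b0)
    show "h (M i j k) \<in> G' 1" if "j < b (Suc i)" "k < b i" for i j k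
      using M[OF that] by (simp add: G')
    have "irrelevant_ideal S G' +>\<^bsub>S\<^esub> T (b 0) v 0 = \<zero>\<^bsub>S Quot irrelevant_ideal S G'\<^esub> \<longleftrightarrow>
        irrelevant_ideal R G +> v 0 = \<zero>\<^bsub>R Quot irrelevant_ideal R G\<^esub>"
      if v: "v \<in> free_module R (b 0)" for v
    proof -
      have v0: "v 0 \<in> carrier R" "T (b 0) v 0 = h (v 0)"
        using v b0 by (auto simp: free_module_def T_def)
      have "h (v 0) \<in> h ` irrelevant_ideal R G \<longleftrightarrow> v 0 \<in> irrelevant_ideal R G"
        using h_inj[OF v0(1)] ideal.Icarr[OF I] by blast
      then show ?thesis
        using rcos_eq_zero_iff[OF R.ring_axioms I v0(1)]
          rcos_eq_zero_iff[OF S.ring_axioms image_ideal[OF I], of "h (v 0)"] v0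
        by (simp add: irr)
    qed
    then show "matrix_map S (b 1) (b 0) (\<lambda>j k. h (M 0 j k)) ` free_module S (b 1) =
       {v \<in> free_module S (b 0). irrelevant_ideal S G' +>\<^bsub>S\<^esub> v 0 = \<zero>\<^bsub>S Quot irrelevant_ideal S G'\<^esub>}"
      using image[of 0] ex0 unfolding One_nat_def free[of "b 0"] by auto
    fix i
    have zero: "(\<lambda>k\<in>{..<b i}. \<zero>\<^bsub>S\<^esub>) = T (b i) (\<lambda>k\<in>{..<b i}. \<zero>)"
      unfolding T_def by (rule restrict_ext) simp
    have "(\<lambda>k\<in>{..<b i}. \<zero>) \<in> free_module R (b i)" by (auto simp: free_module_def)
    then have "matrix_map S (b (Suc i)) (b i) (\<lambda>j k. h (M i j k)) (T (b (Suc i)) v) = (\<lambda>k\<in>{..<b i}. \<zero>\<^bsub>S\<^esub>) \<longleftrightarrow>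
        matrix_map R (b (Suc i)) (b i) (M i) v = (\<lambda>k\<in>{..<b i}. \<zero>)"
      if "v \<in> free_module R (b (Suc i))" for v
      unfolding zero map[OF that] using T_eq map_closed[OF that] by blast
    then show "matrix_map S (b (Suc (Suc i))) (b (Suc i)) (\<lambda>j k. h (M (Suc i) j k)) ` free_module S (b (Suc (Suc i))) =
       {v \<in> free_module S (b (Suc i)).
          matrix_map S (b (Suc i)) (b i) (\<lambda>j k. h (M i j k)) v = (\<lambda>k\<in>{..<b i}. \<zero>\<^bsub>S\<^esub>)}"
      using image[of "Suc i"] ex[of i] unfolding free[of "b (Suc i)"] by auto
  qed
qed

lemma image_koszul:
  assumes "koszul R \<iota> G" and "\<iota>' = h \<circ> \<iota>" and "\<And>d. G' d = h ` G d"
  shows "koszul S \<iota>' G'"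
proof -
  obtain b M where sg: "standard_graded R \<iota> G" and lr: "linear_resolution_of_residue_field R G b M"
    using assms(1) unfolding koszul_def by blast
  have "G d \<subseteq> carrier R" for d
    using sg unfolding standard_graded_def by (meson additive_subgroup.a_subset)
  from image_linear_resolution[OF lr this assms(3)] image_standard_graded[OF sg assms(2,3)]
  show ?thesis unfolding koszul_def by blast
qed

end

section \<open>Standard monomials of a standardizable diagram\<close>

definition bad :: "nat list \<Rightarrow> nat list \<Rightarrow> bool" where
  "bad a b \<longleftrightarrow> (\<exists>k l. k < l \<and> l < length a \<and> l < length b \<and> (\<forall>i<k. a ! i = b ! i) \<and>
     (a ! k < b ! k \<and> a ! l < b ! l \<or> b ! k < a ! k \<and> b ! l < a ! l))"

lemma list_less_iff_nth:
  fixes a b :: "nat list"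
  assumes "length a = length b"
  shows "a < b \<longleftrightarrow> (\<exists>k<length a. (\<forall>i<k. a ! i = b ! i) \<and> a ! k < b ! k)"
proof -
  have "take k a = take k b \<longleftrightarrow> (\<forall>i<k. a ! i = b ! i)" if "k < length a" for k
    using that assms by (simp add: list_eq_iff_nth_eq)
  then show ?thesis
    unfolding list_less_def lexord_take_index_conv using assms by (auto simp: take_all_iff)
qed

section \<open>Counting points by their prefixes\<close>

locale prefix_count =
  fixes E :: "nat list set" and N :: nat
  assumes fin: "finite E" and len: "c \<in> E \<Longrightarrow> length c = N"
begin

definition cnt :: "(nat list \<Rightarrow> nat) \<Rightarrow> (nat list \<Rightarrow> bool) \<Rightarrow> nat" where
  "cnt u P = sum u {c \<in> E. P c}"

lemma cnt_cong: "(\<And>c. c \<in> E \<Longrightarrow> P c \<longleftrightarrow> Q c) \<Longrightarrow> cnt u P = cnt u Q"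
  unfolding cnt_def by (rule arg_cong[where f = "sum u"]) auto

lemma cnt_split: "cnt u P = cnt u (\<lambda>c. P c \<and> Q c) + cnt u (\<lambda>c. P c \<and> \<not> Q c)"
proof -
  have "{c \<in> E. P c} = {c \<in> E. P c \<and> Q c} \<union> {c \<in> E. P c \<and> \<not> Q c}" by auto
  then show ?thesis unfolding cnt_def using fin by (simp add: sum.union_disjoint Int_def)
qed

lemma cnt_pos: "cnt u P > 0 \<longleftrightarrow> (\<exists>c\<in>E. P c \<and> u c > 0)"
proof -
  have "cnt u P = 0 \<longleftrightarrow> (\<forall>c\<in>{c \<in> E. P c}. u c = 0)"
    unfolding cnt_def using fin by (intro sum_eq_0_iff) auto
  then show ?thesis by auto
qed

text \<open>
  Without bad pairs, points with a larger prefix have smaller or equal \<open>k\<close>-th coordinates. So the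
  \<open>c ! k \<le> j\<close> are used up first by the points beyond \<open>p\<close>, then by those with prefix \<open>p\<close>; the truncated
  subtraction is intended.
\<close>

lemma cnt_prefix:
  assumes std: "\<And>a b. \<lbrakk>a \<in> E; b \<in> E; u a > 0; u b > 0\<rbrakk> \<Longrightarrow> \<not> bad a b"
    and k: "k < N" and p: "length p = k"
  shows "cnt u (\<lambda>c. take k c = p \<and> c ! k \<le> j) =
    min (cnt u (\<lambda>c. take k c = p)) (cnt u (\<lambda>c. c ! k \<le> j) - cnt u (\<lambda>c. p < take k c))"
proof -
  have desc: "b ! k \<le> a ! k"
    if ab: "a \<in> E" "b \<in> E" "u a > 0" "u b > 0" and less: "take k a < take k b" for a b
  proof -
    have "length (take k a) = length (take k b)" "length (take k a) = k" using len ab k by simp_all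
    then obtain k' where k': "k' < k" "\<forall>i<k'. a ! i = b ! i" "a ! k' < b ! k'"
      using less by (auto simp: list_less_iff_nth)
    show ?thesis
    proof (rule ccontr)
      assume "\<not> b ! k \<le> a ! k"
      then have "bad a b" unfolding bad_def using k' k len ab by (intro exI[of _ k'] exI[of _ k]) auto
      then show False using std ab by blast
    qed
  qed
  define F where "F = cnt u (\<lambda>c. take k c = p)"
  define G where "G = cnt u (\<lambda>c. p < take k c)"
  define C where "C = cnt u (\<lambda>c. c ! k \<le> j)"
  define Cp where "Cp = cnt u (\<lambda>c. take k c = p \<and> c ! k \<le> j)"
  define Cg where "Cg = cnt u (\<lambda>c. p < take k c \<and> c ! k \<le> j)"
  define Cl where "Cl = cnt u (\<lambda>c. take k c < p \<and> c ! k \<le> j)"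
  have C: "C = Cp + (Cg + Cl)"
  proof -
    have "C = cnt u (\<lambda>c. c ! k \<le> j \<and> take k c = p) + cnt u (\<lambda>c. c ! k \<le> j \<and> take k c \<noteq> p)"
      unfolding C_def by (rule cnt_split)
    moreover have "cnt u (\<lambda>c. c ! k \<le> j \<and> take k c \<noteq> p) =
        cnt u (\<lambda>c. (c ! k \<le> j \<and> take k c \<noteq> p) \<and> p < take k c) +
        cnt u (\<lambda>c. (c ! k \<le> j \<and> take k c \<noteq> p) \<and> \<not> p < take k c)"
      by (rule cnt_split)
    moreover have "cnt u (\<lambda>c. (c ! k \<le> j \<and> take k c \<noteq> p) \<and> p < take k c) = Cg"
      unfolding Cg_def by (rule cnt_cong) auto
    moreover have "cnt u (\<lambda>c. (c ! k \<le> j \<and> take k c \<noteq> p) \<and> \<not> p < take k c) = Cl"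
      unfolding Cl_def by (rule cnt_cong) auto
    moreover have "cnt u (\<lambda>c. c ! k \<le> j \<and> take k c = p) = Cp"
      unfolding Cp_def by (rule cnt_cong) auto
    ultimately show ?thesis by simp
  qed
  have G: "G = Cg + cnt u (\<lambda>c. p < take k c \<and> \<not> c ! k \<le> j)"
    unfolding G_def Cg_def by (rule cnt_split)
  have F: "F = Cp + cnt u (\<lambda>c. take k c = p \<and> \<not> c ! k \<le> j)"
    unfolding F_def Cp_def by (rule cnt_split)
  \<comment> \<open>A point with prefix \<open>p\<close> and value at most \<open>j\<close> forces
    values at most \<open>j\<close> on all points beyond \<open>p\<close>. Conversely, a point with
    prefix \<open>p\<close> and a larger value forces larger values on all points before
    \<open>p\<close>, so that \<open>Cl\<close> vanishes. The two cases together give the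
    minimum.\<close>
  have 1: "G = Cg" if pos: "Cp > 0"
  proof -
    obtain b where b: "b \<in> E" "take k b = p" "b ! k \<le> j" "u b > 0"
      using pos unfolding Cp_def cnt_pos by blast
    have "\<not> cnt u (\<lambda>c. p < take k c \<and> \<not> c ! k \<le> j) > 0"
      unfolding cnt_pos using desc[OF b(1) _ b(4)] b(2,3) by fastforce
    then show ?thesis using G by simp
  qed
  have 2: "Cl = 0" if lt: "Cp < F"
  proof -
    have "cnt u (\<lambda>c. take k c = p \<and> \<not> c ! k \<le> j) > 0" using lt F by simp
    then obtain b where b: "b \<in> E" "take k b = p" "\<not> b ! k \<le> j" "u b > 0"
      unfolding cnt_pos by blast
    have "\<not> Cl > 0"
      unfolding Cl_def cnt_pos using desc[OF _ b(1) _ b(4)] b(2,3) by fastforce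
    then show ?thesis by simp
  qed
  have "Cp = min F (C - G)"
    using C F G 1 2 by (cases "Cp = 0"; cases "Cp < F") auto
  then show ?thesis by (simp add: Cp_def F_def C_def G_def)
qed

text \<open>By \<open>cnt_prefix\<close>, the counts of the prefixes of length \<open>k\<close> and
  the distribution of the coordinate at position \<open>k\<close> determine the counts of the
  prefixes of length \<open>Suc k\<close>. At full length the prefix is the point itself.\<close>

lemma standard_unique:
  assumes std: "\<And>a b. \<lbrakk>a \<in> E; b \<in> E; u a > 0; u b > 0\<rbrakk> \<Longrightarrow> \<not> bad a b"
    and std': "\<And>a b. \<lbrakk>a \<in> E; b \<in> E; v a > 0; v b > 0\<rbrakk> \<Longrightarrow> \<not> bad a b"
    and eq: "\<And>k j. k < N \<Longrightarrow> cnt u (\<lambda>c. c ! k = j) = cnt v (\<lambda>c. c ! k = j)"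
    and total: "cnt u (\<lambda>_. True) = cnt v (\<lambda>_. True)"
    and c: "c \<in> E"
  shows "u c = v c"
proof -
  \<comment> \<open>The image monomial records exact coordinate values, while
    \<open>cnt_prefix\<close> works with cumulative counts. This and the next fact convert between
    the two.\<close>
  have le_eq: "cnt u (\<lambda>c. Q c \<and> c ! k \<le> j) = cnt v (\<lambda>c. Q c \<and> c ! k \<le> j)"
    if "\<And>j. cnt u (\<lambda>c. Q c \<and> c ! k = j) = cnt v (\<lambda>c. Q c \<and> c ! k = j)" for Q k j
  proof (induction j)
    case 0
    then show ?case using that[of 0] by simp
  next
    case (Suc j)
    have "cnt w (\<lambda>c. Q c \<and> c ! k \<le> Suc j) =
        cnt w (\<lambda>c. Q c \<and> c ! k \<le> j) + cnt w (\<lambda>c. Q c \<and> c ! k = Suc j)" for w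
      by (subst cnt_split[where Q = "\<lambda>c. c ! k \<le> j"], intro arg_cong2[where f = "(+)"] cnt_cong) auto
    then show ?case using Suc that by simp
  qed
  have eq_le: "cnt u (\<lambda>c. Q c \<and> c ! k = j) = cnt v (\<lambda>c. Q c \<and> c ! k = j)"
    if h: "\<And>j. cnt u (\<lambda>c. Q c \<and> c ! k \<le> j) = cnt v (\<lambda>c. Q c \<and> c ! k \<le> j)" for Q k j
  proof (cases j)
    case 0
    then show ?thesis using h[of 0] by simp
  next
    case (Suc i)
    have "cnt w (\<lambda>c. Q c \<and> c ! k \<le> Suc i) =
        cnt w (\<lambda>c. Q c \<and> c ! k \<le> i) + cnt w (\<lambda>c. Q c \<and> c ! k = Suc i)" for w
      by (subst cnt_split[where Q = "\<lambda>c. c ! k \<le> i"], intro arg_cong2[where f = "(+)"] cnt_cong) auto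
    then show ?thesis using h[of i] h[of "Suc i"] Suc by simp
  qed
  \<comment> \<open>The induction is over arbitrary predicates on prefixes because
    \<open>cnt_prefix\<close> refers both to prefixes equal to \<open>p\<close> and to prefixes
    beyond \<open>p\<close>.\<close>
  have "\<forall>P. cnt u (\<lambda>c. P (take k c)) = cnt v (\<lambda>c. P (take k c))" if "k \<le> N" for k
    using that
  proof (induction k)
    case 0
    have "cnt w (\<lambda>c. P (take 0 c)) = (if P [] then cnt w (\<lambda>_. True) else 0)" for w P
      by (simp add: cnt_def)
    then show ?case using total by simp
  next
    case (Suc k)
    then have k: "k < N" and IH: "\<And>P. cnt u (\<lambda>c. P (take k c)) = cnt v (\<lambda>c. P (take k c))" by auto
    have le: "cnt u (\<lambda>c. c ! k \<le> j) = cnt v (\<lambda>c. c ! k \<le> j)" for j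
      using le_eq[of "\<lambda>_. True"] eq[OF k] by simp
    have "cnt u (\<lambda>c. take k c = p \<and> c ! k \<le> j) = cnt v (\<lambda>c. take k c = p \<and> c ! k \<le> j)"
      if "length p = k" for p j
      using cnt_prefix[OF std k that] cnt_prefix[OF std' k that] le
        IH[of "\<lambda>q. q = p"] IH[of "\<lambda>q. p < q"] by simp
    then have prefix: "cnt u (\<lambda>c. take k c = p \<and> c ! k = j) = cnt v (\<lambda>c. take k c = p \<and> c ! k = j)"
      if "length p = k" for p j using eq_le[of "\<lambda>c. take k c = p"] that by blast
    have group: "cnt w (\<lambda>c. P (take (Suc k) c)) =
        (\<Sum>q\<in>{q \<in> take (Suc k) ` E. P q}. cnt w (\<lambda>c. take k c = take k q \<and> c ! k = q ! k))" for w P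
    proof -
      have "(\<Sum>q\<in>{q \<in> take (Suc k) ` E. P q}. sum w {c \<in> {c \<in> E. P (take (Suc k) c)}. take (Suc k) c = q}) =
          sum w {c \<in> E. P (take (Suc k) c)}"
        using fin by (intro sum.group) auto
      moreover have "sum w {c \<in> {c \<in> E. P (take (Suc k) c)}. take (Suc k) c = q} =
          cnt w (\<lambda>c. take k c = take k q \<and> c ! k = q ! k)"
        if q: "q \<in> {q \<in> take (Suc k) ` E. P q}" for q
      proof -
        obtain c0 where c0: "c0 \<in> E" "q = take (Suc k) c0" using q by blast
        have conv: "take (Suc k) c = q \<longleftrightarrow> take k c = take k q \<and> c ! k = q ! k" if "c \<in> E" for c
          using len[OF that] len[OF c0(1)] k by (auto simp: c0(2) take_Suc_conv_app_nth min_def nth_append)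
        have "P q" using q by blast
        then have "{c \<in> {c \<in> E. P (take (Suc k) c)}. take (Suc k) c = q} = {c \<in> E. take (Suc k) c = q}"
          by auto
        also have "\<dots> = {c \<in> E. take k c = take k q \<and> c ! k = q ! k}" using conv by blast
        finally have "{c \<in> {c \<in> E. P (take (Suc k) c)}. take (Suc k) c = q} =
            {c \<in> E. take k c = take k q \<and> c ! k = q ! k}" .
        then show ?thesis by (simp add: cnt_def)
      qed
      ultimately show ?thesis by (simp add: cnt_def)
    qed
    show ?case
      unfolding group using prefix len k by (intro allI sum.cong refl) auto
  qed
  from this[OF order_refl, THEN spec, of "\<lambda>d. d = c"]
  have "cnt u (\<lambda>d. take N d = c) = cnt v (\<lambda>d. take N d = c)" .
  moreover have "cnt w (\<lambda>d. take N d = c) = w c" for w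
  proof -
    have "{d \<in> E. take N d = c} = {c}" using len c by auto
    then show ?thesis by (simp add: cnt_def)
  qed
  ultimately show ?thesis by simp
qed

end

section \<open>The monomial map on exponents\<close>

definition point_exp :: "nat list \<Rightarrow> (xt \<Rightarrow>\<^sub>0 nat)" where
  "point_exp c = (\<Sum>i<length (butlast c). single (XVar i (butlast c ! i)) 1) + single (TVar (last c)) 1"

definition toric_exp :: "(nat list \<Rightarrow>\<^sub>0 nat) \<Rightarrow> (xt \<Rightarrow>\<^sub>0 nat)" where
  "toric_exp u = (\<Sum>c\<in>supp u. \<Sum>i<coef u c. point_exp c)"

definition t_degree :: "nat \<Rightarrow> (xt \<Rightarrow>\<^sub>0 nat) \<Rightarrow> nat" where
  "t_degree r \<mu> = (\<Sum>i=1..r. coef \<mu> (TVar i))"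

lemma prod_single: "(\<Prod>i\<in>A. single (f i) (1::'k::field)) = single (\<Sum>i\<in>A. f i) 1"
  by (induction A rule: infinite_finite_induct) (simp_all add: mult_single)

lemma power_single: "single \<mu> (1::'k::field) ^ k = single (\<Sum>i<k. \<mu>) 1"
  by (induction k) (simp_all add: mult_single add_ac)

lemma x_monomial_eq: "x_monomial a = single (\<Sum>i<length a. single (XVar i (a ! i)) 1) (1::'k::field)"
  unfolding x_monomial_def mvar_def by (rule prod_single)

lemma fiber_monomial_eq: "fiber_monomial c = single (point_exp c) (1::'k::field)"
  by (simp add: fiber_monomial_def x_monomial_eq mvar_def mult_single point_exp_def)

lemma coef_point_exp_XVar:
  "coef (point_exp c) (XVar k j) = of_bool (k < length c - 1 \<and> c ! k = j)"
proof -
  have "(\<Sum>i<length (butlast c). coef (single (XVar i (butlast c ! i)) (1::nat)) (XVar k j)) =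
      (\<Sum>i<length c - 1. if i = k then of_bool (c ! k = j) else 0)"
    by (rule sum.cong) (auto simp: lookup_single when_def nth_butlast)
  then show ?thesis
    unfolding point_exp_def lookup_add lookup_sum by (simp add: lookup_single)
qed

lemma coef_point_exp_TVar: "coef (point_exp c) (TVar j) = of_bool (last c = j)"
  unfolding point_exp_def lookup_add lookup_sum by (simp add: lookup_single when_def)

lemma coef_toric_exp:
  assumes "finite A" "supp u \<subseteq> A"
  shows "coef (toric_exp u) x = (\<Sum>c\<in>A. coef u c * coef (point_exp c) x)"
proof -
  have "coef (toric_exp u) x = (\<Sum>c\<in>supp u. coef u c * coef (point_exp c) x)"
    by (simp add: toric_exp_def lookup_sum)
  also have "\<dots> = (\<Sum>c\<in>A. coef u c * coef (point_exp c) x)"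
    by (rule sum.mono_neutral_left[OF assms]) (auto simp: in_keys_iff)
  finally show ?thesis .
qed

lemma toric_exp_add: "toric_exp (u + v) = toric_exp u + toric_exp v"
proof (rule poly_mapping_eqI)
  fix x
  let ?A = "supp u \<union> supp v"
  have "finite ?A" by simp
  from coef_toric_exp[OF this, of u] coef_toric_exp[OF this, of v] coef_toric_exp[OF this, of "u + v"]
  show "coef (toric_exp (u + v)) x = coef (toric_exp u + toric_exp v) x"
    by (simp add: supp_add_nat lookup_add distrib_right sum.distrib)
qed

lemma toric_exp_single: "toric_exp (single c 1) = point_exp c"
  by (simp add: toric_exp_def)

text \<open>At every position the unordered pair of coordinates is the same before and after the
  exchange; the last position is the one that accounts for the t-variable.\<close>

lemma point_exp_exchange:
  assumes "length a = Suc n" "length b = Suc n"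
    and "p = exchange (Suc n) H a b" "q = exchange (Suc n) H b a"
  shows "point_exp a + point_exp b = point_exp p + point_exp q"
proof (rule poly_mapping_eqI)
  fix x
  have nth: "p ! i = (if i \<in> H then b ! i else a ! i)" "q ! i = (if i \<in> H then a ! i else b ! i)"
    if "i < Suc n" for i
    using that unfolding assms(3,4) exchange_def by (simp_all del: upt_Suc)
  have len: "length p = Suc n" "length q = Suc n" by (simp_all add: assms(3,4) exchange_def)
  show "coef (point_exp a + point_exp b) x = coef (point_exp p + point_exp q) x"
  proof (cases x)
    case (XVar i j)
    then show ?thesis
      using nth[of i] by (cases "i < n"; cases "i \<in> H") (simp_all add: lookup_add coef_point_exp_XVar assms(1,2) len)
  next
    case (TVar j)
    have last: "last c = c ! n" if "length c = Suc n" for c :: "nat list"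
      using that by (metis diff_Suc_1 last_conv_nth length_0_conv nat.distinct(1))
    then show ?thesis
      using nth[of n] TVar by (cases "n \<in> H") (simp_all add: lookup_add coef_point_exp_TVar assms(1,2) len)
  qed
qed

section \<open>Exchanges inside the extended diagram\<close>

locale extended_diagram =
  fixes D :: "nat list set" and n r :: nat
  assumes ferrers: "ferrers_diagram n D" and std: "standardizable n D"
begin

abbreviation E :: "nat list set" where "E \<equiv> extend_diagram D r"

lemma finite_E: "finite E"
proof -
  have "E = (\<lambda>(a, i). a @ [i]) ` (D \<times> {1..r})" by (auto simp: extend_diagram_def)
  then show ?thesis using ferrers by (simp add: ferrers_diagram_def)
qed

lemma D_length: "a \<in> D \<Longrightarrow> length a = n"
  using ferrers by (auto simp: ferrers_diagram_def positive_points_def)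

lemma E_length: "c \<in> E \<Longrightarrow> length c = Suc n"
  using D_length by (auto simp: extend_diagram_def)

lemma E_last: "c \<in> E \<Longrightarrow> last c \<in> {1..r}"
  by (auto simp: extend_diagram_def)

lemma E_lower:
  assumes b: "b \<in> E" and a: "length a = Suc n" "\<And>i. i < Suc n \<Longrightarrow> 0 < a ! i \<and> a ! i \<le> b ! i"
  shows "a \<in> E"
proof -
  obtain b' j where b': "b = b' @ [j]" "b' \<in> D" "j \<in> {1..r}" using b by (auto simp: extend_diagram_def)
  have a_eq: "a = butlast a @ [a ! n]"
    using a(1) by (metis append_butlast_last_id diff_Suc_1 last_conv_nth length_0_conv nat.distinct(1))
  have "butlast a \<in> D"
  proof -
    have "0 < butlast a ! i \<and> butlast a ! i \<le> b' ! i" if "i < n" for i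
      using a(2)[of i] that a(1) D_length[OF b'(2)] by (simp add: nth_butlast b'(1) nth_append)
    moreover have "length (butlast a) = n" using a(1) by simp
    ultimately show ?thesis
      using ferrers b'(2) unfolding ferrers_diagram_def positive_points_def by blast
  qed
  moreover have "a ! n \<in> {1..r}"
    using a(2)[of n] b'(3) D_length[OF b'(2)] by (auto simp: b'(1) nth_append)
  ultimately show ?thesis using a_eq unfolding extend_diagram_def by blast
qed

text \<open>Standardizability passes to the product with an interval, because the maximum of two
  last coordinates stays in the interval. If the first difference is at the last position, there is
  nothing to maximize and the new point is \<open>a\<close>.\<close>

lemma E_max:
  assumes a: "a \<in> E" and b: "b \<in> E" and k: "k < Suc n" "\<And>i. i < k \<Longrightarrow> a ! i = b ! i" "a ! k < b ! k"
  shows "map (\<lambda>i. if i \<le> k then a ! i else max (a ! i) (b ! i)) [0..<Suc n] \<in> E"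
proof -
  obtain a' i where a': "a = a' @ [i]" "a' \<in> D" "i \<in> {1..r}" using a by (auto simp: extend_diagram_def)
  obtain b' j where b': "b = b' @ [j]" "b' \<in> D" "j \<in> {1..r}" using b by (auto simp: extend_diagram_def)
  have len: "length a' = n" "length b' = n" using D_length a' b' by blast+
  show ?thesis
  proof (cases "k = n")
    case True
    have "map (\<lambda>i. if i \<le> k then a ! i else max (a ! i) (b ! i)) [0..<Suc n] = map ((!) a) [0..<Suc n]"
      using True by (intro map_cong) auto
    also have "\<dots> = a" using E_length[OF a] by (metis map_nth)
    finally show ?thesis using a by simp
  next
    case False
    then have kn: "k < n" using k(1) by simp
    have "\<forall>i<k. a' ! i = b' ! i" using k(2) kn len by (auto simp: a'(1) b'(1) nth_append)
    moreover have "a' ! k < b' ! k" using k(3) kn len by (simp add: a'(1) b'(1) nth_append)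
    moreover from this have "a' \<noteq> b'" by auto
    ultimately have m: "map (\<lambda>i. if i \<le> k then a' ! i else max (a' ! i) (b' ! i)) [0..<n] \<in> D"
      using std a'(2) b'(2) kn unfolding standardizable_def by blast
    have "map (\<lambda>i. if i \<le> k then a ! i else max (a ! i) (b ! i)) [0..<Suc n] =
        map (\<lambda>i. if i \<le> k then a' ! i else max (a' ! i) (b' ! i)) [0..<n] @ [max i j]"
      using kn len by (auto simp: a'(1) b'(1) nth_append)
    moreover have "max i j \<in> {1..r}" using a'(3) b'(3) by auto
    ultimately show ?thesis using m unfolding extend_diagram_def by blast
  qed
qed

text \<open>Orient the pair so that \<open>a\<close> is smaller at the first difference
  \<open>k\<close>, and let \<open>H\<close> consist of the later positions where \<open>b\<close>
  exceeds \<open>a\<close>. Then \<open>p\<close> is \<open>a\<close> with maxima after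
  \<open>k\<close>, a point of the diagram by \<open>E_max\<close>, while \<open>q\<close> lies
  below \<open>b\<close> in every coordinate. Both exceed \<open>a\<close>: \<open>p\<close> because
  \<open>H\<close> contains \<open>l\<close>, and \<open>q\<close> because it takes its entry at
  \<open>k\<close> from \<open>b\<close>.\<close>

lemma bad_exchange:
  assumes a: "a \<in> E" and b: "b \<in> E" and "bad a b"
  shows "\<exists>a' b' H. {a', b'} = {a, b} \<and> a' < b' \<and> H \<subseteq> {..<Suc n} \<and>
    exchange (Suc n) H a' b' \<in> E \<and> exchange (Suc n) H b' a' \<in> E \<and>
    a' < exchange (Suc n) H a' b' \<and> a' < exchange (Suc n) H b' a'"
proof -
  have main: "a < b \<and> (\<exists>H\<subseteq>{..<Suc n}. exchange (Suc n) H a b \<in> E \<and> exchange (Suc n) H b a \<in> E \<and>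
    a < exchange (Suc n) H a b \<and> a < exchange (Suc n) H b a)"
    if a: "a \<in> E" and b: "b \<in> E" and kl: "k < l" "l < Suc n" "\<forall>i<k. a ! i = b ! i" "a ! k < b ! k" "a ! l < b ! l"
    for a b k l
  proof -
    define H where "H = {i. k < i \<and> i < Suc n \<and> a ! i < b ! i}"
    define p where "p = exchange (Suc n) H a b"
    define q where "q = exchange (Suc n) H b a"
    have nth: "p ! i = (if i \<in> H then b ! i else a ! i)" "q ! i = (if i \<in> H then a ! i else b ! i)"
      if "i < Suc n" for i
      using that unfolding p_def q_def exchange_def by (simp_all del: upt_Suc)
    have len: "length p = Suc n" "length q = Suc n" by (simp_all add: p_def q_def exchange_def)
    have la: "length a = Suc n" "length b = Suc n" using E_length a b by blast+
    have "p = map (\<lambda>i. if i \<le> k then a ! i else max (a ! i) (b ! i)) [0..<Suc n]"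
      unfolding p_def exchange_def by (rule map_cong) (auto simp: H_def)
    then have pE: "p \<in> E" using E_max[OF a b, of k] kl by simp
    have pos: "0 < c ! i" if "c \<in> E" "i < Suc n" for c i
    proof -
      obtain d j where d: "c = d @ [j]" "d \<in> D" "j \<in> {1..r}" using \<open>c \<in> E\<close> by (auto simp: extend_diagram_def)
      have "d \<in> positive_points n" using d(2) ferrers by (auto simp: ferrers_diagram_def)
      then show ?thesis using that(2) d(3) by (auto simp: d(1) positive_points_def nth_append less_Suc_eq)
    qed
    have "0 < q ! i \<and> q ! i \<le> b ! i" if "i < Suc n" for i
      using nth(2)[OF that] pos[OF a that] pos[OF b that] by (auto simp: H_def)
    then have qE: "q \<in> E" using E_lower[OF b len(2)] by blast
    have "a < b"
      unfolding list_less_iff_nth[of a b, unfolded la, OF refl] using kl by (intro exI[of _ k]) auto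
    moreover have "\<exists>m<Suc n. (\<forall>i<m. a ! i = p ! i) \<and> a ! m < p ! m"
    proof -
      define m where "m = (LEAST m. m \<in> H)"
      have "l \<in> H" using kl by (simp add: H_def)
      then have mH: "m \<in> H" unfolding m_def by (rule LeastI)
      moreover have "i \<notin> H" if "i < m" for i using that not_less_Least unfolding m_def by blast
      ultimately show ?thesis
        by (intro exI[of _ m]) (auto simp: nth H_def)
    qed
    then have "a < p" using list_less_iff_nth[of a p] la len by simp
    moreover have "a < q"
      using list_less_iff_nth[of a q] la len kl nth(2) by (auto simp: H_def intro!: exI[of _ k])
    moreover have "H \<subseteq> {..<Suc n}" by (auto simp: H_def)
    ultimately show ?thesis using pE qE unfolding p_def q_def by blast
  qed
  obtain k l where kl: "k < l" "l < length a" "\<forall>i<k. a ! i = b ! i"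
    "a ! k < b ! k \<and> a ! l < b ! l \<or> b ! k < a ! k \<and> b ! l < a ! l"
    using \<open>bad a b\<close> unfolding bad_def by blast
  have l: "l < Suc n" using kl(2) E_length[OF a] by simp
  from kl(4) show ?thesis
  proof
    assume "a ! k < b ! k \<and> a ! l < b ! l"
    then show ?thesis using main[OF a b kl(1) l kl(3)] by blast
  next
    assume "b ! k < a ! k \<and> b ! l < a ! l"
    then have "b < a \<and> (\<exists>H\<subseteq>{..<Suc n}. exchange (Suc n) H b a \<in> E \<and> exchange (Suc n) H a b \<in> E \<and>
      b < exchange (Suc n) H b a \<and> b < exchange (Suc n) H a b)"
      using main[OF b a kl(1) l] kl(3) by simp
    moreover have "{b, a} = {a, b}" by blast
    ultimately show ?thesis by blast
  qed
qed

text \<open>The list \<open>a\<close> is strictly smaller than the other three, so it decides the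
  comparison, and it occurs only on the right.\<close>

lemma exchange_less:
  assumes "a < b" "a < p" "a < (q :: nat list)"
  shows "single p (1::nat) + single q 1 < single a 1 + single b 1"
  unfolding less_poly_mapping.rep_eq less_fun_def
proof (intro exI conjI allI impI)
  show "coef (single p (1::nat) + single q 1) a < coef (single a 1 + single b 1) a"
    using assms by (auto simp: lookup_add lookup_single when_def)
  show "coef (single p (1::nat) + single q 1) c = coef (single a 1 + single b 1) c" if "c < a" for c
    using assms that by (auto simp: lookup_add lookup_single when_def)
qed

sublocale quadratic_toric E toric_exp "t_degree r" bad
proof
  show "finite E" by (rule finite_E)
  show "toric_exp (u + v) = toric_exp u + toric_exp v" for u v by (rule toric_exp_add)
  show "t_degree r (\<mu> + \<nu>) = t_degree r \<mu> + t_degree r \<nu>" for \<mu> \<nu>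
    by (simp add: t_degree_def lookup_add sum.distrib)
  show "t_degree r (toric_exp (single e 1)) = 1" if "e \<in> E" for e
    using E_last[OF that] by (simp only: toric_exp_single t_degree_def coef_point_exp_TVar) simp
  show "\<not> bad e e" for e by (auto simp: bad_def)
  show "bad b a" if "bad a b" for a b using that unfolding bad_def by metis
  show "\<exists>v. supp v \<subseteq> E \<and> toric_exp v = toric_exp u \<and> v < u"
    if u: "supp u \<subseteq> E" and a: "a \<in> supp u" and b: "b \<in> supp u" and "bad a b" for u a b
  proof -
    obtain a' b' H where ab: "{a', b'} = {a, b}" "a' < b'"
      "exchange (Suc n) H a' b' \<in> E" "exchange (Suc n) H b' a' \<in> E"
      "a' < exchange (Suc n) H a' b'" "a' < exchange (Suc n) H b' a'"
      using bad_exchange[of a b] u a b \<open>bad a b\<close> by blast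
    define p q where "p = exchange (Suc n) H a' b'" and "q = exchange (Suc n) H b' a'"
    have a'b': "a' \<in> supp u" "b' \<in> supp u" using ab(1) a b by (auto simp: doubleton_eq_iff)
    \<comment> \<open>The truncated subtractions are exact because \<open>a'\<close> and
      \<open>b'\<close> are distinct and both occur in \<open>u\<close>.\<close>
    define w where "w = u - single a' 1 - single b' 1"
    have "1 \<le> coef (u - single a' 1) b'"
      using a'b' ab(2) by (auto simp: lookup_minus lookup_single when_def in_keys_iff)
    then have "single b' 1 + w = u - single a' 1" unfolding w_def by (rule single_add_minus)
    moreover have "single a' 1 + (u - single a' 1) = u"
      using a'b'(1) by (intro single_add_minus) (simp add: in_keys_iff)
    ultimately have u_eq: "u = (single a' 1 + single b' 1) + w" by (metis add.assoc)
    define v where "v = (single p 1 + single q 1) + w"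
    have "supp w \<subseteq> E" unfolding w_def by (meson order.trans supp_minus_nat u)
    then have "supp v \<subseteq> E" using ab(3,4) by (simp add: v_def supp_add_nat p_def q_def)
    moreover have "point_exp a' + point_exp b' = point_exp p + point_exp q"
      using E_length u a'b' by (intro point_exp_exchange[of _ n _ _ H]) (auto simp: p_def q_def)
    then have "toric_exp v = toric_exp u"
      by (simp only: v_def u_eq toric_exp_add toric_exp_single)
    moreover have "v < u"
      unfolding v_def using exchange_less[of a' b' p q] ab
      by (subst u_eq) (intro add_strict_right_mono, simp add: p_def q_def)
    ultimately show ?thesis by blast
  qed
  fix u v :: "nat list \<Rightarrow>\<^sub>0 nat"
  assume uv: "supp u \<subseteq> E" "supp v \<subseteq> E" "toric_exp u = toric_exp v"
    and std: "\<forall>a\<in>supp u. \<forall>b\<in>supp u. \<not> bad a b" "\<forall>a\<in>supp v. \<forall>b\<in>supp v. \<not> bad a b"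
  interpret C: prefix_count E "Suc n"
    by unfold_locales (use finite_E E_length in auto)
  \<comment> \<open>Exponents of the image are coordinate counts: position \<open>k\<close> with
    value \<open>j\<close> belongs to one variable, an x-variable for \<open>k < n\<close> and a
    t-variable for the last position.\<close>
  have cnt: "C.cnt (coef w) (\<lambda>c. c ! k = j) = coef (toric_exp w) (if k < n then XVar k j else TVar j)"
    if w: "supp w \<subseteq> E" and k: "k < Suc n" for w k j
  proof -
    have "coef (point_exp c) (if k < n then XVar k j else TVar j) = of_bool (c ! k = j)" if c: "c \<in> E" for c
    proof (cases "k < n")
      case True
      then show ?thesis using E_length[OF c] by (simp add: coef_point_exp_XVar)
    next
      case False
      then have "k = n" using k by simp
      moreover have "last c = c ! n" using E_length[OF c]
        by (metis diff_Suc_1 last_conv_nth length_0_conv nat.distinct(1))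
      ultimately show ?thesis by (simp add: coef_point_exp_TVar)
    qed
    then have "coef (toric_exp w) (if k < n then XVar k j else TVar j) = (\<Sum>c\<in>E. coef w c * of_bool (c ! k = j))"
      unfolding coef_toric_exp[OF finite_E w] by simp
    also have "\<dots> = C.cnt (coef w) (\<lambda>c. c ! k = j)"
      unfolding C.cnt_def using finite_E by (simp add: of_bool_def sum.inter_filter if_distrib cong: if_cong)
    finally show ?thesis by simp
  qed
  have total: "C.cnt (coef w) (\<lambda>_. True) = t_degree r (toric_exp w)" if w: "supp w \<subseteq> E" for w
  proof -
    have "t_degree r (toric_exp w) = (\<Sum>c\<in>E. \<Sum>i=1..r. coef w c * coef (point_exp c) (TVar i))"
      unfolding t_degree_def coef_toric_exp[OF finite_E w] by (rule sum.swap)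
    also have "\<dots> = (\<Sum>c\<in>E. coef w c)"
    proof (rule sum.cong[OF refl])
      fix c assume "c \<in> E"
      have "(\<Sum>i=1..r. coef w c * coef (point_exp c) (TVar i)) = coef w c * (\<Sum>i=1..r. of_bool (last c = i))"
        by (simp add: sum_distrib_left coef_point_exp_TVar)
      then show "(\<Sum>i=1..r. coef w c * coef (point_exp c) (TVar i)) = coef w c"
        using E_last[OF \<open>c \<in> E\<close>] by (simp add: of_bool_def)
    qed
    finally show ?thesis by (simp add: C.cnt_def)
  qed
  show "u = v"
  proof (rule poly_mapping_eqI)
    fix c
    show "coef u c = coef v c"
    proof (cases "c \<in> E")
      case True
      show ?thesis
      proof (rule C.standard_unique[OF _ _ _ _ True])
        show "\<not> bad a b" if "coef u a > 0" "coef u b > 0" for a b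
          using std(1) that by (simp add: in_keys_iff)
        show "\<not> bad a b" if "coef v a > 0" "coef v b > 0" for a b
          using std(2) that by (simp add: in_keys_iff)
      qed (use cnt total uv in simp_all)
    next
      case False
      then have "c \<notin> supp u" "c \<notin> supp v" using uv by blast+
      then show ?thesis by (simp add: in_keys_iff)
    qed
  qed
qed

end

section \<open>The special fiber ring\<close>

locale bounded_extended_diagram = extended_diagram +
  fixes m :: nat
  assumes bound: "\<forall>a\<in>D. \<forall>j\<in>set a. j \<le> m"
begin

text \<open>The exponents of the monomials in the multi-Rees algebra: a monomial of \<open>R\<close>
  times a product of generators. The same exponent may have several such decompositions.\<close>

definition rees_exps :: "(xt \<Rightarrow>\<^sub>0 nat) set" where
  "rees_exps = {\<alpha> + \<mu> | \<alpha> \<mu>. supp \<alpha> \<subseteq> x_vars n m \<and> \<mu> \<in> M}"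

text \<open>Here some decomposition has a nontrivial factor from \<open>R\<close>, which
  characterizes the monomials of the ideal that is factored out.\<close>

definition fiber_exps :: "(xt \<Rightarrow>\<^sub>0 nat) set" where
  "fiber_exps = {\<alpha> + \<mu> | \<alpha> \<mu>. supp \<alpha> \<subseteq> x_vars n m \<and> \<alpha> \<noteq> 0 \<and> \<mu> \<in> M}"

lemma rees_exps_0: "0 \<in> rees_exps"
  unfolding rees_exps_def using M_0 by (metis (mono_tags, lifting) add_0 empty_subsetI keys_zero mem_Collect_eq)

lemma rees_exps_add:
  assumes "\<mu> \<in> rees_exps" "\<nu> \<in> rees_exps"
  shows "\<mu> + \<nu> \<in> rees_exps"
proof -
  obtain \<alpha> \<mu>' \<beta> \<nu>' where eq: "\<mu> = \<alpha> + \<mu>'" "supp \<alpha> \<subseteq> x_vars n m" "\<mu>' \<in> M"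
    "\<nu> = \<beta> + \<nu>'" "supp \<beta> \<subseteq> x_vars n m" "\<nu>' \<in> M"
    using assms unfolding rees_exps_def by blast
  have "\<mu> + \<nu> = (\<alpha> + \<beta>) + (\<mu>' + \<nu>')" by (simp add: eq add_ac)
  moreover have "supp (\<alpha> + \<beta>) \<subseteq> x_vars n m" using eq by (simp add: supp_add_nat)
  ultimately show ?thesis unfolding rees_exps_def using M_add eq by blast
qed

lemma fiber_exps_add:
  assumes "\<mu> \<in> rees_exps" "\<nu> \<in> fiber_exps"
  shows "\<mu> + \<nu> \<in> fiber_exps"
proof -
  obtain \<alpha> \<mu>' \<beta> \<nu>' where eq: "\<mu> = \<alpha> + \<mu>'" "supp \<alpha> \<subseteq> x_vars n m" "\<mu>' \<in> M"
    "\<nu> = \<beta> + \<nu>'" "supp \<beta> \<subseteq> x_vars n m" "\<beta> \<noteq> 0" "\<nu>' \<in> M"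
    using assms unfolding rees_exps_def fiber_exps_def by blast
  have "\<mu> + \<nu> = (\<alpha> + \<beta>) + (\<mu>' + \<nu>')" by (simp add: eq add_ac)
  moreover have "supp (\<alpha> + \<beta>) \<subseteq> x_vars n m" using eq by (simp add: supp_add_nat)
  moreover have "\<alpha> + \<beta> \<noteq> 0"
    using eq(6) by (metis keys_eq_empty supp_add_nat Un_empty)
  ultimately show ?thesis unfolding fiber_exps_def using M_add eq by blast
qed

lemma fiber_exps_subset: "fiber_exps \<subseteq> rees_exps"
  unfolding fiber_exps_def rees_exps_def by blast

lemma M_subset: "M \<subseteq> rees_exps"
proof
  fix \<mu> assume "\<mu> \<in> M"
  then show "\<mu> \<in> rees_exps" unfolding rees_exps_def
    by (intro CollectI exI[of _ 0] exI[of _ \<mu>]) simp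
qed

lemma rees_exps_cases: "\<mu> \<in> rees_exps \<Longrightarrow> \<mu> \<in> M \<or> \<mu> \<in> fiber_exps"
  unfolding rees_exps_def fiber_exps_def by fastforce

definition x_degree :: "(xt \<Rightarrow>\<^sub>0 nat) \<Rightarrow> nat" where
  "x_degree \<mu> = (\<Sum>i<n. \<Sum>j=1..m. coef \<mu> (XVar i j))"

lemma x_degree_add: "x_degree (\<mu> + \<nu>) = x_degree \<mu> + x_degree \<nu>"
  by (simp add: x_degree_def lookup_add sum.distrib)

lemma E_entry: "c \<in> E \<Longrightarrow> i < n \<Longrightarrow> c ! i \<in> {1..m}"
proof -
  assume c: "c \<in> E" and i: "i < n"
  then obtain a j where a: "c = a @ [j]" "a \<in> D" by (auto simp: extend_diagram_def)
  have len: "length a = n" by (rule D_length[OF a(2)])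
  then have "c ! i = a ! i" "a ! i \<in> set a" using i by (auto simp: a(1) nth_append)
  moreover have "a \<in> positive_points n" using a(2) ferrers by (auto simp: ferrers_diagram_def)
  then have "0 < a ! i" using i by (simp add: positive_points_def)
  ultimately show ?thesis using bound a(2) by auto
qed

lemma x_degree_toric_exp:
  assumes "supp u \<subseteq> E"
  shows "x_degree (toric_exp u) = n * t_degree r (toric_exp u)"
proof -
  have "x_degree (toric_exp u) = (\<Sum>i<n. \<Sum>c\<in>E. \<Sum>j=1..m. coef u c * coef (point_exp c) (XVar i j))"
    unfolding x_degree_def coef_toric_exp[OF finite_E assms] by (intro sum.cong refl sum.swap)
  also have "\<dots> = (\<Sum>c\<in>E. \<Sum>i<n. \<Sum>j=1..m. coef u c * coef (point_exp c) (XVar i j))"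
    by (rule sum.swap)
  also have "\<dots> = (\<Sum>c\<in>E. coef u c * x_degree (point_exp c))"
    by (simp add: x_degree_def sum_distrib_left)
  also have "\<dots> = (\<Sum>c\<in>E. coef u c * (n * t_degree r (point_exp c)))"
  proof (rule sum.cong[OF refl])
    fix c assume c: "c \<in> E"
    have "x_degree (point_exp c) = (\<Sum>i<n. \<Sum>j=1..m. of_bool (c ! i = j))"
      unfolding x_degree_def coef_point_exp_XVar using E_length[OF c] by (intro sum.cong) auto
    also have "\<dots> = (\<Sum>i<n. 1)"
    proof (rule sum.cong[OF refl])
      fix i assume "i \<in> {..<n}"
      then have "c ! i \<in> {1..m}" using E_entry[OF c] by simp
      then show "(\<Sum>j=1..m. of_bool (c ! i = j)) = (1::nat)" by (simp add: of_bool_def)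
    qed
    finally have "x_degree (point_exp c) = n" by simp
    moreover have "t_degree r (point_exp c) = 1"
      using \<delta>_var[OF c] by (simp only: toric_exp_single)
    ultimately show "coef u c * x_degree (point_exp c) = coef u c * (n * t_degree r (point_exp c))" by simp
  qed
  also have "\<dots> = n * t_degree r (toric_exp u)"
  proof -
    have "t_degree r (toric_exp u) = (\<Sum>c\<in>E. \<Sum>i=1..r. coef u c * coef (point_exp c) (TVar i))"
      unfolding t_degree_def coef_toric_exp[OF finite_E assms] by (rule sum.swap)
    then show ?thesis by (simp add: t_degree_def sum_distrib_left mult_ac)
  qed
  finally show ?thesis .
qed

text \<open>A nontrivial factor from \<open>R\<close> raises the x-degree and leaves the t-degree
  unchanged. This breaks the proportion \<open>x_degree_toric_exp\<close> that holds on
  \<open>M\<close>.\<close>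

lemma fiber_exps_disjoint: "fiber_exps \<inter> M = {}"
proof -
  have False if h: "\<alpha> + \<mu> \<in> M" "supp \<alpha> \<subseteq> x_vars n m" "\<alpha> \<noteq> 0" "\<mu> \<in> M" for \<alpha> \<mu>
  proof -
    have "x_degree (\<alpha> + \<mu>) = n * t_degree r (\<alpha> + \<mu>)" "x_degree \<mu> = n * t_degree r \<mu>"
      using that x_degree_toric_exp unfolding M_def by auto
    moreover have "coef \<alpha> (TVar i) = 0" for i
      using that(2) by (auto simp: in_keys_iff x_vars_def)
    then have "t_degree r \<alpha> = 0" by (simp add: t_degree_def)
    ultimately have x0: "x_degree \<alpha> = 0" by (simp add: x_degree_add \<delta>_add)
    obtain x where x: "x \<in> supp \<alpha>" using h(3) by (metis keys_eq_empty ex_in_conv)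
    then obtain i j where ij: "x = XVar i j" "i < n" "j \<in> {1..m}" using h(2) by (auto simp: x_vars_def)
    have "coef \<alpha> (XVar i j) = 0" using x0 ij(2,3) by (simp add: x_degree_def)
    then show False using x ij(1) by (simp add: in_keys_iff)
  qed
  then show ?thesis unfolding fiber_exps_def by blast
qed

abbreviation I :: "(xt, 'k::field) mpoly set" where "I \<equiv> ferrers_ideal n m D"

section \<open>The multi-Rees algebra and its fiber ideal as spans of monomials\<close>

lemma point_exp_append: "single (point_exp (a @ [i])) (1::'k::field) = x_monomial a * mvar (TVar i)"
  using fiber_monomial_eq[of "a @ [i]", where ?'k = 'k] by (simp add: fiber_monomial_def)

lemma carrier_multi_rees: "carrier (multi_rees n m r (I :: (xt, 'k::field) mpoly set)) = {f. supp f \<subseteq> rees_exps}"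
proof -
  define S :: "(xt, 'k) mpoly ring" where "S = mpoly_ring (x_vars n m \<union> t_vars r)"
  define G :: "(xt, 'k) mpoly set" where "G = carrier (mpoly_ring (x_vars n m)) \<union>
    {x_monomial a * mvar (TVar i) | a i. a \<in> D \<and> i \<in> {1..r}}"
  define C where "C = generate_ring S G"
  have D: "D \<subseteq> positive_points n" using ferrers by (simp add: ferrers_diagram_def)
  have C: "carrier (multi_rees n m r (I :: (xt, 'k) mpoly set)) = C"
    unfolding multi_rees_ferrers[OF D bound] C_def S_def G_def ..
  interpret S: cring S unfolding S_def by (rule cring_mpoly_ring)
  have Sinv: "\<ominus>\<^bsub>S\<^esub> f = - f" if "f \<in> carrier S" for f
    using that S.abelian_group_axioms unfolding S_def
    by (intro abelian_group_inv_type_algebra) (simp_all add: mpoly_ring_closed)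
  have G: "G \<subseteq> carrier S"
  proof -
    have "carrier (mpoly_ring (x_vars n m)) \<subseteq> carrier S" unfolding S_def by (rule mpoly_ring_mono) simp
    moreover have "x_monomial a * mvar (TVar i) \<in> carrier S" if "a \<in> D" "i \<in> {1..r}" for a i
    proof -
      have "x_monomial a \<in> carrier (mpoly_ring (x_vars n m) :: (xt, 'k) mpoly ring)"
        using that D bound by (intro x_monomial_in_mpoly_ring) auto
      moreover have "mvar (TVar i) \<in> carrier S"
        unfolding S_def by (rule mvar_in_mpoly_ring) (use that in \<open>simp add: t_vars_def\<close>)
      ultimately show ?thesis using \<open>carrier (mpoly_ring (x_vars n m)) \<subseteq> carrier S\<close>
        unfolding S_def by (blast intro: mpoly_ring_closed)
    qed
    ultimately show ?thesis unfolding G_def by blast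
  qed
  have "supp f \<subseteq> rees_exps" if "f \<in> C" for f
    using that unfolding C_def
  proof (induction rule: generate_ring.induct)
    case one
    then show ?case using rees_exps_0 by (simp add: S_def)
  next
    case (incl f)
    then consider "f \<in> carrier (mpoly_ring (x_vars n m))" |
      a i where "f = x_monomial a * mvar (TVar i)" "a \<in> D" "i \<in> {1..r}"
      unfolding G_def by blast
    then show ?case
    proof cases
      case 1
      show ?thesis
      proof
        fix \<mu> assume "\<mu> \<in> supp f"
        then have "supp \<mu> \<subseteq> x_vars n m" using 1 by (simp add: carrier_mpoly_ring)
        then show "\<mu> \<in> rees_exps" unfolding rees_exps_def using M_0
          by (intro CollectI exI[of _ \<mu>] exI[of _ 0]) simp
      qed
    next
      case 2
      have "a @ [i] \<in> E" using 2 by (auto simp: extend_diagram_def)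
      then have "point_exp (a @ [i]) \<in> M" using \<theta>_M[of "single (a @ [i]) 1"] by (simp only: toric_exp_single) simp
      then show ?thesis using M_subset by (auto simp: 2(1) simp flip: point_exp_append)
    qed
  next
    case (a_inv f)
    then show ?case using Sinv S.generate_ring_in_carrier[OF G] by (simp add: subset_iff in_keys_iff)
  next
    case (eng_add f g)
    then show ?case using keys_add[of f g] by (auto simp: S_def)
  next
    case (eng_mult f g)
    then show ?case using keys_mult[of f g] rees_exps_add by (fastforce simp: S_def)
  qed
  moreover have "f \<in> C" if f: "supp f \<subseteq> rees_exps" for f
  proof -
    \<comment> \<open>The generators of the toric ring occur among those of the multi-Rees algebra,
      so \<open>toric_ring_generated\<close> places the whole toric ring inside it; a factor from
      \<open>R\<close> then gives every exponent of \<open>rees_exps\<close>.\<close>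
    have toric: "g \<in> C" if "g \<in> B" for g
      using that unfolding toric_ring_generated[symmetric] C_def
    proof (induction rule: generate_ring.induct)
      case one
      then show ?case using generate_ring.one[of S G] by (simp add: S_def)
    next
      case (incl h)
      then consider c where "h = mconst c" | e where "e \<in> E" "h = single (toric_exp (single e 1)) 1"
        unfolding toric_vars_def by blast
      then show ?case
      proof cases
        case 1
        then show ?thesis using const_in_mpoly_ring(3) by (intro generate_ring.incl) (auto simp: G_def)
      next
        case 2
        then obtain a i where "e = a @ [i]" "a \<in> D" "i \<in> {1..r}" by (auto simp: extend_diagram_def)
        then have "h \<in> G" unfolding G_def using 2(2) by (simp only: toric_exp_single point_exp_append) blast
        then show ?thesis by (rule generate_ring.incl)
      qed
    next
      case (a_inv h)
      have "h \<in> B" using a_inv(1) toric_ring_generated by blast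
      then show ?case
        using generate_ring.a_inv[OF a_inv(2)] Sinv S.generate_ring_in_carrier[OF G a_inv(2)]
        by (simp add: toric_ring_inv)
    next
      case (eng_add h1 h2)
      then show ?case using generate_ring.eng_add[OF eng_add(3,4)] by (simp add: S_def)
    next
      case (eng_mult h1 h2)
      then show ?case using generate_ring.eng_mult[OF eng_mult(3,4)] by (simp add: S_def)
    qed
    have "single \<mu> (coef f \<mu>) \<in> C" if \<mu>f: "\<mu> \<in> supp f" for \<mu>
    proof -
      obtain \<alpha> \<nu> where \<mu>: "\<mu> = \<alpha> + \<nu>" "supp \<alpha> \<subseteq> x_vars n m" "\<nu> \<in> M"
        using f \<mu>f unfolding rees_exps_def by blast
      have "single \<alpha> 1 \<in> C"
        unfolding C_def by (rule generate_ring.incl) (use \<mu>(2) in \<open>simp add: G_def carrier_mpoly_ring\<close>)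
      then have "single \<alpha> 1 \<otimes>\<^bsub>S\<^esub> single \<nu> (coef f \<mu>) \<in> C"
        using toric[OF B_single[OF \<mu>(3)]] unfolding C_def by (intro generate_ring.eng_mult)
      then show ?thesis by (simp add: S_def mult_single \<mu>(1))
    qed
    moreover have "additive_subgroup C S"
      unfolding C_def using subring.axioms(1)[OF S.generate_ring_is_subring[OF G]]
      by (rule additive_subgroupI)
    ultimately have "(\<Sum>\<mu>\<in>supp f. single \<mu> (coef f \<mu>)) \<in> C"
      by (intro additive_subgroup_sum_closed[of C S]) (simp_all add: S_def)
    then show ?thesis by (simp add: poly_decomp)
  qed
  ultimately show ?thesis unfolding C by blast
qed

lemma multi_rees_eq: "multi_rees n m r (I :: (xt, 'k::field) mpoly set) = monomial_ring rees_exps"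
proof -
  have "multi_rees n m r (I :: (xt, 'k) mpoly set) =
      monomial_ring UNIV \<lparr>carrier := carrier (multi_rees n m r (I :: (xt, 'k) mpoly set))\<rparr>"
    by (simp add: multi_rees_def Let_def monomial_ring_def mpoly_ring_def)
  then show ?thesis by (simp add: carrier_multi_rees) (simp add: monomial_ring_def)
qed

lemma fiber_ideal_eq:
  "fiber_ideal n m r (I :: (xt, 'k::field) mpoly set) = {f. supp f \<subseteq> fiber_exps}" (is "_ = ?F")
proof -
  define A :: "(xt, 'k) mpoly ring" where "A = monomial_ring rees_exps"
  interpret A: cring A unfolding A_def using rees_exps_0 rees_exps_add by (rule cring_monomial_ring)
  have xe: "single x 1 \<in> fiber_exps" if "x \<in> x_vars n m" for x
    unfolding fiber_exps_def using that M_0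
    by (intro CollectI exI[of _ "single x 1"] exI[of _ 0]) (auto simp flip: keys_eq_empty)
  have xF: "mvar ` x_vars n m \<subseteq> ?F" using xe by (auto simp: mvar_def)
  then have xA: "mvar ` x_vars n m \<subseteq> carrier A" using fiber_exps_subset by (auto simp: A_def)
  have "ideal ?F A"
  proof (rule idealI)
    show "ring A" ..
    show "subgroup ?F (add_monoid A)"
    proof (rule A.add.subgroupI)
      show "?F \<subseteq> carrier A" using fiber_exps_subset by (auto simp: A_def)
      show "?F \<noteq> {}" by (auto intro: exI[of _ 0])
      fix f assume f: "f \<in> ?F"
      then have "\<ominus>\<^bsub>A\<^esub> f = - f"
        unfolding A_def using rees_exps_0 rees_exps_add fiber_exps_subset by (intro monomial_ring_inv) auto
      then show "\<ominus>\<^bsub>A\<^esub> f \<in> ?F" using f by (simp add: subset_iff in_keys_iff)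
    next
      fix f g assume "f \<in> ?F" "g \<in> ?F"
      then show "f \<oplus>\<^bsub>A\<^esub> g \<in> ?F" using keys_add[of f g] by (auto simp: A_def)
    qed
    fix f g assume fg: "f \<in> ?F" "g \<in> carrier A"
    have "g * f \<in> ?F" using fg keys_mult[of g f] fiber_exps_add by (fastforce simp: A_def)
    then show "g \<otimes>\<^bsub>A\<^esub> f \<in> ?F" "f \<otimes>\<^bsub>A\<^esub> g \<in> ?F" by (simp_all add: A_def mult.commute)
  qed
  then have "Idl\<^bsub>A\<^esub> (mvar ` x_vars n m) \<subseteq> ?F" using xF by (rule A.genideal_minimal)
  moreover have "f \<in> Idl\<^bsub>A\<^esub> (mvar ` x_vars n m)" if f: "f \<in> ?F" for f
  proof -
    have id: "ideal (Idl\<^bsub>A\<^esub> (mvar ` x_vars n m)) A" by (rule A.genideal_ideal[OF xA])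
    have "single \<mu> (coef f \<mu>) \<in> Idl\<^bsub>A\<^esub> (mvar ` x_vars n m)" if \<mu>f: "\<mu> \<in> supp f" for \<mu>
    proof -
      obtain \<alpha> \<nu> where \<mu>: "\<mu> = \<alpha> + \<nu>" "supp \<alpha> \<subseteq> x_vars n m" "\<alpha> \<noteq> 0" "\<nu> \<in> M"
        using f \<mu>f unfolding fiber_exps_def by blast
      obtain x where x: "x \<in> supp \<alpha>" using \<mu>(3) by (metis keys_eq_empty ex_in_conv)
      \<comment> \<open>One x-variable is split off as a generator of the ideal; the remaining
        factor is still a monomial of the multi-Rees algebra.\<close>
      define \<beta> where "\<beta> = \<alpha> - single x 1"
      have \<alpha>: "\<alpha> = single x 1 + \<beta>"
        unfolding \<beta>_def using x by (intro single_add_minus[symmetric]) (simp add: in_keys_iff)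
      have "supp \<beta> \<subseteq> x_vars n m" unfolding \<beta>_def by (rule order.trans[OF supp_minus_nat \<mu>(2)])
      then have "\<beta> + \<nu> \<in> rees_exps" unfolding rees_exps_def using \<mu>(4) by blast
      then have "single (\<beta> + \<nu>) (coef f \<mu>) \<in> carrier A" by (simp add: A_def)
      moreover have "mvar x \<in> Idl\<^bsub>A\<^esub> (mvar ` x_vars n m)"
        using A.genideal_self[OF xA] x \<mu>(2) by blast
      ultimately have "mvar x \<otimes>\<^bsub>A\<^esub> single (\<beta> + \<nu>) (coef f \<mu>) \<in> Idl\<^bsub>A\<^esub> (mvar ` x_vars n m)"
        using ideal.I_r_closed[OF id] by blast
      then show ?thesis by (simp add: A_def mvar_def mult_single \<mu>(1) \<alpha> add.assoc)
    qed
    then have "(\<Sum>\<mu>\<in>supp f. single \<mu> (coef f \<mu>)) \<in> Idl\<^bsub>A\<^esub> (mvar ` x_vars n m)"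
      by (intro additive_subgroup_sum_closed[OF ideal.axioms(1)[OF id]]) (simp_all add: A_def)
    then show ?thesis by (simp add: poly_decomp)
  qed
  ultimately show ?thesis unfolding fiber_ideal_def multi_rees_eq A_def by blast
qed

text \<open>The exponents in \<open>rees_exps\<close> are the disjoint union of \<open>M\<close> and
  \<open>fiber_exps\<close>, so the multi-Rees algebra is the direct sum of the toric ring and the
  fiber ideal. Hence the quotient map restricts to an isomorphism from the toric ring, along which
  the Koszul property is transported.\<close>

theorem koszul_special_fiber:
  "koszul (special_fiber n m r I) (special_fiber_scalar n m r (I :: (xt, 'k::field) mpoly set))
     (special_fiber_component n m r I)"
proof -
  define A :: "(xt, 'k) mpoly ring" where "A = multi_rees n m r I"
  define F :: "(xt, 'k) mpoly set" where "F = fiber_ideal n m r I"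
  have A_eq: "A = monomial_ring rees_exps" by (simp add: A_def multi_rees_eq)
  have F_eq: "F = {f. supp f \<subseteq> fiber_exps}" by (simp add: F_def fiber_ideal_eq)
  interpret A: cring A unfolding A_eq using rees_exps_0 rees_exps_add by (rule cring_monomial_ring)
  interpret T: cring "toric_ring :: (xt, 'k) mpoly ring" by (rule cring_toric_ring)
  have "mvar ` x_vars n m \<subseteq> carrier A"
  proof -
    have "single x 1 \<in> rees_exps" if "x \<in> x_vars n m" for x
      unfolding rees_exps_def using that M_0
      by (intro CollectI exI[of _ "single x 1"] exI[of _ 0]) simp
    then show ?thesis by (auto simp: A_eq mvar_def)
  qed
  then have idF: "ideal F A"
    unfolding F_def fiber_ideal_def A_def[symmetric] by (rule A.genideal_ideal)
  interpret F: ideal F A by (rule idF)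
  define h where "h f = F +>\<^bsub>A\<^esub> f" for f
  have BA: "f \<in> carrier A" if "f \<in> B" for f
    using that M_subset by (auto simp: A_eq B_def)
  have hom: "h \<in> ring_hom A (A Quot F)"
    unfolding h_def[abs_def] by (rule F.rcos_ring_hom)
  have hT: "h \<in> ring_hom (toric_ring :: (xt, 'k) mpoly ring) (A Quot F)"
  proof (rule ring_hom_memI)
    show "h (f \<otimes>\<^bsub>toric_ring\<^esub> g) = h f \<otimes>\<^bsub>A Quot F\<^esub> h g"
      if "f \<in> carrier toric_ring" "g \<in> carrier toric_ring" for f g
      using ring_hom_mult[OF hom BA BA, of f g] that by (simp add: A_eq)
    show "h (f \<oplus>\<^bsub>toric_ring\<^esub> g) = h f \<oplus>\<^bsub>A Quot F\<^esub> h g"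
      if "f \<in> carrier toric_ring" "g \<in> carrier toric_ring" for f g
      using ring_hom_add[OF hom BA BA, of f g] that by (simp add: A_eq)
    show "h \<one>\<^bsub>toric_ring\<^esub> = \<one>\<^bsub>A Quot F\<^esub>" using ring_hom_one[OF hom] by (simp add: A_eq)
    show "h f \<in> carrier (A Quot F)" if "f \<in> carrier toric_ring" for f
      using ring_hom_closed[OF hom BA, of f] that by simp
  qed
  have cringQ: "cring (A Quot F)" by (rule F.quotient_is_cring) (rule A.cring_axioms)
  interpret H: ring_hom_cring "toric_ring :: (xt, 'k) mpoly ring" "A Quot F" h
    by (intro ring_hom_cring.intro ring_hom_cring_axioms.intro cringQ hT T.cring_axioms)
  have h_restrict: "h f = h (restrict_supp M f)" and restrict_B: "restrict_supp M f \<in> B" if f: "f \<in> carrier A" for f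
  proof -
    show rB: "restrict_supp M f \<in> B" by (simp add: B_def supp_restrict_supp)
    have "f = restrict_supp M f + restrict_supp fiber_exps f"
    proof (rule poly_mapping_eqI)
      fix \<mu> show "coef f \<mu> = coef (restrict_supp M f + restrict_supp fiber_exps f) \<mu>"
        using f rees_exps_cases[of \<mu>] fiber_exps_disjoint
        by (auto simp: lookup_add coef_restrict_supp A_eq subset_iff in_keys_iff)
    qed
    moreover have "restrict_supp fiber_exps f \<in> F" by (simp add: F_eq supp_restrict_supp)
    then have "h (restrict_supp fiber_exps f) = \<zero>\<^bsub>A Quot F\<^esub>"
      unfolding h_def using rcos_eq_zero_iff[OF A.ring_axioms idF F.Icarr] by blast
    moreover have "h (restrict_supp M f + restrict_supp fiber_exps f) = h (restrict_supp M f) \<oplus>\<^bsub>A Quot F\<^esub> h (restrict_supp fiber_exps f)"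
      using ring_hom_add[OF hom BA[OF rB] F.Icarr[OF \<open>restrict_supp fiber_exps f \<in> F\<close>]] by (simp add: A_eq)
    ultimately show "h f = h (restrict_supp M f)" using H.hom_closed[of "restrict_supp M f"] rB by simp
  qed
  have "inj_on h (carrier toric_ring)"
  proof (rule inj_onI)
    fix f g assume fg: "f \<in> carrier (toric_ring :: (xt, 'k) mpoly ring)" "g \<in> carrier toric_ring" "h f = h g"
    have "h (f - g) = h (f \<oplus>\<^bsub>toric_ring\<^esub> \<ominus>\<^bsub>toric_ring\<^esub> g)"
      using fg(2) by (simp add: toric_ring_inv)
    also have "\<dots> = h f \<oplus>\<^bsub>A Quot F\<^esub> h (\<ominus>\<^bsub>toric_ring\<^esub> g)"
      by (rule H.hom_add[OF fg(1) T.a_inv_closed[OF fg(2)]])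
    also have "\<dots> = h g \<oplus>\<^bsub>A Quot F\<^esub> \<ominus>\<^bsub>A Quot F\<^esub> h g"
      by (simp only: H.hom_a_inv[OF fg(2)] fg(3))
    also have "\<dots> = \<zero>\<^bsub>A Quot F\<^esub>" by (rule H.S.r_neg[OF H.hom_closed[OF fg(2)]])
    finally have "h (f - g) = \<zero>\<^bsub>A Quot F\<^esub>" .
    moreover have fgB: "f - g \<in> B" using fg by (simp add: B_diff)
    ultimately have "f - g \<in> F"
      unfolding h_def using rcos_eq_zero_iff[OF A.ring_axioms idF BA] by blast
    then have "supp (f - g) \<subseteq> fiber_exps \<inter> M" using fgB by (simp add: F_eq B_def)
    then show "f = g" by (simp add: fiber_exps_disjoint)
  qed
  moreover have "h ` carrier toric_ring = carrier (A Quot F)"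
  proof
    show "h ` carrier toric_ring \<subseteq> carrier (A Quot F)" using H.hom_closed by blast
    show "carrier (A Quot F) \<subseteq> h ` carrier toric_ring"
    proof
      fix y assume "y \<in> carrier (A Quot F)"
      then obtain f where "f \<in> carrier A" "y = h f"
        unfolding FactRing_simps h_def by auto
      then show "y \<in> h ` carrier toric_ring" using h_restrict restrict_B by auto
    qed
  qed
  ultimately have "bij_betw h (carrier toric_ring) (carrier (A Quot F))" by (simp add: bij_betw_def)
  then interpret H: ring_iso_cring "toric_ring :: (xt, 'k) mpoly ring" "A Quot F" h
    by unfold_locales
  have "koszul (A Quot F) (special_fiber_scalar n m r I) (special_fiber_component n m r (I :: (xt, 'k) mpoly set))"
  proof (rule H.image_koszul[OF koszul_toric_ring])
    show "special_fiber_scalar n m r (I :: (xt, 'k) mpoly set) = h \<circ> mconst"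
      by (simp add: fun_eq_iff special_fiber_scalar_def h_def A_def F_def)
    fix d
    have comp: "special_fiber_component n m r (I :: (xt, 'k) mpoly set) d =
        {h f | f. f \<in> carrier A \<and> (\<forall>\<mu>\<in>supp f. t_degree r \<mu> = d)}"
      by (simp add: special_fiber_component_def h_def A_def F_def t_degree_def)
    show "special_fiber_component n m r (I :: (xt, 'k) mpoly set) d = h ` piece d"
    proof
      show "special_fiber_component n m r (I :: (xt, 'k) mpoly set) d \<subseteq> h ` piece d"
        unfolding comp
      proof clarify
        fix f assume f: "f \<in> carrier A" "\<forall>\<mu>\<in>supp f. t_degree r \<mu> = d"
        \<comment> \<open>The representative in the toric ring keeps only some monomials of
          \<open>f\<close>, hence its t-degree, and lies in the same coset. So the two gradings
          agree.\<close>
        have "restrict_supp M f \<in> piece d" using f(2) by (auto simp: piece_def supp_restrict_supp)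
        then show "h f \<in> h ` piece d" using h_restrict[OF f(1)] by simp
      qed
      show "h ` piece d \<subseteq> special_fiber_component n m r (I :: (xt, 'k) mpoly set) d"
        unfolding comp
      proof (rule image_subsetI)
        fix f :: "(xt, 'k) mpoly" assume f: "f \<in> piece d"
        then show "h f \<in> {h f | f. f \<in> carrier A \<and> (\<forall>\<mu>\<in>supp f. t_degree r \<mu> = d)}"
          using BA[OF piece_B[OF f]] by (auto simp: piece_def)
      qed
    qed
  qed
  then show ?thesis by (simp add: special_fiber_def A_def F_def)
qed

end

section \<open>The Groebner basis\<close>

definition toric_map :: "(nat list, 'k::field) mpoly \<Rightarrow> (xt, 'k) mpoly" where
  "toric_map f = (\<Sum>u\<in>supp f. single (toric_exp u) (coef f u))"

lemma msubst_fiber_monomial: "msubst fiber_monomial f = toric_map (f :: (nat list, 'k::field) mpoly)"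
proof -
  have "(\<Prod>c\<in>supp u. fiber_monomial c ^ coef u c) = single (toric_exp u) (1::'k)" for u
    by (simp add: fiber_monomial_eq power_single prod_single toric_exp_def)
  then show ?thesis by (simp add: msubst_def toric_map_def mconst_def mult_single)
qed

lemma toric_map_superset:
  assumes "finite A" "supp f \<subseteq> A"
  shows "toric_map f = (\<Sum>u\<in>A. single (toric_exp u) (coef f u))"
  unfolding toric_map_def by (rule sum.mono_neutral_left[OF assms]) (auto simp: in_keys_iff)

lemma toric_map_single: "toric_map (single u a) = single (toric_exp u) a"
  using toric_map_superset[of "{u}" "single u a"] by simp

lemma toric_map_0: "toric_map 0 = 0" by (simp add: toric_map_def)

lemma toric_map_add: "toric_map (f + g) = toric_map f + toric_map g"
  using toric_map_superset[of "supp f \<union> supp g" f] toric_map_superset[of "supp f \<union> supp g" g]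
    toric_map_superset[of "supp f \<union> supp g" "f + g"] keys_add[of f g]
  by (simp add: lookup_add single_add sum.distrib)

lemma toric_map_uminus: "toric_map (- f) = - toric_map f"
  using toric_map_add[of f "- f"] by (simp add: toric_map_0 add_eq_0_iff)

lemma toric_map_sum: "toric_map (sum f A) = (\<Sum>i\<in>A. toric_map (f i))"
  by (induction A rule: infinite_finite_induct) (simp_all add: toric_map_0 toric_map_add)

lemma toric_map_mult: "toric_map (f * g) = toric_map f * toric_map g"
proof -
  have "f * g = (\<Sum>u\<in>supp f. \<Sum>v\<in>supp g. single (u + v) (coef f u * coef g v))"
    by (subst (1 2) poly_decomp[symmetric]) (simp add: sum_product mult_single)
  then have "toric_map (f * g) = (\<Sum>u\<in>supp f. \<Sum>v\<in>supp g. single (toric_exp (u + v)) (coef f u * coef g v))"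
    by (simp add: toric_map_sum toric_map_single)
  then show ?thesis by (simp add: toric_map_def sum_product mult_single toric_exp_add)
qed

lemma coef_toric_map: "coef (toric_map f) \<mu> = (\<Sum>u\<in>{u \<in> supp f. toric_exp u = \<mu>}. coef f u)"
proof -
  have "coef (toric_map f) \<mu> = (\<Sum>u\<in>supp f. if toric_exp u = \<mu> then coef f u else 0)"
    unfolding toric_map_def lookup_sum by (rule sum.cong) (auto simp: lookup_single when_def)
  then show ?thesis by (simp add: sum.inter_filter)
qed

section \<open>The order sigma as the order on exponent vectors\<close>

lemma sigma_gt_iff: "sigma_gt a b \<longleftrightarrow> length a = length b \<and> a < b"
  unfolding sigma_gt_def using list_less_iff_nth by blast

text \<open>\<open>sigma_gt\<close> only relates lists of equal length, whereas \<open><\<close> on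
  exponents looks at all lists. The two agree because lists of any other length have exponent 0 in
  both monomials.\<close>

lemma sigma_lex_iff:
  assumes "\<And>c. c \<in> supp u \<union> supp v \<Longrightarrow> length c = N"
  shows "sigma_lex u v \<longleftrightarrow> v < u"
proof -
  have "(\<forall>d. sigma_gt d c \<longrightarrow> coef u d = coef v d) \<longleftrightarrow> (\<forall>d<c. coef v d = coef u d)"
    if "coef v c < coef u c" for c
  proof -
    have c: "length c = N" using assms[of c] that by (simp add: in_keys_iff)
    have "coef u d = coef v d" if "length d \<noteq> N" for d
      using assms[of d] that by (metis UnCI not_in_keys_iff_lookup_eq_zero)
    then show ?thesis unfolding sigma_gt_iff c by metis
  qed
  then show ?thesis
    unfolding sigma_lex_def less_poly_mapping.rep_eq less_fun_def by blast
qed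

lemma initial_eq:
  fixes f :: "(nat list, 'k::field) mpoly"
  assumes "f \<noteq> 0" "\<And>u c. u \<in> supp f \<Longrightarrow> c \<in> supp u \<Longrightarrow> length c = N"
  shows "initial sigma_lex f = single (Max (supp f)) 1"
proof -
  have ne: "supp f \<noteq> {}" using assms(1) by simp
  have lex: "sigma_lex u v \<longleftrightarrow> v < u" if "u \<in> supp f" "v \<in> supp f" for u v
    using assms(2) that by (intro sigma_lex_iff[of u v N]) blast
  have "(THE u. u \<in> supp f \<and> (\<forall>v\<in>supp f. v \<noteq> u \<longrightarrow> sigma_lex u v)) = Max (supp f)"
  proof (rule the_equality)
    show "Max (supp f) \<in> supp f \<and> (\<forall>v\<in>supp f. v \<noteq> Max (supp f) \<longrightarrow> sigma_lex (Max (supp f)) v)"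
      using lex Max_in[OF finite_keys ne] Max_ge[OF finite_keys, of _ f]
      by (auto simp: order.strict_iff_order)
    fix u assume u: "u \<in> supp f \<and> (\<forall>v\<in>supp f. v \<noteq> u \<longrightarrow> sigma_lex u v)"
    show "u = Max (supp f)"
      by (rule Max_eqI[symmetric]) (use u lex in \<open>auto simp: order.order_iff_strict\<close>)
  qed
  then show ?thesis by (simp add: initial_def)
qed

section \<open>The presentation ideal and its leading monomials\<close>

context extended_diagram
begin

abbreviation K :: "(nat list, 'k::field) mpoly set" where "K \<equiv> presentation_ideal D r"

lemma presentation_ideal_eq:
  "K = {f :: (nat list, 'k::field) mpoly. (\<forall>u\<in>supp f. supp u \<subseteq> E) \<and> toric_map f = 0}"
proof -
  have "\<zero>\<^bsub>fiber_monomial_algebra D r\<^esub> = (0 :: (xt, 'k) mpoly)"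
    by (simp add: fiber_monomial_algebra_def ring_of_type_algebra_def)
  then show ?thesis
    by (auto simp: presentation_ideal_def a_kernel_def' carrier_mpoly_ring msubst_fiber_monomial)
qed

lemma ideal_K: "ideal K (mpoly_ring E :: (nat list, 'k::field) mpoly ring)"
proof -
  interpret cring "mpoly_ring E :: (nat list, 'k) mpoly ring" by (rule cring_mpoly_ring)
  have K: "f \<in> K \<longleftrightarrow> f \<in> carrier (mpoly_ring E) \<and> toric_map f = 0" for f :: "(nat list, 'k) mpoly"
    by (simp add: presentation_ideal_eq carrier_mpoly_ring)
  show ?thesis
  proof (rule idealI)
    show "ring (mpoly_ring E :: (nat list, 'k) mpoly ring)" ..
    show "subgroup K (add_monoid (mpoly_ring E :: (nat list, 'k) mpoly ring))"
    proof (rule add.subgroupI)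
      show "K \<noteq> ({} :: (nat list, 'k) mpoly set)"
        using K[of 0] const_in_mpoly_ring(1) toric_map_0 by blast
      fix f :: "(nat list, 'k) mpoly" assume f: "f \<in> K"
      then have "\<ominus>\<^bsub>mpoly_ring E\<^esub> f = - f"
        using K abelian_group_axioms by (intro abelian_group_inv_type_algebra) (auto intro: mpoly_ring_closed)
      then show "\<ominus>\<^bsub>mpoly_ring E\<^esub> f \<in> K" using f K mpoly_ring_closed(2)[of f E f] by (simp add: toric_map_uminus)
    qed (use K in \<open>auto simp: toric_map_add intro: mpoly_ring_closed\<close>)
    fix f g :: "(nat list, 'k) mpoly" assume "f \<in> K" "g \<in> carrier (mpoly_ring E)"
    then show "g \<otimes>\<^bsub>mpoly_ring E\<^esub> f \<in> K" "f \<otimes>\<^bsub>mpoly_ring E\<^esub> g \<in> K"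
      using K by (simp_all add: toric_map_mult mpoly_ring_closed)
  qed
qed

lemma exchange_binomials_subset:
  "exchange_binomials (Suc n) E \<subseteq> (K :: (nat list, 'k::field) mpoly set)"
proof
  fix g :: "(nat list, 'k) mpoly" assume "g \<in> exchange_binomials (Suc n) E"
  then obtain H a b where g: "g = exchange_binomial (Suc n) E H a b" "a \<in> E" "b \<in> E"
    unfolding exchange_binomials_def by blast
  define p q where "p = exchange (Suc n) H a b" and "q = exchange (Suc n) H b a"
  show "g \<in> K"
  proof (cases "p \<in> E \<and> q \<in> E")
    case True
    have c: "mvar a * mvar b \<in> carrier (mpoly_ring E :: (nat list, 'k) mpoly ring)"
      "mvar p * mvar q \<in> carrier (mpoly_ring E :: (nat list, 'k) mpoly ring)"
      using True g(2,3) by (auto intro!: mpoly_ring_closed(3) mvar_in_mpoly_ring)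
    have "g = mvar a * mvar b + - (mvar p * mvar q)"
      using True by (simp add: g(1) exchange_binomial_def p_def q_def)
    moreover have "mvar a * mvar b + - (mvar p * mvar q) \<in> carrier (mpoly_ring E :: (nat list, 'k) mpoly ring)"
      by (rule mpoly_ring_closed(1)[OF c(1) mpoly_ring_closed(2)[OF c(2) c(2)]])
    moreover have "point_exp a + point_exp b = point_exp p + point_exp q"
      using g E_length by (intro point_exp_exchange[of _ n _ _ H]) (auto simp: p_def q_def)
    then have "toric_map (mvar a * mvar b + - (mvar p * mvar q)) = (0 :: (xt, 'k) mpoly)"
      by (simp only: toric_map_add toric_map_uminus toric_map_mult mvar_def toric_map_single toric_exp_add toric_exp_single mult_single) simp
    ultimately show ?thesis by (simp add: presentation_ideal_eq carrier_mpoly_ring)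
  next
    case False
    then have "g = 0" by (auto simp: g(1) exchange_binomial_def Let_def p_def q_def)
    then show ?thesis by (simp add: presentation_ideal_eq toric_map_0)
  qed
qed

lemma finite_exchange_binomials: "finite (exchange_binomials (Suc n) E :: (nat list, 'k::field) mpoly set)"
proof (rule finite_subset)
  show "exchange_binomials (Suc n) E \<subseteq>
      (\<lambda>(H, a, b). exchange_binomial (Suc n) E H a b :: (nat list, 'k) mpoly) ` (Pow {..<Suc n} \<times> E \<times> E)"
  proof
    fix g :: "(nat list, 'k) mpoly" assume "g \<in> exchange_binomials (Suc n) E"
    then obtain H a b where "g = exchange_binomial (Suc n) E H a b" "H \<subseteq> {..<Suc n}" "a \<in> E" "b \<in> E"
      unfolding exchange_binomials_def by blast
    then show "g \<in> (\<lambda>(H, a, b). exchange_binomial (Suc n) E H a b) ` (Pow {..<Suc n} \<times> E \<times> E)"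
      by (intro image_eqI[of _ _ "(H, a, b)"]) simp_all
  qed
  show "finite ((\<lambda>(H, a, b). exchange_binomial (Suc n) E H a b :: (nat list, 'k) mpoly) ` (Pow {..<Suc n} \<times> E \<times> E))"
    using finite_E by simp
qed

lemma initial_K:
  fixes f :: "(nat list, 'k::field) mpoly"
  assumes "f \<in> K" "f \<noteq> 0"
  shows "initial sigma_lex f = single (Max (supp f)) 1"
proof (rule initial_eq[OF assms(2)])
  show "length c = Suc n" if "u \<in> supp f" "c \<in> supp u" for u c
    using assms(1) E_length that by (auto simp: presentation_ideal_eq)
qed

text \<open>A normal leading monomial would be the largest in the support of \<open>f\<close> and at
  the same time the least in its fiber. It would thus be alone in its fiber within \<open>f\<close>,
  and its coefficient would survive in the image.\<close>

lemma leading_not_normal: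
  fixes f :: "(nat list, 'k::field) mpoly"
  assumes "f \<in> K" "f \<noteq> 0"
  shows "\<not> normal (Max (supp f))"
proof
  assume nrm: "normal (Max (supp f))"
  have f: "toric_map f = 0" "\<And>u. u \<in> supp f \<Longrightarrow> supp u \<subseteq> E" using assms(1) by (auto simp: presentation_ideal_eq)
  define u where "u = Max (supp f)"
  have u: "u \<in> supp f" unfolding u_def using assms(2) by (intro Max_in) simp_all
  have "{v \<in> supp f. toric_exp v = toric_exp u} = {u}"
  proof -
    have "v = u" if v: "v \<in> supp f" "toric_exp v = toric_exp u" for v
    proof (rule antisym)
      show "v \<le> u" unfolding u_def using v(1) by simp
      show "u \<le> v" using nf_le[OF f(2)[OF v(1)]] nf_normal[OF nrm] v(2) by (simp add: u_def)
    qed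
    then show ?thesis using u by blast
  qed
  then have "coef (toric_map f) (toric_exp u) = coef f u" by (simp add: coef_toric_map)
  then show False using f(1) u by (simp add: in_keys_iff)
qed

text \<open>A leading monomial of the presentation ideal contains a bad pair by
  \<open>leading_not_normal\<close>, and the exchange binomial built from that pair has its product
  as leading monomial.\<close>

theorem exchange_binomials_groebner_basis:
  "groebner_basis E sigma_lex (exchange_binomials (Suc n) E) (K :: (nat list, 'k::field) mpoly set)"
proof -
  interpret cring "mpoly_ring E :: (nat list, 'k) mpoly ring" by (rule cring_mpoly_ring)
  let ?G = "exchange_binomials (Suc n) E :: (nat list, 'k) mpoly set"
  have inK: "initial sigma_lex f \<in> carrier (mpoly_ring E)" if "f \<in> K - {0}" for f :: "(nat list, 'k) mpoly"
  proof -
    have "Max (supp f) \<in> supp f" using that by (intro Max_in) simp_all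
    then show ?thesis using that initial_K[of f] by (auto simp: presentation_ideal_eq carrier_mpoly_ring)
  qed
  have cK: "initial sigma_lex ` (K - {0}) \<subseteq> carrier (mpoly_ring E :: (nat list, 'k) mpoly ring)"
    using inK by blast
  have cG: "initial sigma_lex ` (?G - {0}) \<subseteq> carrier (mpoly_ring E)"
    using cK exchange_binomials_subset by blast
  have sub: "Idl\<^bsub>mpoly_ring E\<^esub> (initial sigma_lex ` (?G - {0})) \<subseteq> Idl\<^bsub>mpoly_ring E\<^esub> (initial sigma_lex ` (K - {0}))"
    by (rule genideal_minimal[OF genideal_ideal[OF cK]])
      (use genideal_self[OF cK] exchange_binomials_subset in blast)
  have "initial sigma_lex f \<in> Idl\<^bsub>mpoly_ring E\<^esub> (initial sigma_lex ` (?G - {0}))"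
    if f: "f \<in> K" "f \<noteq> 0" for f :: "(nat list, 'k) mpoly"
  proof -
    define u where "u = Max (supp f)"
    have "u \<in> supp f" unfolding u_def using f(2) by (intro Max_in) simp_all
    then have uE: "supp u \<subseteq> E" using f(1) by (simp add: presentation_ideal_eq)
    then obtain a0 b0 where ab0: "a0 \<in> supp u" "b0 \<in> supp u" "bad a0 b0"
      using leading_not_normal[OF f] by (auto simp: normal_def u_def)
    then obtain a b H where ab: "{a, b} = {a0, b0}" "a < b" "H \<subseteq> {..<Suc n}"
      "exchange (Suc n) H a b \<in> E" "exchange (Suc n) H b a \<in> E"
      "a < exchange (Suc n) H a b" "a < exchange (Suc n) H b a"
      using bad_exchange[of a0 b0] uE by blast
    have abu: "a \<in> supp u" "b \<in> supp u" using ab(1) ab0 by (auto simp: doubleton_eq_iff)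
    then have abE: "a \<in> E" "b \<in> E" using uE by blast+
    define p q where "p = exchange (Suc n) H a b" and "q = exchange (Suc n) H b a"
    define s t where "s = single a (1::nat) + single b 1" and "t = single p (1::nat) + single q 1"
    have "t < s" unfolding s_def t_def using exchange_less[of a b p q] ab by (simp add: p_def q_def)
    define g where "g = (exchange_binomial (Suc n) E H a b :: (nat list, 'k) mpoly)"
    have g: "g = single s 1 - single t 1"
      using ab(4,5) by (simp add: g_def exchange_binomial_def Let_def p_def q_def mvar_def mult_single s_def t_def)
    have supp_g: "supp g = {s, t}"
      using \<open>t < s\<close> by (auto simp: g in_keys_iff lookup_minus lookup_single when_def split: if_splits)
    then have "g \<noteq> 0" by auto
    then have gG: "g \<in> ?G" unfolding exchange_binomials_def g_def using ab(3) abE by blast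
    have "g \<in> K" using gG exchange_binomials_subset by blast
    then have "initial sigma_lex g = single s 1"
      using initial_K[of g] \<open>g \<noteq> 0\<close> \<open>t < s\<close> by (simp add: supp_g max.absorb1 less_imp_le)
    then have "single s 1 \<in> initial sigma_lex ` (?G - {0})"
      using gG \<open>g \<noteq> 0\<close> by (intro image_eqI[of _ _ g]) simp_all
    then have sI: "single s 1 \<in> Idl\<^bsub>mpoly_ring E\<^esub> (initial sigma_lex ` (?G - {0}))"
      using genideal_self[OF cG] by blast
    \<comment> \<open>The cofactor of the bad pair in \<open>u\<close>; subtraction is exact since
      \<open>a\<close> and \<open>b\<close> are distinct variables of \<open>u\<close>.\<close>
    define w where "w = u - single a 1 - single b 1"
    have "1 \<le> coef (u - single a 1) b"
      using abu ab(2) by (auto simp: lookup_minus lookup_single when_def in_keys_iff)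
    then have "single b 1 + w = u - single a 1" unfolding w_def by (rule single_add_minus)
    moreover have "single a 1 + (u - single a 1) = u"
      using abu(1) by (intro single_add_minus) (simp add: in_keys_iff)
    ultimately have u_eq: "u = s + w" unfolding s_def by (metis add.assoc)
    have "supp w \<subseteq> E" unfolding w_def by (meson order.trans supp_minus_nat uE)
    then have "single w 1 \<in> carrier (mpoly_ring E :: (nat list, 'k) mpoly ring)" by (simp add: carrier_mpoly_ring)
    then have "single s 1 \<otimes>\<^bsub>mpoly_ring E\<^esub> single w 1 \<in> Idl\<^bsub>mpoly_ring E\<^esub> (initial sigma_lex ` (?G - {0}))"
      by (rule ideal.I_r_closed[OF genideal_ideal[OF cG] sI])
    then show ?thesis using initial_K[OF f] by (simp add: mult_single u_eq flip: u_def)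
  qed
  then have "initial sigma_lex ` (K - {0}) \<subseteq> Idl\<^bsub>mpoly_ring E\<^esub> (initial sigma_lex ` (?G - {0}))" by blast
  then have "Idl\<^bsub>mpoly_ring E\<^esub> (initial sigma_lex ` (K - {0})) \<subseteq> Idl\<^bsub>mpoly_ring E\<^esub> (initial sigma_lex ` (?G - {0}))"
    by (rule genideal_minimal[OF genideal_ideal[OF cG]])
  then show ?thesis
    unfolding groebner_basis_def using sub ideal_K finite_exchange_binomials exchange_binomials_subset by blast
qed

end

theorem theorem5p7:
  fixes D :: "nat list set" and n m r :: nat
  assumes "1 \<le> n" and "1 \<le> r"
    and "ferrers_diagram n D" and "standardizable n D"
    and "\<forall>a\<in>D. \<forall>j\<in>set a. j \<le> m"
  shows "groebner_basis (extend_diagram D r) sigma_lex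
           (exchange_binomials (n + 1) (extend_diagram D r))
           (presentation_ideal D r :: (nat list, 'k::field) mpoly set) \<and>
         koszul (special_fiber n m r (ferrers_ideal n m D))
           (special_fiber_scalar n m r (ferrers_ideal n m D :: (xt, 'k) mpoly set))
           (special_fiber_component n m r (ferrers_ideal n m D))"
proof -
  interpret bounded_extended_diagram D n r m
    using assms(3-5) by unfold_locales
  show ?thesis
    using exchange_binomials_groebner_basis koszul_special_fiber by simp
qed

end
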